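(* Let $\lambda>1$ and let $T:\mathbb{S}^1\to\mathbb{S}^1$ be such that $|T'(x)|>\lambda$ for all $x\in\mathbb{S}^1$ and $T'$ belongs to the Denjoy–Carleman class $\mathcal{C}^M$. For every $\theta\in\,]1,\lambda[$ there are constants $C,A>0$ and a Hilbert space $\mathcal{H}$, continuously contained in $\mathcal{C}^\infty(\mathbb{S}^1)$ and containing the trigonometric polynomials as a dense subspace, such that the transfer operator $\mathcal{L}$ defines a compact operator from $\mathcal{H}$ to itself. Moreover, if $(\sigma_k)_{k\in\mathbb{N}}$ is the sequence of singular values of $\mathcal{L}$ acting on $\mathcal{H}$, then for every integer $k\ge1$ $$\sigma_k\le C\sup_{0<x\le\frac1k}\frac{w(Ax)}{w(\theta Ax)}.$$
   Context: $\mathbb{S}^1=\mathbb{R}/\mathbb{Z}$, $\mathbb{N}=\{0,1,2,\dots\}$. $M=(M_k)_{k\in\mathbb{N}}$ is a fixed non-decreasing, logarithmically convex sequence of positive reals with $M_0=1$ (logarithmically convex: $M_k^2\le M_{k-1}M_{k+1}$ for all $k\ge1$). A $\mathcal{C}^\infty$ function $f:\mathbb{S}^1\to\mathbb{C}$ belongs to $\mathcal{C}^M$ if there are $C,R>0$ with $|f^{(k)}(x)|\le CR^kk!M_k$ for all $k\in\mathbb{N}$, $x\in\mathbb{S}^1$. The function $w:\mathbb{R}_+^*\to\mathbb{R}_+^*$ is $w(x)=\inf_{k\in\mathbb{N}}x^kk!M_k$. The transfer operator is $\mathcal{L}\varphi(x)=\sum_{y:\,Ty=x}\frac{1}{|T'(y)|}\varphi(y)$.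 "Continuously contained" means linear subspace with continuous inclusion (usual Fréchet topology on $\mathcal{C}^\infty(\mathbb{S}^1)$). Trigonometric polynomials are finite linear combinations of $x\mapsto e^{2i\pi nx}$, $n\in\mathbb{Z}$. Singular values are listed in non-increasing order with multiplicity, indexed from $0$. *)

theory Defs
  imports "HOL-Analysis.Analysis" "HOL-Library.Function_Algebras"
begin

section \<open>Complex-valued functions as a complex vector space\<close>

abbreviation (input) fscale :: "complex \<Rightarrow> ('a \<Rightarrow> complex) \<Rightarrow> 'a \<Rightarrow> complex" where
  "fscale c f \<equiv> (\<lambda>x. c * f x)"

global_interpretation cfun: vector_space "fscale :: complex \<Rightarrow> ('a \<Rightarrow> complex) \<Rightarrow> _"
  by unfold_locales (auto simp: fun_eq_iff algebra_simps)


section \<open>Complex Hilbert spaces of functions\<close>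

text \<open>A complex inner product space whose carrier is a set of functions. The inner product is
  linear in the first argument; its values outside the carrier are irrelevant.\<close>

locale function_inner_space =
  fixes H :: "('a \<Rightarrow> complex) set" and ip :: "('a \<Rightarrow> complex) \<Rightarrow> ('a \<Rightarrow> complex) \<Rightarrow> complex"
  assumes subspace: "cfun.subspace H"
    and ip_add_left: "\<lbrakk>f \<in> H; g \<in> H; h \<in> H\<rbrakk> \<Longrightarrow> ip (f + g) h = ip f h + ip g h"
    and ip_scale_left: "\<lbrakk>f \<in> H; h \<in> H\<rbrakk> \<Longrightarrow> ip (fscale c f) h = c * ip f h"
    and ip_commute: "\<lbrakk>f \<in> H; g \<in> H\<rbrakk> \<Longrightarrow> ip g f = cnj (ip f g)"
    and ip_ge_zero: "f \<in> H \<Longrightarrow> 0 \<le> Re (ip f f)"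
    and ip_eq_zero: "\<lbrakk>f \<in> H; ip f f = 0\<rbrakk> \<Longrightarrow> f = 0"
begin

definition hnorm :: "('a \<Rightarrow> complex) \<Rightarrow> real" where
  "hnorm f = sqrt (Re (ip f f))"

text \<open>The metric space locale demands symmetry and non-negativity off the carrier as well, hence
  the dummy value there.\<close>

definition hdist :: "('a \<Rightarrow> complex) \<Rightarrow> ('a \<Rightarrow> complex) \<Rightarrow> real" where
  "hdist f g = (if f \<in> H \<and> g \<in> H then hnorm (f - g) else 0)"

lemma ip_self_real: "f \<in> H \<Longrightarrow> ip f f = of_real (Re (ip f f))"
  using ip_commute[of f f] by (simp add: complex_eq_iff)

lemma ip_add_right: "\<lbrakk>f \<in> H; g \<in> H; h \<in> H\<rbrakk> \<Longrightarrow> ip h (f + g) = ip h f + ip h g"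
  using ip_commute[of "f + g" h] ip_commute[of f h] ip_commute[of g h]
  by (simp add: ip_add_left cfun.subspace_add[OF subspace])

lemma ip_scale_right: "\<lbrakk>f \<in> H; h \<in> H\<rbrakk> \<Longrightarrow> ip h (fscale c f) = cnj c * ip h f"
  using ip_commute[of "fscale c f" h] ip_commute[of f h]
  by (simp add: ip_scale_left cfun.subspace_scale[OF subspace])

lemma Re_ip_scale_add:
  assumes "f \<in> H" "g \<in> H"
  shows "Re (ip (f + fscale c g) (f + fscale c g)) =
    Re (ip f f) + 2 * Re (cnj c * ip f g) + (cmod c)\<^sup>2 * Re (ip g g)"
proof -
  have [simp]: "fscale c g \<in> H" using assms cfun.subspace_scale[OF subspace] by blast
  have [simp]: "f + fscale c g \<in> H" using assms cfun.subspace_add[OF subspace] by auto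
  have "ip (f + fscale c g) (f + fscale c g) =
      ip f f + cnj c * ip f g + c * cnj (ip f g) + c * cnj c * ip g g"
    using assms ip_commute[of f g]
    by (simp add: ip_add_left ip_add_right ip_scale_left ip_scale_right algebra_simps)
  moreover have "c * cnj c = of_real ((cmod c)\<^sup>2)"
    by (metis complex_norm_square of_real_power)
  moreover have "Re (c * cnj (ip f g)) = Re (cnj c * ip f g)"
    by simp
  ultimately show ?thesis
    by (simp del: of_real_power)
qed

lemma Cauchy_Schwarz:
  assumes "f \<in> H" "g \<in> H"
  shows "(cmod (ip f g))\<^sup>2 \<le> Re (ip f f) * Re (ip g g)"
proof (cases "g = 0")
  case True
  have "ip f g = 0" using assms True ip_scale_right[of g f 0] by (simp add: zero_fun_def)
  moreover have "ip g g = 0" using assms True ip_scale_right[of g g 0] by (simp add: zero_fun_def)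
  ultimately show ?thesis by simp
next
  case False
  define G where "G = Re (ip g g)"
  have G: "G > 0" using False assms ip_eq_zero[of g] ip_ge_zero[of g] ip_self_real[of g]
    unfolding G_def by (metis less_eq_real_def of_real_0)
  define c where "c = - ip f g / of_real G"
  have "f + fscale c g \<in> H"
    using assms cfun.subspace_add[OF subspace] cfun.subspace_scale[OF subspace] by blast
  then have "0 \<le> Re (ip f f) + 2 * Re (cnj c * ip f g) + (cmod c)\<^sup>2 * G"
    using ip_ge_zero Re_ip_scale_add[OF assms] unfolding G_def by metis
  moreover have "cnj c * ip f g = - of_real ((cmod (ip f g))\<^sup>2 / G)"
    unfolding c_def using complex_norm_square[of "ip f g"] by (simp add: mult.commute)
  moreover have "(cmod c)\<^sup>2 = (cmod (ip f g))\<^sup>2 / G\<^sup>2"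
    unfolding c_def by (simp add: norm_divide power_divide)
  ultimately have "0 \<le> Re (ip f f) - (cmod (ip f g))\<^sup>2 / G"
    using G by (simp add: power2_eq_square del: of_real_divide of_real_power)
  then show ?thesis using G unfolding G_def by (simp add: field_simps)
qed

lemma hnorm_triangle:
  assumes "f \<in> H" "g \<in> H"
  shows "hnorm (f + g) \<le> hnorm f + hnorm g"
proof -
  have "Re (ip f g) \<le> cmod (ip f g)" by (rule complex_Re_le_cmod)
  also have "\<dots> \<le> hnorm f * hnorm g"
    using real_sqrt_le_mono[OF Cauchy_Schwarz[OF assms]] by (simp add: hnorm_def real_sqrt_mult)
  finally have "Re (ip (f + g) (f + g)) \<le> (hnorm f + hnorm g)\<^sup>2"
    using Re_ip_scale_add[OF assms, of 1] assms[THEN ip_ge_zero]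
    by (simp add: hnorm_def power2_sum)
  moreover have "0 \<le> hnorm f + hnorm g"
    using assms by (simp add: hnorm_def ip_ge_zero)
  ultimately show ?thesis
    unfolding hnorm_def[of "f + g"] by (simp add: real_le_lsqrt)
qed

sublocale Metric_space H hdist
proof
  fix f g
  show "0 \<le> hdist f g"
    by (simp add: hdist_def hnorm_def ip_ge_zero cfun.subspace_diff[OF subspace])
  show "hdist f g = hdist g f"
  proof (cases "f \<in> H \<and> g \<in> H")
    case True
    then have d: "f - g \<in> H" "g - f \<in> H"
      using cfun.subspace_diff[OF subspace] by auto
    have "g - f = fscale (-1) (f - g)" by (auto simp: fun_eq_iff)
    then have "ip (g - f) (g - f) = ip (f - g) (f - g)"
      using d ip_scale_left[of "f - g" "g - f" "-1"] ip_scale_right[of "f - g" "f - g" "-1"]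
      by simp
    then show ?thesis by (simp add: hdist_def hnorm_def)
  qed (auto simp: hdist_def)
next
  fix f g assume fg: "f \<in> H" "g \<in> H"
  then have "f - g \<in> H" using cfun.subspace_diff[OF subspace] by auto
  moreover have "ip 0 0 = 0"
    using ip_scale_left[of f 0 0] fg cfun.subspace_0[OF subspace] by (simp add: zero_fun_def)
  ultimately show "hdist f g = 0 \<longleftrightarrow> f = g"
    using ip_eq_zero[of "f - g"] ip_self_real[of "f - g"] fg
    by (auto simp: hdist_def hnorm_def)
next
  fix f g h assume *: "f \<in> H" "g \<in> H" "h \<in> H"
  then show "hdist f h \<le> hdist f g + hdist g h"
    using hnorm_triangle[of "f - g" "g - h"] cfun.subspace_diff[OF subspace]
    by (simp add: hdist_def)
qed

text \<open>A compact operator maps bounded sets to relatively compact sets.\<close>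

definition compact_operator :: "(('a \<Rightarrow> complex) \<Rightarrow> ('a \<Rightarrow> complex)) \<Rightarrow> bool" where
  "compact_operator A \<longleftrightarrow>
    (\<forall>f\<in>H. A f \<in> H) \<and>
    (\<forall>f\<in>H. \<forall>g\<in>H. A (f + g) = A f + A g) \<and>
    (\<forall>c. \<forall>f\<in>H. A (fscale c f) = fscale c (A f)) \<and>
    (\<forall>B. mbounded B \<longrightarrow> compactin mtopology (mtopology closure_of (A ` B)))"

definition hadjoint :: "(('a \<Rightarrow> complex) \<Rightarrow> ('a \<Rightarrow> complex)) \<Rightarrow> ('a \<Rightarrow> complex) \<Rightarrow> ('a \<Rightarrow> complex)" where
  "hadjoint A g = (THE h. h \<in> H \<and> (\<forall>f\<in>H. ip (A f) g = ip f h))"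

text \<open>The multiplicity of \<open>s > 0\<close> as a singular value of \<open>A\<close> is the dimension of the eigenspace of
  \<open>A\<^sup>* A\<close> for the eigenvalue \<open>s\<^sup>2\<close>; it is \<open>0\<close> iff \<open>s\<close> is not a singular value. For compact \<open>A\<close> these
  eigenspaces are finite-dimensional, and only finitely many \<open>s\<close> above any positive bound have
  non-zero multiplicity.\<close>

definition singular_multiplicity :: "(('a \<Rightarrow> complex) \<Rightarrow> ('a \<Rightarrow> complex)) \<Rightarrow> real \<Rightarrow> nat" where
  "singular_multiplicity A s =
    cfun.dim {f \<in> H. hadjoint A (A f) = fscale (of_real (s\<^sup>2)) f}"

text \<open>The entry with index \<open>k\<close> (starting at \<open>0\<close>) of the non-increasing list of the singular values,
  each repeated according to its multiplicity and padded with zeros: it is the largest \<open>s\<close>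
  such that more than \<open>k\<close> singular values, counted with multiplicity, are at least \<open>s\<close>.
  Each singular value \<open>t\<close> is counted through the pairs \<open>(t, j)\<close> with \<open>j\<close> below the
  multiplicity of \<open>t\<close>.\<close>

definition singular_value :: "(('a \<Rightarrow> complex) \<Rightarrow> ('a \<Rightarrow> complex)) \<Rightarrow> nat \<Rightarrow> real" where
  "singular_value A k =
    Sup (insert 0 {s. 0 < s \<and> k < card {(t, j). s \<le> t \<and> j < singular_multiplicity A t}})"

text \<open>Conversely, any such list agrees with the sequence just defined.\<close>

lemma singular_value_eqI:
  assumes "antimono \<sigma>" "\<sigma> \<longlonglongrightarrow> 0"
    and mult: "\<And>t. 0 < t \<Longrightarrow> card {i. \<sigma> i = t} = singular_multiplicity A t"
  shows "singular_value A k = \<sigma> k"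
proof -
  have nonneg: "0 \<le> \<sigma> i" for i
    using decseq_ge[of \<sigma> 0 i] assms(1,2) by (simp add: decseq_def antimono_def)
  have *: "k < card {(t, j). s \<le> t \<and> j < singular_multiplicity A t} \<longleftrightarrow> s \<le> \<sigma> k" if s: "0 < s" for s
  proof -
    have "eventually (\<lambda>i. \<sigma> i < s) sequentially"
      using assms(2) s by (rule order_tendstoD)
    then obtain N where N: "\<And>i. N \<le> i \<Longrightarrow> \<sigma> i < s"
      by (auto simp: eventually_sequentially)
    define I where "I = {i. s \<le> \<sigma> i}"
    have finI: "finite I"
      using N by (intro finite_subset[of I "{..<N}"]) (auto simp: I_def not_le[symmetric])
    have "{(t, j). s \<le> t \<and> j < singular_multiplicity A t} =
        (SIGMA t:\<sigma> ` I. {..<singular_multiplicity A t})" (is "?L = ?R")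
    proof
      show "?L \<subseteq> ?R"
      proof clarsimp
        fix t j assume t: "s \<le> t" "j < singular_multiplicity A t"
        then have "card {i. \<sigma> i = t} \<noteq> 0" using mult s by simp
        then obtain i where "\<sigma> i = t" by (metis (mono_tags, lifting) Collect_empty_eq card.empty)
        then show "t \<in> \<sigma> ` I" using t by (auto simp: I_def)
      qed
    qed (auto simp: I_def)
    then have "card ?L = (\<Sum>t\<in>\<sigma> ` I. singular_multiplicity A t)"
      using finI by simp
    also have "\<dots> = (\<Sum>t\<in>\<sigma> ` I. card {i \<in> I. \<sigma> i = t})"
    proof (rule sum.cong)
      fix t assume "t \<in> \<sigma> ` I"
      then have "0 < t" and "{i \<in> I. \<sigma> i = t} = {i. \<sigma> i = t}"
        using s by (auto simp: I_def)
      then show "singular_multiplicity A t = card {i \<in> I. \<sigma> i = t}"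
        using mult by simp
    qed simp
    also have "\<dots> = card I"
      using sum.image_gen[OF finI, of "\<lambda>_. 1::nat" \<sigma>] by simp
    finally have c: "card ?L = card I" .
    show ?thesis
    proof
      assume "k < card ?L"
      then have "\<not> I \<subseteq> {..<k}"
        using c card_mono[of "{..<k}" I] by auto
      then obtain i where "i \<in> I" "k \<le> i" by (meson lessThan_iff not_less subsetI)
      then show "s \<le> \<sigma> k" using antimonoD[OF assms(1)] by (force simp: I_def)
    next
      assume "s \<le> \<sigma> k"
      then have "{..k} \<subseteq> I" using antimonoD[OF assms(1)] by (force simp: I_def)
      then show "k < card ?L"
        using c card_mono[OF finI, of "{..k}"] by simp
    qed
  qed
  have "insert 0 {s. 0 < s \<and> k < card {(t, j). s \<le> t \<and> j < singular_multiplicity A t}} = {0..\<sigma> k}"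
    using nonneg[of k] by (simp add: * set_eq_iff cong: conj_cong) (auto simp: less_le)
  then show ?thesis
    unfolding singular_value_def using nonneg[of k] by simp
qed

end

locale function_hilbert_space = function_inner_space +
  assumes complete: mcomplete


section \<open>The circle and smooth functions on it\<close>

quotient_type circle = real / "\<lambda>x y. x - y \<in> \<int>"
proof (rule equivpI)
  show "symp (\<lambda>x y::real. x - y \<in> \<int>)"
    by (metis (no_types, lifting) Ints_minus minus_diff_eq sympI)
  show "transp (\<lambda>x y::real. x - y \<in> \<int>)"
    by (rule transpI) (metis Ints_add diff_add_cancel add_diff_eq)
qed (auto intro: reflpI)

text \<open>Functions on the circle are differentiated through their 1-periodic pullbacks to the real
  line: \<open>circle_deriv f k x\<close> is the \<open>k\<close>-th derivative of \<open>f\<close> at the class of \<open>x\<close>.\<close>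

definition circle_deriv :: "(circle \<Rightarrow> complex) \<Rightarrow> nat \<Rightarrow> real \<Rightarrow> complex" where
  "circle_deriv f k = ((\<lambda>g x. vector_derivative g (at x)) ^^ k) (f \<circ> abs_circle)"

definition smooth_functions :: "(circle \<Rightarrow> complex) set" where
  "smooth_functions = {f. \<forall>k x. circle_deriv f k differentiable at x}"

definition smooth_seminorm :: "nat \<Rightarrow> (circle \<Rightarrow> complex) \<Rightarrow> real" where
  "smooth_seminorm k f = (SUP x. cmod (circle_deriv f k x))"

definition smooth_topology :: "(circle \<Rightarrow> complex) topology" where
  "smooth_topology = topology_generated_by
    {{g \<in> smooth_functions. smooth_seminorm k (g - f) < e} | f k e. f \<in> smooth_functions \<and> 0 < e}"

lift_definition circle_character :: "int \<Rightarrow> circle \<Rightarrow> complex" is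
  "\<lambda>n x. exp (2 * \<i> * of_real pi * of_int n * of_real x)"
proof -
  fix n :: int and x y :: real
  assume "x - y \<in> \<int>"
  then obtain m where "x = y + of_int m" by (metis Ints_cases add.commute diff_add_cancel)
  then have "2 * \<i> * of_real pi * of_int n * of_real x =
      2 * \<i> * of_real pi * of_int n * of_real y + (2 * of_int (n * m) * of_real pi) * \<i>"
    by (simp add: algebra_simps)
  then show "exp (2 * \<i> * of_real pi * of_int n * of_real x) =
      exp (2 * \<i> * of_real pi * of_int n * of_real y)"
    using exp_integer_2pi[of "of_int (n * m)"] by (simp add: exp_add)
qed

definition trigonometric_polynomials :: "(circle \<Rightarrow> complex) set" where
  "trigonometric_polynomials = cfun.span (range circle_character)"

text \<open>A circle map is differentiable when it is covered by a differentiable map of the real line;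
  \<open>T'\<close> is the derivative of any such lift, which does not depend on the lift.\<close>

definition circle_map_has_derivative :: "(circle \<Rightarrow> circle) \<Rightarrow> (circle \<Rightarrow> real) \<Rightarrow> bool" where
  "circle_map_has_derivative T T' \<longleftrightarrow>
    (\<exists>F. \<forall>x. T (abs_circle x) = abs_circle (F x) \<and>
      (F has_real_derivative T' (abs_circle x)) (at x))"

definition transfer_operator ::
  "(circle \<Rightarrow> circle) \<Rightarrow> (circle \<Rightarrow> real) \<Rightarrow> (circle \<Rightarrow> complex) \<Rightarrow> circle \<Rightarrow> complex" where
  "transfer_operator T T' \<phi> x = (\<Sum>y | T y = x. of_real (1 / \<bar>T' y\<bar>) * \<phi> y)"


section \<open>Denjoy--Carleman classes\<close>

definition denjoy_carleman :: "(nat \<Rightarrow> real) \<Rightarrow> (circle \<Rightarrow> complex) set" where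
  "denjoy_carleman M = {f \<in> smooth_functions.
    \<exists>C>0. \<exists>R>0. \<forall>k x. cmod (circle_deriv f k x) \<le> C * R ^ k * fact k * M k}"

definition weight_function :: "(nat \<Rightarrow> real) \<Rightarrow> real \<Rightarrow> real" where
  "weight_function M x = (INF k. x ^ k * fact k * M k)"

end

theory Submission
  imports Defs "HOL-Complex_Analysis.Great_Picard"
begin

text \<open>Expansion of \<open>T\<close> makes the transfer operator \<open>L\<close> contract derivatives. Let \<open>F\<close> be a lift of
\<open>T\<close> to the real line, \<open>u = 1 / F'\<close>, and \<open>D\<close> the differentiation. The Jacobian factor in \<open>L\<close> is the
derivative of the inverse branches, so \<open>(L f)' = L (D (u f))\<close> and the \<open>k\<close>-th derivative of \<open>L f\<close> is
\<open>L ((D u)^k f)\<close> (lemma \<open>iter_deriv_transfer\<close>). When \<open>D u\<close> is expanded by the Leibniz rule, the term in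
which \<open>u\<close> is not differentiated gains a factor \<open>|u| < 1 / lam\<close>. Suppose that the derivatives of
\<open>f\<close> are of size \<open>B^j j! M j\<close> and those of \<open>u\<close> of size \<open>R^i i! M i\<close>, with \<open>B\<close> much larger than \<open>R\<close>.
By log-convexity the terms in which \<open>u\<close> is differentiated \<open>i\<close> times then carry
a factor \<open>(R / B)^i\<close>, and their sum is small. Hence the \<open>k\<close>-th derivative of \<open>L f\<close> is of size
\<open>(p B)^k k! M k\<close> with \<open>p\<close> as close to \<open>1 / lam\<close> as desired, in particular with \<open>p \<theta> < 1\<close>
(lemma \<open>twisted_deriv_power_bound\<close>). The sizes are measured in \<open>L^2\<close>: derivatives and
Fourier coefficients then control each other without any loss of derivatives, which matters because
\<open>M (k + 1) / M k\<close> may grow arbitrarily fast.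

The Hilbert space \<open>H\<close> consists of the functions whose Fourier coefficients are square summable with
the weights \<open>W n = 1 / w (B / (2 pi |n|))\<close>; these weights are the suprema over \<open>k\<close> of
\<open>(2 pi |n|)^k / (B^k k! M k)\<close>. Because \<open>p \<theta> < 1\<close>, the estimates for all \<open>k\<close> can be
summed (lemma \<open>sum_fourier_weight_le\<close>), and \<open>L\<close> maps \<open>H\<close> boundedly into the smaller space with the
weights \<open>V n = 1 / w (B / (2 pi \<theta> |n|))\<close>. On \<open>H\<close> the operator is thus a
bounded map followed by the diagonal inclusion with entries \<open>W n / V n\<close>. The entries tend to
\<open>0\<close>, so \<open>L\<close> is compact. On the functions \<open>f\<close> for which the coefficients of \<open>L f\<close> with
\<open>|n| < k / 2\<close> vanish, the norm of \<open>L\<close> is at most a constant times the supremum of the remaining entries;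
these are at most \<open>k\<close> linear conditions, so the min-max principle (lemmas \<open>singular_value_le\<close> and
\<open>smoothing_operator_singular_value\<close>) bounds the singular value with index \<open>k\<close>. Since
\<open>1 / |n|\<close> runs up to \<open>2 / k\<close> there, the constant \<open>A\<close> is \<open>2 B / (2 pi \<theta>)\<close>.\<close>

section \<open>Inner product spaces of functions and singular values\<close>

text \<open>Gaussian elimination: an unknown that occurs in the equation \<open>m\<close> is solved for and substituted into
the other equations.\<close>

lemma homogeneous_system_nontrivial_solution:
  fixes a :: "'i \<Rightarrow> 'j \<Rightarrow> 'k::field"
  assumes "finite F" "finite P" "card F < card P"
  shows "\<exists>x. (\<exists>p\<in>P. x p \<noteq> 0) \<and> (\<forall>n\<in>F. (\<Sum>p\<in>P. x p * a n p) = 0)"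
  using assms
proof (induction F arbitrary: P a rule: finite_induct)
  case empty
  then obtain p where "p \<in> P" by (metis card.empty all_not_in_conv less_irrefl)
  then show ?case by (intro exI[of _ "\<lambda>_. 1"]) auto
next
  case (insert m F)
  show ?case
  proof (cases "\<forall>p\<in>P. a m p = 0")
    case True
    obtain x where "\<exists>p\<in>P. x p \<noteq> 0" "\<forall>n\<in>F. (\<Sum>p\<in>P. x p * a n p) = 0"
      using insert.IH[of P a] insert.prems insert.hyps by auto
    then show ?thesis using True by (intro exI[of _ x]) auto
  next
    case False
    then obtain q where q: "q \<in> P" "a m q \<noteq> 0" by auto
    define b where "b n p = a n p - a n q * a m p / a m q" for n p
    have "card F < card (P - {q})"
      using insert.prems insert.hyps q by simp
    then obtain x where x: "\<exists>p\<in>P - {q}. x p \<noteq> 0" "\<forall>n\<in>F. (\<Sum>p\<in>P - {q}. x p * b n p) = 0"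
      using insert.IH[of "P - {q}" b] insert.prems by auto
    define S where "S = (\<Sum>p\<in>P - {q}. x p * a m p)"
    define y where "y = x(q := - S / a m q)"
    have split: "(\<Sum>p\<in>P. y p * a n p) = (\<Sum>p\<in>P - {q}. x p * a n p) - S / a m q * a n q" for n
      using q insert.prems by (simp add: sum.remove[of P q] y_def)
    have "(\<Sum>p\<in>P. y p * a n p) = 0" if "n \<in> insert m F" for n
    proof (cases "n = m")
      case True
      then show ?thesis using q by (simp add: split S_def)
    next
      case False
      then have "(\<Sum>p\<in>P - {q}. x p * b n p) = 0" using x that by auto
      moreover have "(\<Sum>p\<in>P - {q}. x p * b n p) =
          (\<Sum>p\<in>P - {q}. x p * a n p) - (a n q / a m q) * (\<Sum>p\<in>P - {q}. x p * a m p)"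
        unfolding b_def sum_distrib_left sum_subtractf[symmetric]
        by (intro sum.cong) (auto simp: algebra_simps)
      ultimately show ?thesis unfolding split by (simp add: S_def)
    qed
    moreover have "\<exists>p\<in>P. y p \<noteq> 0" using x(1) by (auto simp: y_def)
    ultimately show ?thesis by blast
  qed
qed

context function_inner_space
begin

lemma zero_mem: "0 \<in> H"
  by (rule cfun.subspace_0[OF subspace])

lemma add_mem: "\<lbrakk>f \<in> H; g \<in> H\<rbrakk> \<Longrightarrow> f + g \<in> H"
  by (rule cfun.subspace_add[OF subspace])

lemma diff_mem: "\<lbrakk>f \<in> H; g \<in> H\<rbrakk> \<Longrightarrow> f - g \<in> H"
  by (rule cfun.subspace_diff[OF subspace])

lemma scale_mem: "f \<in> H \<Longrightarrow> fscale c f \<in> H"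
  by (rule cfun.subspace_scale[OF subspace])

lemma sum_mem: "(\<And>i. i \<in> I \<Longrightarrow> f i \<in> H) \<Longrightarrow> sum f I \<in> H"
  by (rule cfun.subspace_sum[OF subspace])

lemma ip_zero_left: "g \<in> H \<Longrightarrow> ip 0 g = 0"
  using ip_add_left[of 0 0 g] zero_mem by simp

lemma ip_zero_right: "g \<in> H \<Longrightarrow> ip g 0 = 0"
  using ip_add_right[of 0 0 g] zero_mem by simp

lemma ip_diff_right: "\<lbrakk>f \<in> H; g \<in> H; h \<in> H\<rbrakk> \<Longrightarrow> ip h (f - g) = ip h f - ip h g"
  using ip_add_right[of "f - g" g h] diff_mem[of f g] by simp

lemma ip_sum_left:
  "\<lbrakk>\<And>i. i \<in> I \<Longrightarrow> f i \<in> H; h \<in> H\<rbrakk> \<Longrightarrow> ip (sum f I) h = (\<Sum>i\<in>I. ip (f i) h)"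
  by (induction I rule: infinite_finite_induct)
    (auto simp: ip_zero_left ip_add_left sum_mem)

lemma ip_sum_right:
  "\<lbrakk>\<And>i. i \<in> I \<Longrightarrow> f i \<in> H; h \<in> H\<rbrakk> \<Longrightarrow> ip h (sum f I) = (\<Sum>i\<in>I. ip h (f i))"
  by (induction I rule: infinite_finite_induct)
    (auto simp: ip_zero_right ip_add_right sum_mem)

lemma hnorm_nonneg: "f \<in> H \<Longrightarrow> 0 \<le> hnorm f"
  by (simp add: hnorm_def ip_ge_zero)

lemma hnorm_sq: "f \<in> H \<Longrightarrow> (hnorm f)\<^sup>2 = Re (ip f f)"
  by (simp add: hnorm_def ip_ge_zero)

lemma hnorm_pos: "\<lbrakk>f \<in> H; f \<noteq> 0\<rbrakk> \<Longrightarrow> 0 < hnorm f"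
  using ip_eq_zero[of f] ip_ge_zero[of f] ip_self_real[of f]
  by (metis hnorm_def less_eq_real_def of_real_0 real_sqrt_gt_0_iff)

lemma hnorm_zero: "hnorm 0 = 0"
  by (simp add: hnorm_def ip_zero_left zero_mem)

lemma hnorm_sum_le:
  "(\<And>i. i \<in> I \<Longrightarrow> f i \<in> H) \<Longrightarrow> hnorm (sum f I) \<le> (\<Sum>i\<in>I. hnorm (f i))"
proof (induction I rule: infinite_finite_induct)
  case (insert i I)
  then have "hnorm (f i + sum f I) \<le> hnorm (f i) + hnorm (sum f I)"
    by (intro hnorm_triangle sum_mem) auto
  moreover have "hnorm (sum f I) \<le> (\<Sum>i\<in>I. hnorm (f i))"
    using insert.IH insert.prems by blast
  ultimately show ?case
    unfolding sum.insert[OF insert.hyps] by linarith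
qed (simp_all add: hnorm_zero)

lemma hnorm_diff_commute: "\<lbrakk>f \<in> H; g \<in> H\<rbrakk> \<Longrightarrow> hnorm (f - g) = hnorm (g - f)"
  using commute[of f g] by (simp add: hdist_def)

lemma Pythagoras_orthonormal:
  assumes e: "\<And>i. i \<in> I \<Longrightarrow> e i \<in> H"
    and ortho: "\<And>i j. \<lbrakk>i \<in> I; j \<in> I\<rbrakk> \<Longrightarrow> ip (e i) (e j) = (if i = j then 1 else 0)"
    and "finite I"
  shows "(hnorm (\<Sum>i\<in>I. fscale (a i) (e i)))\<^sup>2 = (\<Sum>i\<in>I. (cmod (a i))\<^sup>2)"
proof -
  have mem: "(\<Sum>i\<in>I. fscale (a i) (e i)) \<in> H" by (intro sum_mem scale_mem e)
  have "ip (\<Sum>i\<in>I. fscale (a i) (e i)) (\<Sum>i\<in>I. fscale (a i) (e i)) =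
      (\<Sum>i\<in>I. ip (fscale (a i) (e i)) (\<Sum>j\<in>I. fscale (a j) (e j)))"
    using e mem by (intro ip_sum_left scale_mem)
  also have "\<dots> = (\<Sum>i\<in>I. \<Sum>j\<in>I. a i * (cnj (a j) * ip (e i) (e j)))"
    using e mem by (intro sum.cong refl)
      (simp add: ip_scale_left ip_sum_right ip_scale_right scale_mem sum_distrib_left)
  also have "\<dots> = (\<Sum>i\<in>I. \<Sum>j\<in>I. if i = j then a i * cnj (a i) else 0)"
    by (intro sum.cong) (auto simp: ortho)
  also have "\<dots> = of_real (\<Sum>i\<in>I. (cmod (a i))\<^sup>2)"
    using \<open>finite I\<close> by (simp add: complex_norm_square del: of_real_power)
  finally show ?thesis using hnorm_sq[OF mem] by simp
qed

lemma Bessel_inequality: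
  assumes e: "\<And>i. i \<in> I \<Longrightarrow> e i \<in> H"
    and ortho: "\<And>i j. \<lbrakk>i \<in> I; j \<in> I\<rbrakk> \<Longrightarrow> ip (e i) (e j) = (if i = j then 1 else 0)"
    and "finite I" and f: "f \<in> H"
  shows "(\<Sum>i\<in>I. (cmod (ip f (e i)))\<^sup>2) \<le> (hnorm f)\<^sup>2"
proof -
  define p where "p = (\<Sum>i\<in>I. fscale (ip f (e i)) (e i))"
  define S where "S = (\<Sum>i\<in>I. (cmod (ip f (e i)))\<^sup>2)"
  have p: "p \<in> H" unfolding p_def by (intro sum_mem scale_mem e)
  have "ip f p = (\<Sum>i\<in>I. cnj (ip f (e i)) * ip f (e i))"
    unfolding p_def using e f by (simp add: ip_sum_right ip_scale_right scale_mem)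
  also have "\<dots> = of_real S"
    unfolding S_def by (simp add: complex_norm_square mult.commute del: of_real_power)
  finally have fp: "ip f p = of_real S" .
  have pp: "(hnorm p)\<^sup>2 = S"
    unfolding p_def S_def by (rule Pythagoras_orthonormal) (use assms in auto)
  have "S \<ge> 0" unfolding S_def by (simp add: sum_nonneg)
  have "(cmod (ip f p))\<^sup>2 \<le> (hnorm f)\<^sup>2 * S"
    using Cauchy_Schwarz[OF f p] hnorm_sq[OF f] hnorm_sq[OF p] pp by simp
  then have "S * S \<le> (hnorm f)\<^sup>2 * S"
    unfolding fp by (simp add: power2_eq_square)
  then show ?thesis using \<open>S \<ge> 0\<close> unfolding S_def[symmetric]
    by (cases "S = 0") auto
qed

text \<open>The easy half of the min-max principle. If more than \<open>k\<close> singular values were at least \<open>s\<close>, the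
eigenvectors of \<open>A\<^sup>* A\<close> belonging to them would span a space of dimension greater than \<open>k\<close> on which \<open>A\<close>
expands norms at least by the factor \<open>s\<close>; the conditions \<open>l n f = 0\<close>, at most \<open>k\<close> in number, leave a
nonzero vector in this space, on which \<open>A\<close> expands at most by \<open>\<epsilon>\<close>.\<close>

lemma singular_value_le:
  fixes l :: "'n \<Rightarrow> ('a \<Rightarrow> complex) \<Rightarrow> complex"
  assumes maps: "\<And>f. f \<in> H \<Longrightarrow> A f \<in> H"
    and add: "\<And>f g. \<lbrakk>f \<in> H; g \<in> H\<rbrakk> \<Longrightarrow> A (f + g) = A f + A g"
    and scale: "\<And>f c. f \<in> H \<Longrightarrow> A (fscale c f) = fscale c (A f)"
    and adj_mem: "\<And>g. g \<in> H \<Longrightarrow> hadjoint A g \<in> H"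
    and adj: "\<And>f g. \<lbrakk>f \<in> H; g \<in> H\<rbrakk> \<Longrightarrow> ip (A f) g = ip f (hadjoint A g)"
    and F: "finite F" "card F \<le> k"
    and l_add: "\<And>n f g. \<lbrakk>n \<in> F; f \<in> H; g \<in> H\<rbrakk> \<Longrightarrow> l n (f + g) = l n f + l n g"
    and l_scale: "\<And>n f c. \<lbrakk>n \<in> F; f \<in> H\<rbrakk> \<Longrightarrow> l n (fscale c f) = c * l n f"
    and small: "\<And>f. \<lbrakk>f \<in> H; \<And>n. n \<in> F \<Longrightarrow> l n f = 0\<rbrakk> \<Longrightarrow> hnorm (A f) \<le> \<epsilon> * hnorm f"
    and \<epsilon>: "0 \<le> \<epsilon>"
  shows "singular_value A k \<le> \<epsilon>"
proof -
  have "s \<le> \<epsilon>" if s: "0 < s" and k: "k < card {(t, j). s \<le> t \<and> j < singular_multiplicity A t}" for s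
  proof -
    define P where "P = {(t, j). s \<le> t \<and> j < singular_multiplicity A t}"
    have finP: "finite P" using k card.infinite unfolding P_def by fastforce
    define Ts where "Ts = fst ` P"
    have finTs: "finite Ts" using finP by (simp add: Ts_def)
    have P_eq: "P = (SIGMA t:Ts. {..<singular_multiplicity A t})"
      by (force simp: Ts_def P_def)
    have Ts: "s \<le> t" "0 < singular_multiplicity A t" if "t \<in> Ts" for t
      using that by (auto simp: Ts_def P_def)
    define E where "E t = {f \<in> H. hadjoint A (A f) = fscale (of_real (t\<^sup>2)) f}" for t
    \<comment> \<open>the eigenvalue equation tested against all \<open>A g\<close>: in this form it obviously defines a
      subspace, so it passes from the basis vectors in \<open>E t\<close> to their linear combinations\<close>
    define Q where "Q t = {f \<in> H. \<forall>g\<in>H. ip (A g) (A f) = of_real (t\<^sup>2) * ip g f}" for t :: real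
    have EQ: "E t \<subseteq> Q t" for t
    proof
      fix f assume f: "f \<in> E t"
      then have fH: "f \<in> H" by (simp add: E_def)
      have "ip (A g) (A f) = of_real (t\<^sup>2) * ip g f" if g: "g \<in> H" for g
      proof -
        have "ip (A g) (A f) = ip g (hadjoint A (A f))" using adj[OF g maps[OF fH]] .
        also have "\<dots> = ip g (fscale (of_real (t\<^sup>2)) f)" using f by (simp add: E_def)
        also have "\<dots> = of_real (t\<^sup>2) * ip g f" using ip_scale_right[OF fH g] by simp
        finally show ?thesis .
      qed
      then show "f \<in> Q t" using fH by (simp add: Q_def)
    qed
    have A0: "A 0 = 0" using add[of 0 0] zero_mem by simp
    have Qsub: "cfun.subspace (Q t)" for t
      unfolding cfun.subspace_def Q_def
      by (auto simp: zero_mem A0 ip_zero_right maps add_mem add ip_add_right scale_mem scale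
          ip_scale_right distrib_left)
    have "\<exists>B. B \<subseteq> E t \<and> cfun.independent B \<and> card B = singular_multiplicity A t" for t
      using cfun.basis_exists[of "E t"] unfolding singular_multiplicity_def E_def[symmetric] by metis
    then obtain B where B: "\<And>t. B t \<subseteq> E t" "\<And>t. cfun.independent (B t)"
        "\<And>t. card (B t) = singular_multiplicity A t"
      by metis
    have finB: "finite (B t)" if "t \<in> Ts" for t
      using Ts(2)[OF that] B(3)[of t] card_ge_0_finite by metis
    define PB where "PB = Sigma Ts B"
    have "card PB = card P"
      unfolding PB_def P_eq using finTs finB by (simp add: B(3))
    have finPB: "finite PB" unfolding PB_def using finTs finB by auto
    have "card F < card PB"
      using F k \<open>card PB = card P\<close> by (simp add: P_def)
    then obtain x where x: "\<exists>p\<in>PB. x p \<noteq> 0" "\<forall>n\<in>F. (\<Sum>p\<in>PB. x p * l n (snd p)) = 0"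
      using homogeneous_system_nontrivial_solution[OF F(1) finPB, of "\<lambda>n p. l n (snd p)"] by auto
    \<comment> \<open>the vector is kept split into its components in the mutually orthogonal eigenspaces\<close>
    define g where "g t = (\<Sum>b\<in>B t. fscale (x (t, b)) b)" for t
    have gQ: "g t \<in> Q t" for t
      unfolding g_def using B(1) EQ
      by (intro cfun.subspace_sum[OF Qsub] cfun.subspace_scale[OF Qsub]) blast
    then have gH: "g t \<in> H" for t by (auto simp: Q_def)
    have gQ': "ip (A h) (A (g t)) = of_real (t\<^sup>2) * ip h (g t)" if "h \<in> H" for h t
      using gQ[of t] that by (simp add: Q_def)
    define f where "f = sum g Ts"
    have fH: "f \<in> H" unfolding f_def by (intro sum_mem gH)
    have ortho: "ip (g t) (g t') = 0" if "t \<in> Ts" "t' \<in> Ts" "t \<noteq> t'" for t t'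
    proof -
      have "ip (A (g t)) (A (g t')) = of_real (t'\<^sup>2) * ip (g t) (g t')"
        by (rule gQ'[OF gH])
      moreover have "ip (A (g t)) (A (g t')) = of_real (t\<^sup>2) * ip (g t) (g t')"
      proof -
        have "ip (A (g t)) (A (g t')) = cnj (ip (A (g t')) (A (g t)))"
          by (rule ip_commute) (intro maps gH)+
        also have "ip (A (g t')) (A (g t)) = of_real (t\<^sup>2) * ip (g t') (g t)"
          by (rule gQ'[OF gH])
        also have "ip (g t') (g t) = cnj (ip (g t) (g t'))"
          by (rule ip_commute) (rule gH)+
        finally show ?thesis by simp
      qed
      ultimately have "(of_real (t'\<^sup>2) - of_real (t\<^sup>2)) * ip (g t) (g t') = 0"
        by (metis left_diff_distrib right_minus_eq)
      moreover have "t'\<^sup>2 \<noteq> t\<^sup>2"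
        using Ts(1) that s by (smt (verit) power2_eq_iff)
      ultimately show ?thesis
        by (metis mult_eq_0_iff of_real_eq_iff right_minus_eq)
    qed
    have Af: "A f = (\<Sum>t\<in>Ts. A (g t))"
      unfolding f_def using finTs
    proof (induction Ts)
      case (insert t T)
      moreover have "A (g t + sum g T) = A (g t) + A (sum g T)" by (intro add gH sum_mem)
      ultimately show ?case by (simp only: sum.insert[OF insert.hyps])
    qed (simp only: sum.empty A0)
    have diag: "ip (g t) f = ip (g t) (g t)" if "t \<in> Ts" for t
    proof -
      have "ip (g t) f = (\<Sum>t'\<in>Ts. if t' = t then ip (g t) (g t) else 0)"
        unfolding f_def using gH that ortho by (subst ip_sum_right) (auto intro!: sum.cong)
      then show ?thesis using finTs that by simp
    qed
    have ff: "ip f f = (\<Sum>t\<in>Ts. ip (g t) (g t))"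
      using ip_sum_left[of Ts g f] gH fH diag by (simp add: f_def[symmetric])
    have AfAf: "ip (A f) (A f) = (\<Sum>t\<in>Ts. of_real (t\<^sup>2) * ip (g t) (g t))"
    proof -
      have "ip (A f) (A f) = (\<Sum>t\<in>Ts. ip (A f) (A (g t)))"
        by (subst (2) Af, rule ip_sum_right) (auto intro: maps gH fH)
      also have "\<dots> = (\<Sum>t\<in>Ts. of_real (t\<^sup>2) * ip f (g t))"
        using gQ'[OF fH] by simp
      also have "\<dots> = (\<Sum>t\<in>Ts. of_real (t\<^sup>2) * ip (g t) (g t))"
        using diag ip_commute[OF gH fH] ip_commute[OF gH gH]
        by (intro sum.cong refl arg_cong2[of _ _ _ _ "(*)"]) metis
      finally show ?thesis .
    qed
    have "s\<^sup>2 * Re (ip f f) \<le> Re (ip (A f) (A f))"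
    proof -
      have "s\<^sup>2 * Re (ip f f) = (\<Sum>t\<in>Ts. s\<^sup>2 * Re (ip (g t) (g t)))"
        by (simp add: ff sum_distrib_left)
      also have "\<dots> \<le> (\<Sum>t\<in>Ts. t\<^sup>2 * Re (ip (g t) (g t)))"
        using Ts(1) s ip_ge_zero[OF gH]
        by (intro sum_mono mult_right_mono power_mono) auto
      also have "\<dots> = Re (ip (A f) (A f))"
        by (simp add: AfAf del: of_real_power)
      finally show ?thesis .
    qed
    then have "(s * hnorm f)\<^sup>2 \<le> (hnorm (A f))\<^sup>2"
      using hnorm_sq[OF fH] hnorm_sq[OF maps[OF fH]] by (simp add: power_mult_distrib)
    then have lower: "s * hnorm f \<le> hnorm (A f)"
      using hnorm_nonneg[OF maps[OF fH]] power2_le_imp_le by blast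
    have BH: "b \<in> H" if "b \<in> B t" for b t
      using B(1)[of t] that by (auto simp: E_def)
    have l_sum: "l n (sum h I) = (\<Sum>i\<in>I. l n (h i))" if "n \<in> F" "finite I" "\<And>i. i \<in> I \<Longrightarrow> h i \<in> H"
      for n I and h :: "'i \<Rightarrow> 'a \<Rightarrow> complex"
      using that(2,3)
    proof (induction I)
      case empty
      have "l n 0 = 0" using l_add[OF that(1), of 0 0] zero_mem by simp
      then show ?case by (simp only: sum.empty)
    next
      case (insert i I)
      have "l n (h i + sum h I) = l n (h i) + l n (sum h I)"
        using insert.prems by (intro l_add[OF that(1)] sum_mem) auto
      moreover have "l n (sum h I) = (\<Sum>i\<in>I. l n (h i))"
        using insert.prems by (intro insert.IH) auto
      ultimately show ?case by (simp only: sum.insert[OF insert.hyps])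
    qed
    have "l n f = 0" if "n \<in> F" for n
    proof -
      have "l n f = (\<Sum>t\<in>Ts. l n (g t))"
        unfolding f_def by (intro l_sum that finTs gH)
      also have "\<dots> = (\<Sum>t\<in>Ts. \<Sum>b\<in>B t. x (t, b) * l n b)"
        unfolding g_def
        by (intro sum.cong refl, subst l_sum[OF that]) (auto simp: finB scale_mem BH l_scale[OF that])
      also have "\<dots> = (\<Sum>p\<in>PB. x p * l n (snd p))"
        unfolding PB_def using finTs finB by (subst sum.Sigma) (auto intro!: sum.cong)
      finally show ?thesis using x(2) that by simp
    qed
    then have upper: "hnorm (A f) \<le> \<epsilon> * hnorm f" using small[OF fH] by blast
    have "f \<noteq> 0"
    proof
      assume "f = 0"
      obtain t b where tb: "t \<in> Ts" "b \<in> B t" "x (t, b) \<noteq> 0" using x(1) by (auto simp: PB_def)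
      have "ip (g t) (g t) = 0" using diag[OF tb(1)] \<open>f = 0\<close> ip_zero_right[OF gH] by simp
      then have "g t = 0" using ip_eq_zero[OF gH] by blast
      then have "x (t, b) = 0"
        using cfun.independentD[OF B(2) finB[OF tb(1)] order_refl, of "\<lambda>b. x (t, b)" b] tb(2)
        unfolding g_def by blast
      then show False using tb(3) by simp
    qed
    then show "s \<le> \<epsilon>" using lower upper hnorm_pos[OF fH]
      by (metis mult_le_cancel_right order_less_not_sym order_trans)
  qed
  then show ?thesis
    unfolding singular_value_def using \<epsilon> by (intro cSup_least) auto
qed

end

section \<open>Weighted sequence spaces\<close>

text \<open>The map \<open>coeff\<close> identifies \<open>H\<close> with the space of all coefficient families that are square summable
with the weights \<open>W\<close>. Everything is derived from this identification, so that \<open>H\<close> can consist of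
functions on the circle instead of sequences.\<close>

locale weighted_l2 =
  fixes H :: "('a \<Rightarrow> complex) set"
    and coeff :: "('a \<Rightarrow> complex) \<Rightarrow> 'i::countable \<Rightarrow> complex"
    and W :: "'i \<Rightarrow> real"
  assumes carrier_subspace: "cfun.subspace H"
    and W_pos: "\<And>n. 0 < W n"
    and coeff_add: "\<And>f g n. \<lbrakk>f \<in> H; g \<in> H\<rbrakk> \<Longrightarrow> coeff (f + g) n = coeff f n + coeff g n"
    and coeff_scale: "\<And>f n a. f \<in> H \<Longrightarrow> coeff (fscale a f) n = a * coeff f n"
    and coeff_inj: "\<And>f. \<lbrakk>f \<in> H; \<And>n. coeff f n = 0\<rbrakk> \<Longrightarrow> f = 0"
    and coeff_summable: "\<And>f. f \<in> H \<Longrightarrow> (\<lambda>n. (W n * cmod (coeff f n))\<^sup>2) summable_on UNIV"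
    and coeff_surj: "\<And>a. (\<lambda>n. (W n * cmod (a n))\<^sup>2) summable_on UNIV \<Longrightarrow> \<exists>f\<in>H. coeff f = a"
begin

abbreviation wcoeff :: "('a \<Rightarrow> complex) \<Rightarrow> 'i \<Rightarrow> real" where
  "wcoeff f n \<equiv> W n * cmod (coeff f n)"

definition l2_ip :: "('a \<Rightarrow> complex) \<Rightarrow> ('a \<Rightarrow> complex) \<Rightarrow> complex" where
  "l2_ip f g = (\<Sum>\<^sub>\<infinity>n. of_real ((W n)\<^sup>2) * coeff f n * cnj (coeff g n))"

lemma summable_l2_ip:
  assumes "f \<in> H" "g \<in> H"
  shows "(\<lambda>n. of_real ((W n)\<^sup>2) * coeff f n * cnj (coeff g n)) summable_on UNIV"
proof (rule Infinite_Sum.abs_summable_summable, rule Infinite_Sum.abs_summable_on_comparison_test')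
  show "(\<lambda>n. (wcoeff f n)\<^sup>2 + (wcoeff g n)\<^sup>2) summable_on UNIV"
    by (intro summable_on_add coeff_summable assms)
  fix n
  have "(wcoeff f n) * (wcoeff g n) \<le>
      (wcoeff f n)\<^sup>2 + (wcoeff g n)\<^sup>2"
  proof -
    have "0 \<le> x * y \<Longrightarrow> x * y \<le> x\<^sup>2 + y\<^sup>2" for x y :: real
      using sum_squares_bound[of x y] by linarith
    then show ?thesis using W_pos[of n] by (simp add: less_imp_le)
  qed
  then show "cmod (of_real ((W n)\<^sup>2) * coeff f n * cnj (coeff g n)) \<le>
      (wcoeff f n)\<^sup>2 + (wcoeff g n)\<^sup>2"
    by (simp add: norm_mult norm_power power2_eq_square mult_ac)
qed

lemma l2_ip_self:
  assumes "f \<in> H"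
  shows "l2_ip f f = of_real (\<Sum>\<^sub>\<infinity>n. (wcoeff f n)\<^sup>2)"
proof -
  have "of_real ((W n)\<^sup>2) * coeff f n * cnj (coeff f n) = of_real ((wcoeff f n)\<^sup>2)" for n
    using complex_norm_square[of "coeff f n"] by (simp add: power_mult_distrib mult.assoc)
  then show ?thesis
    unfolding l2_ip_def
    using has_sum_of_real[OF has_sum_infsum[OF coeff_summable[OF assms]], where ?'a = complex]
    by (intro infsumI) (simp only:)
qed

sublocale function_inner_space H l2_ip
proof
  show "cfun.subspace H" by (rule carrier_subspace)
next
  fix f g h assume *: "f \<in> H" "g \<in> H" "h \<in> H"
  show "l2_ip (f + g) h = l2_ip f h + l2_ip g h"
    unfolding l2_ip_def using *
    by (subst infsum_add[symmetric]) (simp_all only: summable_l2_ip coeff_add distrib_left distrib_right)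
next
  fix f h c assume *: "f \<in> H" "h \<in> H"
  show "l2_ip (fscale c f) h = c * l2_ip f h"
    unfolding l2_ip_def using *
    by (simp add: infsum_cmult_right'[symmetric] coeff_scale mult_ac)
next
  fix f g assume "f \<in> H" "g \<in> H"
  show "l2_ip g f = cnj (l2_ip f g)"
    unfolding l2_ip_def infsum_cnj[symmetric] by (simp add: mult_ac)
next
  fix f assume f: "f \<in> H"
  show "0 \<le> Re (l2_ip f f)"
    unfolding l2_ip_self[OF f] by (simp add: infsum_nonneg)
  assume "l2_ip f f = 0"
  then have z: "(\<Sum>\<^sub>\<infinity>n. (wcoeff f n)\<^sup>2) = 0"
    unfolding l2_ip_self[OF f] by simp
  have "coeff f n = 0" for n
  proof -
    have "(wcoeff f n)\<^sup>2 = 0"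
      by (rule nonneg_infsum_le_0D[OF _ coeff_summable[OF f]]) (auto simp: z)
    then show ?thesis using W_pos[of n] by simp
  qed
  then show "f = 0" using coeff_inj[OF f] by blast
qed

lemma hnorm_sq_eq: "f \<in> H \<Longrightarrow> (hnorm f)\<^sup>2 = (\<Sum>\<^sub>\<infinity>n. (wcoeff f n)\<^sup>2)"
  by (simp add: hnorm_sq l2_ip_self)

lemma sum_le_hnorm_sq:
  "\<lbrakk>f \<in> H; finite F\<rbrakk> \<Longrightarrow> (\<Sum>n\<in>F. (wcoeff f n)\<^sup>2) \<le> (hnorm f)\<^sup>2"
  unfolding hnorm_sq_eq by (intro finite_sum_le_infsum coeff_summable) auto

lemma coeff_le_hnorm: "f \<in> H \<Longrightarrow> wcoeff f n \<le> hnorm f"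
  using sum_le_hnorm_sq[of f "{n}"] hnorm_nonneg[of f] power2_le_imp_le by auto

lemma hnorm_leI:
  assumes "f \<in> H" "0 \<le> K" "\<And>F. finite F \<Longrightarrow> (\<Sum>n\<in>F. (wcoeff f n)\<^sup>2) \<le> K\<^sup>2"
  shows "hnorm f \<le> K"
  using assms
  by (intro power2_le_imp_le[of "hnorm f" K])
    (auto simp: hnorm_sq_eq intro!: infsum_le_finite_sums coeff_summable)

lemma summable_if_bounded:
  assumes "\<And>F. finite F \<Longrightarrow> (\<Sum>n\<in>F. (W n * cmod (a n))\<^sup>2) \<le> K"
  shows "(\<lambda>n. (W n * cmod (a n))\<^sup>2) summable_on UNIV"
  by (rule nonneg_bdd_above_summable_on) (auto intro!: bdd_aboveI2[where M = K] assms)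

lemma coeff_diff: "\<lbrakk>f \<in> H; g \<in> H\<rbrakk> \<Longrightarrow> coeff (f - g) n = coeff f n - coeff g n"
  using coeff_add[of "f - g" g n] diff_mem[of f g] by simp

lemma coeff_zero: "coeff 0 n = 0"
  using coeff_add[of 0 0 n] zero_mem by simp

lemma coeff_sum: "(\<And>i. i \<in> I \<Longrightarrow> f i \<in> H) \<Longrightarrow> coeff (sum f I) n = (\<Sum>i\<in>I. coeff (f i) n)"
  by (induction I rule: infinite_finite_induct) (auto simp: coeff_zero coeff_add sum_mem)

sublocale function_hilbert_space H l2_ip
proof
  show mcomplete
    unfolding mcomplete_def
  proof (intro allI impI)
    fix \<sigma> assume "MCauchy \<sigma>"
    then have mem: "\<And>j. \<sigma> j \<in> H"
      and cauchy: "\<And>e. e > 0 \<Longrightarrow> \<exists>N. \<forall>i j. N \<le> i \<longrightarrow> N \<le> j \<longrightarrow> hnorm (\<sigma> i - \<sigma> j) < e"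
      unfolding MCauchy_def hdist_def by (auto simp: image_subset_iff)
    have "Cauchy (\<lambda>j. coeff (\<sigma> j) n)" for n
    proof (rule metric_CauchyI)
      fix e :: real assume "0 < e"
      then obtain N where N: "\<And>i j. N \<le> i \<Longrightarrow> N \<le> j \<Longrightarrow> hnorm (\<sigma> i - \<sigma> j) < W n * e"
        using cauchy[of "W n * e"] W_pos[of n] by auto
      have "dist (coeff (\<sigma> i) n) (coeff (\<sigma> j) n) < e" if "N \<le> i" "N \<le> j" for i j
      proof -
        have "W n * cmod (coeff (\<sigma> i) n - coeff (\<sigma> j) n) < W n * e"
          using coeff_le_hnorm[OF diff_mem[OF mem mem], of n i j] N[OF that]
          by (simp add: coeff_diff mem)
        then show ?thesis using W_pos[of n] by (simp add: dist_norm)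
      qed
      then show "\<exists>N. \<forall>i\<ge>N. \<forall>j\<ge>N. dist (coeff (\<sigma> i) n) (coeff (\<sigma> j) n) < e" by blast
    qed
    then obtain a where a: "\<And>n. (\<lambda>j. coeff (\<sigma> j) n) \<longlonglongrightarrow> a n"
      unfolding Cauchy_convergent_iff convergent_def by metis
    have tail: "(\<Sum>n\<in>F. (W n * cmod (coeff (\<sigma> i) n - a n))\<^sup>2) \<le> e\<^sup>2"
      if "finite F" "\<And>j. N \<le> j \<Longrightarrow> hnorm (\<sigma> i - \<sigma> j) < e" for F N i e
    proof (rule LIMSEQ_le_const2)
      show "(\<lambda>j. \<Sum>n\<in>F. (W n * cmod (coeff (\<sigma> i) n - coeff (\<sigma> j) n))\<^sup>2)
          \<longlonglongrightarrow> (\<Sum>n\<in>F. (W n * cmod (coeff (\<sigma> i) n - a n))\<^sup>2)"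
        by (intro tendsto_intros a)
      have "(\<Sum>n\<in>F. (W n * cmod (coeff (\<sigma> i) n - coeff (\<sigma> j) n))\<^sup>2) \<le> e\<^sup>2" if "N \<le> j" for j
      proof -
        have "(\<Sum>n\<in>F. (W n * cmod (coeff (\<sigma> i) n - coeff (\<sigma> j) n))\<^sup>2) \<le> (hnorm (\<sigma> i - \<sigma> j))\<^sup>2"
          using sum_le_hnorm_sq[OF diff_mem[OF mem mem] \<open>finite F\<close>, of i j]
          by (simp add: coeff_diff mem)
        also have "\<dots> \<le> e\<^sup>2"
          using \<open>\<And>j. N \<le> j \<Longrightarrow> hnorm (\<sigma> i - \<sigma> j) < e\<close>[OF that] hnorm_nonneg[OF diff_mem[OF mem mem]]
          by (intro power_mono) auto
        finally show ?thesis .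
      qed
      then show "\<exists>N. \<forall>j\<ge>N. (\<Sum>n\<in>F. (W n * cmod (coeff (\<sigma> i) n - coeff (\<sigma> j) n))\<^sup>2) \<le> e\<^sup>2"
        by blast
    qed
    obtain N where N: "\<And>i j. N \<le> i \<Longrightarrow> N \<le> j \<Longrightarrow> hnorm (\<sigma> i - \<sigma> j) < 1"
      using cauchy[of 1] by auto
    have "(\<lambda>n. (W n * cmod (coeff (\<sigma> N) n - a n))\<^sup>2) summable_on UNIV"
      using tail[of _ N N 1] N by (intro summable_if_bounded[where K = "1\<^sup>2"]) auto
    then obtain h where h: "h \<in> H" "coeff h = (\<lambda>n. coeff (\<sigma> N) n - a n)"
      using coeff_surj[of "\<lambda>n. coeff (\<sigma> N) n - a n"] by auto
    define x where "x = \<sigma> N - h"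
    have x: "x \<in> H" unfolding x_def by (intro diff_mem mem h)
    have cx: "coeff x n = a n" for n
      unfolding x_def by (simp add: coeff_diff mem h)
    have "\<exists>N. \<forall>n\<ge>N. \<sigma> n \<in> H \<and> hdist (\<sigma> n) x < e" if "e > 0" for e
    proof -
      obtain N where N: "\<And>i j. N \<le> i \<Longrightarrow> N \<le> j \<Longrightarrow> hnorm (\<sigma> i - \<sigma> j) < e / 2"
        using cauchy[of "e / 2"] \<open>e > 0\<close> by auto
      have "hnorm (\<sigma> i - x) \<le> e / 2" if "N \<le> i" for i
        using tail[of _ N i "e / 2"] N[OF that] \<open>e > 0\<close>
        by (intro hnorm_leI diff_mem mem x) (auto simp: coeff_diff mem x cx)
      then show ?thesis using \<open>e > 0\<close> mem x unfolding hdist_def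
        by (intro exI[of _ N]) (auto intro: le_less_trans[of _ "e / 2"])
    qed
    then show "\<exists>x. limitin mtopology \<sigma> x sequentially"
      unfolding limit_metric_sequentially using x by blast
  qed
qed

definition unit_vector :: "'i \<Rightarrow> 'a \<Rightarrow> complex" where
  "unit_vector n = (SOME f. f \<in> H \<and> coeff f = (\<lambda>m. if m = n then 1 else 0))"

lemma unit_vector: "unit_vector n \<in> H" "coeff (unit_vector n) m = (if m = n then 1 else 0)"
proof -
  have "(\<lambda>m. (W m * cmod (if m = n then 1 else 0))\<^sup>2) summable_on UNIV"
    by (rule iffD1[OF summable_on_cong_neutral[of UNIV "{n}"]]) auto
  then have "\<exists>f. f \<in> H \<and> coeff f = (\<lambda>m. if m = n then 1 else 0)"
    using coeff_surj[of "\<lambda>m. if m = n then 1 else 0"] by auto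
  from someI_ex[OF this]
  show "unit_vector n \<in> H" "coeff (unit_vector n) m = (if m = n then 1 else 0)"
    unfolding unit_vector_def by auto
qed

lemma coeff_unit_vector_sum:
  assumes "finite F"
  shows "coeff (\<Sum>n\<in>F. fscale (a n) (unit_vector n)) m = (if m \<in> F then a m else 0)"
proof -
  have "coeff (\<Sum>n\<in>F. fscale (a n) (unit_vector n)) m = (\<Sum>n\<in>F. if n = m then a m else 0)"
    by (subst coeff_sum)
      (auto simp: scale_mem unit_vector coeff_scale intro!: sum.cong)
  then show ?thesis using assms by simp
qed

lemma unit_vector_sum_tendsto:
  assumes f: "f \<in> H"
  shows "((\<lambda>F. hnorm (f - (\<Sum>n\<in>F. fscale (coeff f n) (unit_vector n)))) \<longlongrightarrow> 0)
    (finite_subsets_at_top UNIV)"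
proof -
  define p where "p F = (\<Sum>n\<in>F. fscale (coeff f n) (unit_vector n))" for F
  define u where "u n = (wcoeff f n)\<^sup>2" for n
  have p: "p F \<in> H" for F unfolding p_def by (intro sum_mem scale_mem unit_vector)
  have us: "u summable_on UNIV" unfolding u_def by (rule coeff_summable[OF f])
  have "hnorm (f - p F) \<le> sqrt (infsum u UNIV - sum u F)" if F: "finite F" for F
  proof (rule hnorm_leI[OF diff_mem[OF f p]])
    show "0 \<le> sqrt (infsum u UNIV - sum u F)"
      using finite_sum_le_infsum[OF us F] by (simp add: u_def)
    fix G :: "'i set" assume G: "finite G"
    have "(\<Sum>n\<in>G. (wcoeff (f - p F) n)\<^sup>2) = (\<Sum>n\<in>G. if n \<in> F then 0 else u n)"
      using F by (intro sum.cong) (auto simp: coeff_diff f p u_def, auto simp: p_def coeff_unit_vector_sum)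
    also have "\<dots> = sum u (G - F)"
      using G by (simp add: sum.If_cases Diff_eq)
    also have "\<dots> = sum u (G \<union> F) - sum u F"
      using F G sum.union_disjoint[of "G - F" F u] Diff_disjoint[of F G]
      by (simp add: Int_commute Un_Diff_cancel2)
    also have "\<dots> \<le> infsum u UNIV - sum u F"
      using finite_sum_le_infsum[OF us, of "G \<union> F"] F G by (simp add: u_def)
    also have "\<dots> = (sqrt (infsum u UNIV - sum u F))\<^sup>2"
      using finite_sum_le_infsum[OF us F] by (simp add: u_def)
    finally show "(\<Sum>n\<in>G. (wcoeff (f - p F) n)\<^sup>2) \<le>
        (sqrt (infsum u UNIV - sum u F))\<^sup>2" .
  qed
  then have le: "\<forall>\<^sub>F F in finite_subsets_at_top UNIV. hnorm (f - p F) \<le> sqrt (infsum u UNIV - sum u F)"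
    by (intro eventually_finite_subsets_at_top_weakI)
  have "((\<lambda>F. sqrt (infsum u UNIV - sum u F)) \<longlongrightarrow> sqrt (infsum u UNIV - infsum u UNIV))
      (finite_subsets_at_top UNIV)"
    by (intro tendsto_intros infsum_tendsto us)
  then have lim: "((\<lambda>F. sqrt (infsum u UNIV - sum u F)) \<longlongrightarrow> 0) (finite_subsets_at_top UNIV)"
    by simp
  have "((\<lambda>F. hnorm (f - p F)) \<longlongrightarrow> 0) (finite_subsets_at_top UNIV)"
    by (rule tendsto_sandwich[OF always_eventually le tendsto_const lim])
      (intro allI hnorm_nonneg diff_mem f p)
  then show ?thesis unfolding p_def .
qed

lemma closure_of_span_unit_vectors:
  "mtopology closure_of (cfun.span (range unit_vector)) = H"
proof -
  have "\<exists>y\<in>cfun.span (range unit_vector). y \<in> mball f r" if f: "f \<in> H" and "0 < r" for f r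
  proof -
    have "eventually (\<lambda>F. hnorm (f - (\<Sum>n\<in>F. fscale (coeff f n) (unit_vector n))) < r)
        (finite_subsets_at_top UNIV)"
      using unit_vector_sum_tendsto[OF f] \<open>0 < r\<close> by (rule order_tendstoD)
    then obtain F where "hnorm (f - (\<Sum>n\<in>F. fscale (coeff f n) (unit_vector n))) < r"
      using eventually_happens'[OF finite_subsets_at_top_neq_bot] by blast
    moreover have "(\<Sum>n\<in>F. fscale (coeff f n) (unit_vector n)) \<in> H"
      by (intro sum_mem scale_mem unit_vector)
    moreover have "(\<Sum>n\<in>F. fscale (coeff f n) (unit_vector n)) \<in> cfun.span (range unit_vector)"
      by (intro cfun.span_sum cfun.span_scale cfun.span_base) auto
    ultimately show ?thesis using f by (auto simp: hdist_def)
  qed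
  then show ?thesis by (auto simp: metric_closure_of)
qed

text \<open>The values of \<open>l\<close> on the unit vectors prescribe the coefficients \<open>a\<close> of the representing vector.
For a truncation \<open>p\<close> of this vector, \<open>l p\<close> is the square of the norm of \<open>p\<close>, and the bound on \<open>l\<close> gives
\<open>hnorm p \<le> \<bar>K\<bar>\<close>; so \<open>a\<close> is square summable.\<close>

lemma Riesz_representation:
  assumes l_add: "\<And>f g. \<lbrakk>f \<in> H; g \<in> H\<rbrakk> \<Longrightarrow> l (f + g) = l f + l g"
    and l_scale: "\<And>f c. f \<in> H \<Longrightarrow> l (fscale c f) = c * l f"
    and bound: "\<And>f. f \<in> H \<Longrightarrow> cmod (l f) \<le> K * hnorm f"
  shows "\<exists>h\<in>H. \<forall>f\<in>H. l f = l2_ip f h"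
proof -
  have l_sum: "l (sum h I) = (\<Sum>i\<in>I. l (h i))" if "\<And>i. h i \<in> H" for I :: "'i set" and h
    using that l_add[of 0 0] zero_mem
    by (induction I rule: infinite_finite_induct) (simp_all add: l_add sum_mem)
  have l_diff: "l (f - g) = l f - l g" if "f \<in> H" "g \<in> H" for f g
    using l_add[of "f - g" g] diff_mem[of f g] that by simp
  define a where "a n = cnj (l (unit_vector n)) / of_real ((W n)\<^sup>2)" for n
  have la: "l (unit_vector n) = of_real ((W n)\<^sup>2) * cnj (a n)" for n
    using W_pos[of n] by (simp add: a_def)
  have "(\<lambda>n. (W n * cmod (a n))\<^sup>2) summable_on UNIV"
  proof (rule summable_if_bounded)
    fix F :: "'i set" assume F: "finite F"
    define S where "S = (\<Sum>n\<in>F. (W n * cmod (a n))\<^sup>2)"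
    define p where "p = (\<Sum>n\<in>F. fscale (a n) (unit_vector n))"
    have p: "p \<in> H" unfolding p_def by (intro sum_mem scale_mem unit_vector)
    have S0: "0 \<le> S" unfolding S_def by (simp add: sum_nonneg)
    have "l p = (\<Sum>n\<in>F. a n * l (unit_vector n))"
      unfolding p_def by (simp add: l_sum scale_mem unit_vector l_scale)
    also have "\<dots> = (\<Sum>n\<in>F. of_real ((W n * cmod (a n))\<^sup>2))"
      using complex_norm_square
      by (intro sum.cong refl) (simp add: la power_mult_distrib mult_ac)
    also have "\<dots> = of_real S" unfolding S_def by simp
    finally have lp: "l p = of_real S" .
    have "hnorm p \<le> sqrt S"
    proof (rule hnorm_leI[OF p])
      show "0 \<le> sqrt S" using S0 by simp
    next
      fix G :: "'i set" assume G: "finite G"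
      have "(\<Sum>n\<in>G. (wcoeff p n)\<^sup>2) = (\<Sum>n\<in>G. if n \<in> F then (W n * cmod (a n))\<^sup>2 else 0)"
        using F by (intro sum.cong) (auto simp: p_def coeff_unit_vector_sum)
      also have "\<dots> = (\<Sum>n\<in>G \<inter> F. (W n * cmod (a n))\<^sup>2)"
        using G by (simp add: sum.If_cases)
      also have "\<dots> \<le> S" unfolding S_def using F by (intro sum_mono2) auto
      finally show "(\<Sum>n\<in>G. (wcoeff p n)\<^sup>2) \<le> (sqrt S)\<^sup>2" using S0 by simp
    qed
    have "S \<le> \<bar>K\<bar> * sqrt S"
    proof -
      have "S \<le> K * hnorm p" using bound[OF p] lp S0 by simp
      also have "\<dots> \<le> \<bar>K\<bar> * sqrt S"
        using \<open>hnorm p \<le> sqrt S\<close> hnorm_nonneg[OF p] by (intro mult_mono) auto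
      finally show ?thesis .
    qed
    then have "sqrt S * sqrt S \<le> \<bar>K\<bar> * sqrt S" using S0 by simp
    then have "sqrt S \<le> \<bar>K\<bar>"
      using S0 by (cases "S = 0") (auto intro: mult_right_le_imp_le[of _ "sqrt S"] simp del: real_sqrt_mult_self)
    then have "(sqrt S)\<^sup>2 \<le> \<bar>K\<bar>\<^sup>2" using S0 by (intro power_mono) auto
    then show "(\<Sum>n\<in>F. (W n * cmod (a n))\<^sup>2) \<le> K\<^sup>2" using S0 by (simp add: S_def)
  qed
  then obtain h where h: "h \<in> H" "coeff h = a" using coeff_surj by blast
  have "l f = l2_ip f h" if f: "f \<in> H" for f
  proof -
    define p where "p F = (\<Sum>n\<in>F. fscale (coeff f n) (unit_vector n))" for F
    have p: "p F \<in> H" for F unfolding p_def by (intro sum_mem scale_mem unit_vector)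
    have lp: "l (p F) = (\<Sum>n\<in>F. of_real ((W n)\<^sup>2) * coeff f n * cnj (coeff h n))" for F
      unfolding p_def by (simp add: l_sum scale_mem unit_vector l_scale la h mult_ac)
    have "((\<lambda>F. l f - l (p F)) \<longlongrightarrow> 0) (finite_subsets_at_top UNIV)"
    proof (rule Lim_null_comparison)
      show "\<forall>\<^sub>F F in finite_subsets_at_top UNIV. cmod (l f - l (p F)) \<le> K * hnorm (f - p F)"
        using bound[OF diff_mem[OF f p]] by (simp add: l_diff f p)
      show "((\<lambda>F. K * hnorm (f - p F)) \<longlongrightarrow> 0) (finite_subsets_at_top UNIV)"
        unfolding p_def using unit_vector_sum_tendsto[OF f] by (rule tendsto_mult_right_zero)
    qed
    then have "((\<lambda>F. l f - (l f - l (p F))) \<longlongrightarrow> l f - 0) (finite_subsets_at_top UNIV)"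
      by (intro tendsto_diff tendsto_const)
    then have "((\<lambda>n. of_real ((W n)\<^sup>2) * coeff f n * cnj (coeff h n)) has_sum l f) UNIV"
      unfolding has_sum_def by (simp add: lp)
    then show ?thesis unfolding l2_ip_def by (rule infsumI[symmetric])
  qed
  then show ?thesis using h by blast
qed

context
  fixes A :: "('a \<Rightarrow> complex) \<Rightarrow> ('a \<Rightarrow> complex)"
  assumes A_mem: "\<And>f. f \<in> H \<Longrightarrow> A f \<in> H"
    and A_add: "\<And>f g. \<lbrakk>f \<in> H; g \<in> H\<rbrakk> \<Longrightarrow> A (f + g) = A f + A g"
    and A_scale: "\<And>f c. f \<in> H \<Longrightarrow> A (fscale c f) = fscale c (A f)"
begin

lemma bounded_operator_adjoint:
  assumes K: "\<And>f. f \<in> H \<Longrightarrow> hnorm (A f) \<le> K * hnorm f" and g: "g \<in> H"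
  shows "hadjoint A g \<in> H \<and> (\<forall>f\<in>H. l2_ip (A f) g = l2_ip f (hadjoint A g))"
proof -
  have "\<exists>h\<in>H. \<forall>f\<in>H. l2_ip (A f) g = l2_ip f h"
  proof (rule Riesz_representation)
    fix f assume f: "f \<in> H"
    have "(cmod (l2_ip (A f) g))\<^sup>2 \<le> (hnorm (A f) * hnorm g)\<^sup>2"
      using Cauchy_Schwarz[OF A_mem[OF f] g] by (simp add: hnorm_sq A_mem f g power_mult_distrib)
    then have "cmod (l2_ip (A f) g) \<le> hnorm (A f) * hnorm g"
      by (rule power2_le_imp_le) (intro mult_nonneg_nonneg hnorm_nonneg g A_mem f)
    also have "\<dots> \<le> K * hnorm f * hnorm g"
      by (intro mult_right_mono K f hnorm_nonneg g)
    finally show "cmod (l2_ip (A f) g) \<le> K * hnorm g * hnorm f" by (simp add: mult_ac)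
  qed (use g in \<open>auto simp: A_add A_scale A_mem ip_add_left ip_scale_left\<close>)
  then obtain h where h: "h \<in> H" "\<forall>f\<in>H. l2_ip (A f) g = l2_ip f h" by blast
  show ?thesis
    unfolding hadjoint_def
  proof (rule theI[where a = h])
    fix h' assume h': "h' \<in> H \<and> (\<forall>f\<in>H. l2_ip (A f) g = l2_ip f h')"
    then have "l2_ip (h' - h) (h' - h) = 0"
      using h diff_mem[of h' h] by (subst ip_diff_right) auto
    then show "h' = h" using ip_eq_zero[of "h' - h"] h' h(1) diff_mem by auto
  qed (use h in auto)
qed

text \<open>The range of \<open>A\<close> lies in the space with the weights \<open>V\<close>. Thus \<open>A\<close> is a bounded map
followed by an inclusion that is diagonal with entries \<open>W n / V n\<close>. These tend to \<open>0\<close>, which makes \<open>A\<close>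
compact, and outside of \<open>F\<close> they are at most \<open>\<epsilon>\<close>.\<close>

lemma
  fixes V :: "'i \<Rightarrow> real"
  assumes V_pos: "\<And>n. 0 < V n" and "0 \<le> K"
    and gain: "\<And>f F. \<lbrakk>f \<in> H; finite F\<rbrakk> \<Longrightarrow> (\<Sum>n\<in>F. (V n * cmod (coeff (A f) n))\<^sup>2) \<le> (K * hnorm f)\<^sup>2"
    and WV: "\<And>\<delta>. 0 < \<delta> \<Longrightarrow> finite {n. \<delta> * V n < W n}"
  shows smoothing_operator_compact: "compact_operator A"
    and smoothing_operator_singular_value:
      "\<And>F \<epsilon> k. \<lbrakk>finite F; card F \<le> k; 0 \<le> \<epsilon>; \<And>n. n \<notin> F \<Longrightarrow> W n \<le> \<epsilon> * V n\<rbrakk>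
        \<Longrightarrow> singular_value A k \<le> K * \<epsilon>"
proof -
  have A_diff: "A (f - g) = A f - A g" if "f \<in> H" "g \<in> H" for f g
    using A_add[of "f - g" g] diff_mem[of f g] that by simp
  have off: "(\<Sum>n\<in>G. (wcoeff (A f) n)\<^sup>2) \<le> (\<epsilon> * (K * hnorm f))\<^sup>2"
    if "f \<in> H" "finite G" "\<And>n. n \<in> G \<Longrightarrow> W n \<le> \<epsilon> * V n" "0 \<le> \<epsilon>" for f G \<epsilon>
  proof -
    have "(\<Sum>n\<in>G. (wcoeff (A f) n)\<^sup>2) \<le> (\<Sum>n\<in>G. (\<epsilon> * (V n * cmod (coeff (A f) n)))\<^sup>2)"
      using that W_pos
      by (intro sum_mono power_mono)
        (auto simp: mult.assoc[symmetric] less_imp_le intro!: mult_right_mono mult_nonneg_nonneg)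
    also have "\<dots> = \<epsilon>\<^sup>2 * (\<Sum>n\<in>G. (V n * cmod (coeff (A f) n))\<^sup>2)"
      unfolding sum_distrib_left by (intro sum.cong refl) (rule power_mult_distrib)
    also have "\<dots> \<le> \<epsilon>\<^sup>2 * (K * hnorm f)\<^sup>2"
      using that by (intro mult_left_mono gain) auto
    finally show ?thesis by (simp add: power_mult_distrib)
  qed
  show compact: "compact_operator A"
    unfolding compact_operator_def
  proof (intro conjI ballI allI impI A_mem A_add A_scale)
    fix B assume "mbounded B"
    then obtain R where B: "B \<subseteq> H" and R: "R > 0" "\<And>f g. f \<in> B \<Longrightarrow> g \<in> B \<Longrightarrow> hnorm (f - g) \<le> R"
      unfolding mbounded_alt_pos hdist_def by (auto simp: subset_iff)
    have "mtotally_bounded (A ` B)"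
      unfolding mtotally_bounded_sequentially
    proof (intro conjI allI impI)
      show "A ` B \<subseteq> H" using B A_mem by auto
      fix \<tau> :: "nat \<Rightarrow> 'a \<Rightarrow> complex" assume "range \<tau> \<subseteq> A ` B"
      then have "\<forall>j. \<exists>f. f \<in> B \<and> \<tau> j = A f" by (auto simp: image_subset_iff)
      then obtain \<sigma> where \<sigma>: "\<And>j. \<sigma> j \<in> B" "\<And>j. \<tau> j = A (\<sigma> j)" by metis
      have \<sigma>H: "\<sigma> j \<in> H" for j using \<sigma> B by auto
      have \<tau>H: "\<tau> j \<in> H" for j using \<sigma> \<sigma>H A_mem by auto
      \<comment> \<open>the factor \<open>V n\<close> makes these numbers bounded uniformly in \<open>n\<close>, so that one subsequence
        converges in every coefficient\<close>
      define x where "x j n = of_real (V n) * (coeff (\<tau> j) n - coeff (\<tau> 0) n)" for j n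
      have diff: "coeff (\<tau> i) n - coeff (\<tau> j) n = coeff (A (\<sigma> i - \<sigma> j)) n" for i j n
        using \<sigma>H A_diff \<tau>H by (simp add: coeff_diff \<sigma>(2) A_mem)
      have x_le: "norm (x j n) \<le> K * R" for j n
      proof -
        have "(V n * cmod (coeff (A (\<sigma> j - \<sigma> 0)) n))\<^sup>2 \<le> (K * hnorm (\<sigma> j - \<sigma> 0))\<^sup>2"
          using gain[OF diff_mem[OF \<sigma>H \<sigma>H], of "{n}" j 0] by simp
        then have "V n * cmod (coeff (A (\<sigma> j - \<sigma> 0)) n) \<le> K * hnorm (\<sigma> j - \<sigma> 0)"
          by (rule power2_le_imp_le) (intro mult_nonneg_nonneg \<open>0 \<le> K\<close> hnorm_nonneg diff_mem \<sigma>H)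
        also have "\<dots> \<le> K * R" using R \<sigma> \<open>0 \<le> K\<close> by (intro mult_left_mono) auto
        finally show ?thesis
          using V_pos[of n] by (simp add: x_def norm_mult diff)
      qed
      obtain r where r: "strict_mono r" "\<And>n. \<exists>l. (\<lambda>j. x (r j) n) \<longlonglongrightarrow> l"
        by (rule function_convergent_subsequence[of "UNIV :: 'i set" x "K * R"]) (use x_le in auto)
      have Cau: "Cauchy (\<lambda>j. coeff (\<tau> (r j)) n)" for n
      proof -
        obtain l where "(\<lambda>j. x (r j) n) \<longlonglongrightarrow> l" using r by blast
        then have "(\<lambda>j. x (r j) n / of_real (V n) + coeff (\<tau> 0) n) \<longlonglongrightarrow> l / of_real (V n) + coeff (\<tau> 0) n"
          by (intro tendsto_intros) (use V_pos[of n] in auto)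
        then show ?thesis
          unfolding x_def using V_pos[of n] by (intro LIMSEQ_imp_Cauchy) simp
      qed
      have "\<exists>N. \<forall>i j. N \<le> i \<longrightarrow> N \<le> j \<longrightarrow> hnorm (\<tau> (r i) - \<tau> (r j)) < e" if "e > 0" for e
      proof -
        define \<delta> where "\<delta> = e / (4 * (K * R + 1))"
        have "K * R \<ge> 0" using \<open>0 \<le> K\<close> R by simp
        then have \<delta>: "\<delta> > 0" and \<delta>e: "\<delta> * (K * R) \<le> e / 4"
          using \<open>e > 0\<close> by (auto simp: \<delta>_def field_simps)
        \<comment> \<open>off the finite set \<open>F\<close> the inclusion is small; on \<open>F\<close> the coefficients converge\<close>
        define F where "F = {n. \<delta> * V n < W n}"
        have F: "finite F" unfolding F_def using WV \<delta> by blast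
        define \<eta> where "\<eta> = e / (4 * (\<Sum>n\<in>F. W n) + 4)"
        have SW: "0 \<le> (\<Sum>n\<in>F. W n)" using W_pos less_imp_le by (intro sum_nonneg) blast
        have \<eta>: "\<eta> > 0" using SW \<open>e > 0\<close> by (simp add: \<eta>_def)
        have "\<forall>\<^sub>F N in sequentially. \<forall>n\<in>F. \<forall>i\<ge>N. \<forall>j\<ge>N. dist (coeff (\<tau> (r i)) n) (coeff (\<tau> (r j)) n) < \<eta>"
          unfolding eventually_ball_finite_distrib[OF F] eventually_sequentially
          using metric_CauchyD[OF Cau \<eta>] by (meson order_trans)
        then obtain N where N: "\<And>n i j. n \<in> F \<Longrightarrow> N \<le> i \<Longrightarrow> N \<le> j \<Longrightarrow>
            cmod (coeff (\<tau> (r i)) n - coeff (\<tau> (r j)) n) < \<eta>"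
          unfolding eventually_sequentially dist_norm by blast
        have "hnorm (\<tau> (r i) - \<tau> (r j)) < e" if "N \<le> i" "N \<le> j" for i j
        proof -
          let ?g = "\<sigma> (r i) - \<sigma> (r j)"
          have g: "?g \<in> H" "hnorm ?g \<le> R" using \<sigma>H \<sigma>(1) R by (auto simp: diff_mem)
          have eq: "\<tau> (r i) - \<tau> (r j) = A ?g" using \<sigma>H A_diff by (simp add: \<sigma>(2))
          have "hnorm (A ?g) \<le> e / 2"
          proof (rule hnorm_leI[OF A_mem[OF g(1)]])
            show "0 \<le> e / 2" using \<open>e > 0\<close> by simp
            fix G :: "'i set" assume G: "finite G"
            have "(\<Sum>n\<in>G \<inter> F. (wcoeff (A ?g) n)\<^sup>2) \<le> (\<Sum>n\<in>F. (wcoeff (A ?g) n)\<^sup>2)"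
              using F by (intro sum_mono2) auto
            also have "\<dots> \<le> (\<Sum>n\<in>F. wcoeff (A ?g) n)\<^sup>2"
              using L2_set_le_sum[of F "\<lambda>n. wcoeff (A ?g) n"] W_pos
              by (auto simp: L2_set_def less_imp_le sum_nonneg real_sqrt_le_iff dest!: sqrt_le_D)
            also have "\<dots> \<le> (e / 4)\<^sup>2"
            proof (rule power_mono)
              have "(\<Sum>n\<in>F. wcoeff (A ?g) n) \<le> (\<Sum>n\<in>F. W n * \<eta>)"
                using N that W_pos
                by (intro sum_mono mult_left_mono) (auto simp: diff[symmetric] less_imp_le)
              also have "\<dots> \<le> e / 4"
                using SW \<open>e > 0\<close> unfolding sum_distrib_right[symmetric] \<eta>_def
                by (simp add: field_simps)
              finally show "(\<Sum>n\<in>F. wcoeff (A ?g) n) \<le> e / 4" .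
              show "0 \<le> (\<Sum>n\<in>F. wcoeff (A ?g) n)"
                using W_pos by (intro sum_nonneg mult_nonneg_nonneg) (auto simp: less_imp_le)
            qed
            finally have 1: "(\<Sum>n\<in>G \<inter> F. (wcoeff (A ?g) n)\<^sup>2) \<le> (e / 4)\<^sup>2" .
            have "(\<Sum>n\<in>G - F. (wcoeff (A ?g) n)\<^sup>2) \<le> (\<delta> * (K * hnorm ?g))\<^sup>2"
              using G \<delta> by (intro off g) (auto simp: F_def not_less)
            also have "\<dots> \<le> (e / 4)\<^sup>2"
            proof (rule power_mono)
              have "\<delta> * (K * hnorm ?g) \<le> \<delta> * (K * R)"
                using \<delta> \<open>0 \<le> K\<close> g by (intro mult_left_mono) auto
              then show "\<delta> * (K * hnorm ?g) \<le> e / 4" using \<delta>e by simp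
              show "0 \<le> \<delta> * (K * hnorm ?g)"
                using \<delta> \<open>0 \<le> K\<close> hnorm_nonneg[OF g(1)] by simp
            qed
            finally have 2: "(\<Sum>n\<in>G - F. (wcoeff (A ?g) n)\<^sup>2) \<le> (e / 4)\<^sup>2" .
            have "(\<Sum>n\<in>G. (wcoeff (A ?g) n)\<^sup>2) \<le> (e / 4)\<^sup>2 + (e / 4)\<^sup>2"
              using 1 2 sum.Int_Diff[OF G, of "\<lambda>n. (wcoeff (A ?g) n)\<^sup>2" F] by linarith
            also have "\<dots> \<le> (e / 2)\<^sup>2" by (simp add: power2_eq_square)
            finally show "(\<Sum>n\<in>G. (wcoeff (A ?g) n)\<^sup>2) \<le> (e / 2)\<^sup>2" .
          qed
          then show ?thesis using \<open>e > 0\<close> by (simp add: eq)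
        qed
        then show ?thesis by blast
      qed
      then have "MCauchy (\<tau> \<circ> r)"
        unfolding MCauchy_def hdist_def using \<tau>H by auto
      then show "\<exists>r. strict_mono r \<and> MCauchy (\<tau> \<circ> r)" using r by blast
    qed
    then show "compactin mtopology (mtopology closure_of (A ` B))"
      using mtotally_bounded_eq_compact_closure_of[OF complete] by blast
  qed

  obtain K' where K': "\<And>f. f \<in> H \<Longrightarrow> hnorm (A f) \<le> K' * hnorm f"
  proof -
    define F where "F = {n. 1 * V n < W n}"
    have F: "finite F" unfolding F_def by (rule WV) simp
    define c where "c = (\<Sum>n\<in>F. W n / V n) + 1"
    have "W n \<le> c * V n" for n
    proof (cases "n \<in> F")
      case True
      then have "W n / V n \<le> (\<Sum>n\<in>F. W n / V n)"
        using W_pos V_pos less_imp_le F by (intro member_le_sum) (auto simp: less_imp_le)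
      then have "W n / V n \<le> c" by (simp add: c_def)
      then show ?thesis using V_pos[of n] by (simp add: field_simps)
    next
      case False
      moreover have "0 \<le> (\<Sum>n\<in>F. W n / V n)"
        using W_pos V_pos less_imp_le by (intro sum_nonneg) (auto simp: less_imp_le)
      then have "1 * V n \<le> c * V n"
        using V_pos[of n] by (intro mult_right_mono) (auto simp: c_def)
      ultimately show ?thesis by (simp add: F_def)
    qed
    moreover have "0 \<le> c"
      using W_pos V_pos unfolding c_def by (intro add_nonneg_nonneg sum_nonneg) (auto simp: less_imp_le)
    ultimately have "hnorm (A f) \<le> c * K * hnorm f" if "f \<in> H" for f
      using that off[OF that, of _ c] \<open>0 \<le> K\<close> hnorm_nonneg[OF that]
      by (intro hnorm_leI A_mem) (auto simp: mult.assoc)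
    then show ?thesis using that by blast
  qed
  show "singular_value A k \<le> K * \<epsilon>"
    if F: "finite F" "card F \<le> k" and \<epsilon>: "0 \<le> \<epsilon>" "\<And>n. n \<notin> F \<Longrightarrow> W n \<le> \<epsilon> * V n" for F \<epsilon> k
  proof (rule singular_value_le[where F = F and l = "\<lambda>n f. coeff (A f) n"])
    fix f assume f: "f \<in> H" and zero: "\<And>n. n \<in> F \<Longrightarrow> coeff (A f) n = 0"
    show "hnorm (A f) \<le> K * \<epsilon> * hnorm f"
    proof (rule hnorm_leI[OF A_mem[OF f]])
      fix G :: "'i set" assume G: "finite G"
      have "(\<Sum>n\<in>G. (wcoeff (A f) n)\<^sup>2) = (\<Sum>n\<in>G - F. (wcoeff (A f) n)\<^sup>2)"
        using G zero by (intro sum.mono_neutral_right) auto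
      also have "\<dots> \<le> (\<epsilon> * (K * hnorm f))\<^sup>2" using G \<epsilon> by (intro off f) auto
      finally show "(\<Sum>n\<in>G. (wcoeff (A f) n)\<^sup>2) \<le> (K * \<epsilon> * hnorm f)\<^sup>2"
        by (simp add: mult_ac)
    qed (use \<open>0 \<le> K\<close> \<epsilon> hnorm_nonneg[OF f] in auto)
  qed (use F \<epsilon> \<open>0 \<le> K\<close> bounded_operator_adjoint[OF K'] in
      \<open>auto simp: A_mem A_add A_scale coeff_add coeff_scale\<close>)
qed

end

end


section \<open>Smooth functions of a real variable\<close>

definition iter_deriv :: "nat \<Rightarrow> (real \<Rightarrow> complex) \<Rightarrow> real \<Rightarrow> complex" where
  "iter_deriv k = (\<lambda>g x. vector_derivative g (at x)) ^^ k"

definition smooth :: "(real \<Rightarrow> complex) \<Rightarrow> bool" where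
  "smooth f \<longleftrightarrow> (\<forall>k x. iter_deriv k f differentiable at x)"

lemma iter_deriv_0 [simp]: "iter_deriv 0 f = f"
  by (simp add: iter_deriv_def)

lemma iter_deriv_Suc: "iter_deriv (Suc k) f = (\<lambda>x. vector_derivative (iter_deriv k f) (at x))"
  by (simp add: iter_deriv_def)

lemma iter_deriv_iter_deriv: "iter_deriv j (iter_deriv k f) = iter_deriv (j + k) f"
  by (simp add: iter_deriv_def funpow_add)

lemma smooth_has_vector_derivative:
  "smooth f \<Longrightarrow> (iter_deriv k f has_vector_derivative iter_deriv (Suc k) f x) (at x)"
  by (simp add: smooth_def iter_deriv_Suc vector_derivative_works)

lemma smooth_has_vector_derivative_0:
  "smooth f \<Longrightarrow> (f has_vector_derivative iter_deriv 1 f x) (at x)"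
  using smooth_has_vector_derivative[of f 0 x] by simp

lemma smooth_iter_deriv: "smooth f \<Longrightarrow> smooth (iter_deriv k f)"
  by (simp add: smooth_def iter_deriv_iter_deriv)

lemma smooth_continuous: "smooth f \<Longrightarrow> continuous_on S f"
  using smooth_has_vector_derivative_0
  by (metis continuous_at_imp_continuous_on has_vector_derivative_continuous)

text \<open>A sequence of functions each of which is the derivative of the preceding one consists of the iterated
derivatives of its first member. The derivatives of sums, products, series and transfers are
found in this way.\<close>

lemma iter_deriv_eq_jet:
  assumes "\<And>k x. (g k has_vector_derivative g (Suc k) x) (at x)"
  shows "iter_deriv k (g 0) = g k"
  by (induction k) (simp_all add: iter_deriv_Suc vector_derivative_at[OF assms])

lemma smooth_jet:
  assumes "\<And>k x. (g k has_vector_derivative g (Suc k) x) (at x)"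
  shows "smooth (g 0)"
  unfolding smooth_def iter_deriv_eq_jet[where g = g, OF assms]
  using assms differentiableI_vector by blast

lemma smooth_coinduct:
  assumes "S f"
    and step: "\<And>f. S f \<Longrightarrow> \<exists>f'. S f' \<and> (\<forall>x. (f has_vector_derivative f' x) (at x))"
  shows "smooth f"
proof -
  have "S (iter_deriv k f)" for k
  proof (induction k)
    case (Suc k)
    then obtain f' where f': "S f'" "\<forall>x. (iter_deriv k f has_vector_derivative f' x) (at x)"
      using step by blast
    then have "iter_deriv (Suc k) f = f'"
      by (auto simp: iter_deriv_Suc fun_eq_iff intro: vector_derivative_at)
    then show ?case using f' by simp
  qed (simp add: assms)
  then show ?thesis
    unfolding smooth_def using step differentiableI_vector by blast
qed

lemma
  assumes "smooth f" "smooth g"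
  shows iter_deriv_add: "iter_deriv k (\<lambda>x. f x + g x) = (\<lambda>x. iter_deriv k f x + iter_deriv k g x)"
    and smooth_add: "smooth (\<lambda>x. f x + g x)"
proof -
  have "((\<lambda>x. iter_deriv k f x + iter_deriv k g x) has_vector_derivative
      iter_deriv (Suc k) f x + iter_deriv (Suc k) g x) (at x)" for k x
    by (intro has_vector_derivative_add smooth_has_vector_derivative assms)
  note jet = iter_deriv_eq_jet[of "\<lambda>k x. iter_deriv k f x + iter_deriv k g x", OF this]
    smooth_jet[of "\<lambda>k x. iter_deriv k f x + iter_deriv k g x", OF this]
  show "iter_deriv k (\<lambda>x. f x + g x) = (\<lambda>x. iter_deriv k f x + iter_deriv k g x)"
    "smooth (\<lambda>x. f x + g x)"
    using jet by simp_all
qed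

lemma
  assumes "smooth f"
  shows iter_deriv_cmult: "iter_deriv k (\<lambda>x. c * f x) = (\<lambda>x. c * iter_deriv k f x)"
    and smooth_cmult: "smooth (\<lambda>x. c * f x)"
proof -
  have "((\<lambda>x. c * iter_deriv k f x) has_vector_derivative c * iter_deriv (Suc k) f x) (at x)" for k x
    by (intro has_vector_derivative_mult_right smooth_has_vector_derivative assms)
  note jet = iter_deriv_eq_jet[of "\<lambda>k x. c * iter_deriv k f x", OF this]
    smooth_jet[of "\<lambda>k x. c * iter_deriv k f x", OF this]
  show "iter_deriv k (\<lambda>x. c * f x) = (\<lambda>x. c * iter_deriv k f x)" "smooth (\<lambda>x. c * f x)"
    using jet by simp_all
qed

lemma smooth_const: "smooth (\<lambda>x. c)"
  by (rule smooth_coinduct[where S = "\<lambda>f. \<exists>c. f = (\<lambda>x. c)"])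
    (auto intro!: exI[of _ "\<lambda>x. 0"] derivative_intros)

text \<open>Pascal's rule in the form needed to differentiate the Leibniz formula.\<close>

lemma Leibniz_step:
  fixes a b :: "nat \<Rightarrow> 'a::comm_ring_1"
  shows "(\<Sum>i\<le>k. of_nat (k choose i) * (a (Suc i) * b (k - i) + a i * b (Suc (k - i)))) =
    (\<Sum>i\<le>Suc k. of_nat (Suc k choose i) * a i * b (Suc k - i))"
proof -
  define x where "x i = a i * b (Suc k - i)" for i
  have "(\<Sum>i\<le>k. of_nat (k choose i) * (a (Suc i) * b (k - i) + a i * b (Suc (k - i)))) =
      (\<Sum>i\<le>k. of_nat (k choose i) * x (Suc i)) + (\<Sum>i\<le>k. of_nat (k choose i) * x i)"
    unfolding sum.distrib[symmetric] x_def
    by (intro sum.cong) (auto simp: algebra_simps Suc_diff_le)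
  also have "(\<Sum>i\<le>k. of_nat (k choose i) * x i) = (\<Sum>i\<le>Suc k. of_nat (k choose i) * x i)"
    by (simp add: binomial_eq_0)
  also have "\<dots> = x 0 + (\<Sum>i\<le>k. of_nat (k choose Suc i) * x (Suc i))"
    by (subst sum.atMost_Suc_shift) simp
  also have "(\<Sum>i\<le>k. of_nat (k choose i) * x (Suc i)) + (x 0 + (\<Sum>i\<le>k. of_nat (k choose Suc i) * x (Suc i))) =
      x 0 + (\<Sum>i\<le>k. of_nat (Suc k choose Suc i) * x (Suc i))"
    by (simp add: sum.distrib algebra_simps)
  also have "\<dots> = (\<Sum>i\<le>Suc k. of_nat (Suc k choose i) * x i)"
    by (subst sum.atMost_Suc_shift) simp
  finally show ?thesis by (simp add: x_def mult.assoc)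
qed

lemma
  assumes "smooth f" "smooth g"
  shows Leibniz: "iter_deriv k (\<lambda>x. f x * g x) =
      (\<lambda>x. \<Sum>i\<le>k. of_nat (k choose i) * iter_deriv i f x * iter_deriv (k - i) g x)"
    and smooth_mult: "smooth (\<lambda>x. f x * g x)"
proof -
  define p where "p k x = (\<Sum>i\<le>k. of_nat (k choose i) * iter_deriv i f x * iter_deriv (k - i) g x)" for k x
  have p: "(p k has_vector_derivative p (Suc k) x) (at x)" for k x
  proof -
    have 1: "((\<lambda>x. \<Sum>i\<le>k. of_nat (k choose i) * (iter_deriv i f x * iter_deriv (k - i) g x))
        has_vector_derivative
        (\<Sum>i\<le>k. of_nat (k choose i) * (iter_deriv i f x * iter_deriv (Suc (k - i)) g x
          + iter_deriv (Suc i) f x * iter_deriv (k - i) g x))) (at x)"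
      by (intro has_vector_derivative_sum has_vector_derivative_mult_right has_vector_derivative_mult
          smooth_has_vector_derivative assms)
    have 2: "p k = (\<lambda>x. \<Sum>i\<le>k. of_nat (k choose i) * (iter_deriv i f x * iter_deriv (k - i) g x))"
      by (simp add: p_def fun_eq_iff mult.assoc)
    have "p (Suc k) x = (\<Sum>i\<le>k. of_nat (k choose i) *
        (iter_deriv (Suc i) f x * iter_deriv (k - i) g x + iter_deriv i f x * iter_deriv (Suc (k - i)) g x))"
      unfolding p_def Leibniz_step[of k "\<lambda>i. iter_deriv i f x" "\<lambda>i. iter_deriv i g x"] ..
    then show ?thesis
      using 1 unfolding 2 by (simp only: add.commute)
  qed
  show "iter_deriv k (\<lambda>x. f x * g x) =
      (\<lambda>x. \<Sum>i\<le>k. of_nat (k choose i) * iter_deriv i f x * iter_deriv (k - i) g x)"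
    "smooth (\<lambda>x. f x * g x)"
    using iter_deriv_eq_jet[of p k, OF p] smooth_jet[of p, OF p] by (simp_all add: p_def[abs_def])
qed

text \<open>The functions \<open>f / v^n\<close> with smooth \<open>f\<close> form a class closed under differentiation.\<close>

lemma smooth_inverse:
  assumes v: "smooth v" and nz: "\<And>x. v x \<noteq> 0"
  shows "smooth (\<lambda>x. inverse (v x))"
proof (rule smooth_coinduct[where S = "\<lambda>h. \<exists>f n. smooth f \<and> h = (\<lambda>x. f x * inverse (v x) ^ n)"])
  show "\<exists>f n. smooth f \<and> (\<lambda>x. inverse (v x)) = (\<lambda>x. f x * inverse (v x) ^ n)"
    using smooth_const[of 1] by (intro exI[of _ "\<lambda>x. 1"] exI[of _ 1]) simp
  fix h assume "\<exists>f n. smooth f \<and> h = (\<lambda>x. f x * inverse (v x) ^ n)"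
  then obtain f n where f: "smooth f" and h: "h = (\<lambda>x. f x * inverse (v x) ^ n)" by blast
  let ?g = "\<lambda>x. iter_deriv 1 f x * v x + (- of_nat n) * (f x * iter_deriv 1 v x)"
  have g: "smooth ?g"
    by (intro smooth_add smooth_mult smooth_cmult smooth_iter_deriv f v)
  have "(h has_vector_derivative ?g x * inverse (v x) ^ Suc n) (at x)" for x
  proof -
    have "((\<lambda>z. inverse z ^ n) has_field_derivative - of_nat n * inverse (v x) ^ Suc n) (at (v x))"
      by (rule DERIV_cong[OF DERIV_power[OF DERIV_inverse[OF nz]]]) (cases n; simp add: algebra_simps)
    from field_vector_diff_chain_at[OF smooth_has_vector_derivative_0[OF v] this]
    have "((\<lambda>x. inverse (v x) ^ n) has_vector_derivative
        iter_deriv 1 v x * (- of_nat n * inverse (v x) ^ Suc n)) (at x)"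
      by (simp add: o_def)
    from has_vector_derivative_mult[OF smooth_has_vector_derivative_0[OF f] this]
    show ?thesis
      unfolding h by (rule has_vector_derivative_eq_rhs) (use nz[of x] in \<open>simp add: field_simps\<close>)
  qed
  then show "\<exists>h'. (\<exists>f n. smooth f \<and> h' = (\<lambda>x. f x * inverse (v x) ^ n)) \<and>
      (\<forall>x. (h has_vector_derivative h' x) (at x))"
    using g by (intro exI[of _ "\<lambda>x. ?g x * inverse (v x) ^ Suc n"] conjI exI[of _ ?g] exI[of _ "Suc n"]) auto
qed

section \<open>Periodic functions\<close>

definition periodic :: "(real \<Rightarrow> 'a) \<Rightarrow> bool" where
  "periodic f \<longleftrightarrow> (\<forall>x. f (x + 1) = f x)"

lemma periodic_of_int: "periodic f \<Longrightarrow> f (x + of_int n) = f x"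
proof (induction n rule: int_induct[where k = 0])
  case (step1 i)
  then show ?case unfolding periodic_def by (metis add.assoc of_int_1 of_int_add)
next
  case (step2 i)
  have "f (x + of_int (i - 1) + 1) = f (x + of_int (i - 1))"
    using step2.prems unfolding periodic_def by blast
  then show ?case using step2 by (simp add: algebra_simps)
qed simp

lemma periodic_frac: "periodic f \<Longrightarrow> f (frac x) = f x"
  using periodic_of_int[of f x "- floor x"] by (simp add: frac_def)

lemma periodic_iter_deriv:
  assumes "smooth f" "periodic f"
  shows "periodic (iter_deriv k f)"
proof (induction k)
  case (Suc k)
  have "(iter_deriv k f has_vector_derivative iter_deriv (Suc k) f (x + 1)) (at x)" for x
  proof -
    have "((iter_deriv k f \<circ> (\<lambda>x. x + 1)) has_vector_derivative 1 *\<^sub>R iter_deriv (Suc k) f (x + 1)) (at x)"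
      by (intro vector_diff_chain_at smooth_has_vector_derivative assms) (auto intro!: derivative_eq_intros)
    moreover have "iter_deriv k f \<circ> (\<lambda>x. x + 1) = iter_deriv k f"
      using Suc by (auto simp: periodic_def)
    ultimately show ?thesis by simp
  qed
  then show ?case
    unfolding periodic_def using smooth_has_vector_derivative[OF assms(1)] vector_derivative_unique_at
    by blast
qed (use assms in simp)

lemma periodic_mult: "\<lbrakk>periodic f; periodic g\<rbrakk> \<Longrightarrow> periodic (\<lambda>x. f x * g x)"
  by (simp add: periodic_def)

lemma periodic_continuous_bounded:
  fixes f :: "real \<Rightarrow> complex"
  assumes "periodic f" "continuous_on UNIV f"
  obtains B where "0 \<le> B" "\<And>x. cmod (f x) \<le> B"
proof -
  have "bounded (f ` {0..1})"
    using assms(2) by (intro compact_imp_bounded compact_continuous_image) (auto intro: continuous_on_subset)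
  then obtain B where B: "\<And>x. x \<in> {0..1} \<Longrightarrow> cmod (f x) \<le> B" by (meson bounded_iff imageI)
  have *: "cmod (f x) \<le> B" for x
    using B[of "frac x"] periodic_frac[OF assms(1), of x] frac_lt_1[of x] by (simp add: less_imp_le)
  show ?thesis
    by (rule that[of B]) (use * in \<open>auto intro: order_trans[OF norm_ge_zero]\<close>)
qed

text \<open>The series of the derivatives converges uniformly, so it can be integrated term by term; the result
is then differentiated by the fundamental theorem of calculus.\<close>

lemma has_vector_derivative_infsum:
  fixes f f' :: "'i \<Rightarrow> real \<Rightarrow> complex"
  assumes deriv: "\<And>i x. (f i has_vector_derivative f' i x) (at x)"
    and cont: "\<And>i. continuous_on UNIV (f' i)"
    and bound: "\<And>i x. norm (f' i x) \<le> M i" and M: "M summable_on UNIV"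
    and summ: "\<And>x. (\<lambda>i. f i x) summable_on UNIV"
  shows "((\<lambda>x. \<Sum>\<^sub>\<infinity>i. f i x) has_vector_derivative (\<Sum>\<^sub>\<infinity>i. f' i x)) (at x)"
proof -
  define g where "g x = (\<Sum>\<^sub>\<infinity>i. f i x)" for x
  define G where "G x = (\<Sum>\<^sub>\<infinity>i. f' i x)" for x
  have unif: "uniform_limit S (\<lambda>F x. \<Sum>i\<in>F. f' i x) G (finite_subsets_at_top UNIV)" for S
    unfolding G_def by (rule Weierstrass_m_test_general[OF bound M])
  have contF: "continuous_on S (\<lambda>x. \<Sum>i\<in>F. f' i x)" for F S
    by (intro continuous_on_sum continuous_on_subset[OF cont]) simp
  have contG: "continuous_on S G" for S
    by (rule uniform_limit_theorem[OF _ unif]) (auto intro!: always_eventually contF)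
  have eq: "integral {a..y} G = g y - g a" if "a \<le> y" for a y
  proof -
    obtain I J where I: "\<And>F. ((\<lambda>x. \<Sum>i\<in>F. f' i x) has_integral I F) {a..y}"
      and J: "(G has_integral J) {a..y}" and lim: "(I \<longlongrightarrow> J) (finite_subsets_at_top UNIV)"
      by (rule uniform_limit_integral[OF unif contF]) auto
    have "I F = (\<Sum>i\<in>F. f i y) - (\<Sum>i\<in>F. f i a)" for F
    proof (rule has_integral_unique[OF I])
      show "((\<lambda>x. \<Sum>i\<in>F. f' i x) has_integral (\<Sum>i\<in>F. f i y) - (\<Sum>i\<in>F. f i a)) {a..y}"
        using that by (intro fundamental_theorem_of_calculus has_vector_derivative_sum)
          (auto intro: has_vector_derivative_at_within deriv)
    qed
    then have "((\<lambda>F. (\<Sum>i\<in>F. f i y) - (\<Sum>i\<in>F. f i a)) \<longlongrightarrow> J) (finite_subsets_at_top UNIV)"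
      using lim by presburger
    moreover have "((\<lambda>F. (\<Sum>i\<in>F. f i y) - (\<Sum>i\<in>F. f i a)) \<longlongrightarrow> g y - g a) (finite_subsets_at_top UNIV)"
      unfolding g_def by (intro tendsto_diff infsum_tendsto summ)
    ultimately have "J = g y - g a"
      using tendsto_unique finite_subsets_at_top_neq_bot by blast
    then show ?thesis using J by (simp add: integral_unique)
  qed
  have "((\<lambda>y. integral {x - 1..y} G) has_vector_derivative G x) (at x within {x - 1..x + 1})"
    by (rule integral_has_vector_derivative[OF contG]) auto
  then have "((\<lambda>y. g (x - 1) + integral {x - 1..y} G) has_vector_derivative G x) (at x within {x - 1..x + 1})"
    using has_vector_derivative_add[OF has_vector_derivative_const] by fastforce
  then have "(g has_vector_derivative G x) (at x within {x - 1..x + 1})"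
    by (rule has_vector_derivative_transform[rotated 2]) (auto simp: eq)
  then have "(g has_vector_derivative G x) (at x)"
    using at_within_Icc_at[of "x - 1" x "x + 1"] by simp
  then show ?thesis by (simp add: g_def[abs_def] G_def)
qed


section \<open>Fourier series of smooth periodic functions\<close>

definition periodic_continuous :: "(real \<Rightarrow> complex) set" where
  "periodic_continuous = {f. continuous_on UNIV f \<and> periodic f}"

definition L2_ip :: "(real \<Rightarrow> complex) \<Rightarrow> (real \<Rightarrow> complex) \<Rightarrow> complex" where
  "L2_ip f g = integral {0..1} (\<lambda>x. f x * cnj (g x))"

lemma periodic_continuousD:
  "f \<in> periodic_continuous \<Longrightarrow> continuous_on S f" "f \<in> periodic_continuous \<Longrightarrow> periodic f"
  by (auto simp: periodic_continuous_def intro: continuous_on_subset)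

lemma smooth_periodic_continuous: "\<lbrakk>smooth f; periodic f\<rbrakk> \<Longrightarrow> f \<in> periodic_continuous"
  by (simp add: periodic_continuous_def smooth_continuous)

lemma periodic_continuous_mult:
  "\<lbrakk>f \<in> periodic_continuous; g \<in> periodic_continuous\<rbrakk> \<Longrightarrow> (\<lambda>x. f x * g x) \<in> periodic_continuous"
  by (auto simp: periodic_continuous_def periodic_def intro!: continuous_intros)

lemma L2_integrable:
  "\<lbrakk>f \<in> periodic_continuous; g \<in> periodic_continuous\<rbrakk> \<Longrightarrow> (\<lambda>x. f x * cnj (g x)) integrable_on {0..1}"
  by (intro integrable_continuous_interval continuous_intros periodic_continuousD)

lemma L2_ip_self:
  assumes "f \<in> periodic_continuous"
  shows "L2_ip f f = of_real (integral {0..1} (\<lambda>x. (cmod (f x))\<^sup>2))"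
proof -
  have "(\<lambda>x. (cmod (f x))\<^sup>2) integrable_on {0..1}"
    by (intro integrable_continuous_interval continuous_intros periodic_continuousD assms)
  then have "((\<lambda>x. of_real ((cmod (f x))\<^sup>2) :: complex) has_integral
      of_real (integral {0..1} (\<lambda>x. (cmod (f x))\<^sup>2))) {0..1}"
    by (intro has_integral_of_real integrable_integral)
  then show ?thesis
    unfolding L2_ip_def complex_norm_square[symmetric] of_real_power by (rule integral_unique)
qed

text \<open>A periodic function that vanishes on \<open>[0, 1]\<close> vanishes everywhere, so integration over one period is
definite.\<close>

lemma L2: "function_inner_space periodic_continuous L2_ip"
proof
  show "cfun.subspace periodic_continuous"
    unfolding cfun.subspace_def periodic_continuous_def periodic_def zero_fun_def plus_fun_def
    by (auto intro!: continuous_intros)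
next
  fix f g h :: "real \<Rightarrow> complex"
  assume "f \<in> periodic_continuous" "g \<in> periodic_continuous" "h \<in> periodic_continuous"
  then show "L2_ip (f + g) h = L2_ip f h + L2_ip g h"
    unfolding L2_ip_def
    by (subst integral_add[symmetric]) (simp_all add: L2_integrable distrib_right)
next
  fix f h :: "real \<Rightarrow> complex" and c
  show "L2_ip (fscale c f) h = c * L2_ip f h"
    unfolding L2_ip_def by (simp add: mult.assoc)
next
  fix f g :: "real \<Rightarrow> complex"
  show "L2_ip g f = cnj (L2_ip f g)"
    unfolding L2_ip_def integral_cnj by (simp add: mult.commute)
next
  fix f assume f: "f \<in> periodic_continuous"
  have cont: "continuous_on {0..1} (\<lambda>x. (cmod (f x))\<^sup>2)"
    by (intro continuous_intros periodic_continuousD f)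
  show "0 \<le> Re (L2_ip f f)"
    unfolding L2_ip_self[OF f] using cont
    by (auto intro!: Henstock_Kurzweil_Integration.integral_nonneg integrable_continuous_interval)
  assume "L2_ip f f = 0"
  then have "\<forall>x\<in>{0..1}. (cmod (f x))\<^sup>2 = 0"
    using integral_eq_0_iff[OF cont] unfolding L2_ip_self[OF f] by simp
  then have "f (frac x) = 0" for x
    using frac_lt_1[of x] by (simp add: less_imp_le)
  then show "f = 0"
    using periodic_frac[OF periodic_continuousD(2)[OF f]] by (simp add: fun_eq_iff)
qed

abbreviation L2_norm :: "(real \<Rightarrow> complex) \<Rightarrow> real" where
  "L2_norm \<equiv> function_inner_space.hnorm L2_ip"

lemmas L2_Re_ip_self = function_inner_space.hnorm_sq[OF L2]
lemmas L2_Bessel_inequality = function_inner_space.Bessel_inequality[OF L2]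
lemmas L2_add_mem = function_inner_space.add_mem[OF L2]
lemmas L2_diff_mem = function_inner_space.diff_mem[OF L2]
lemmas L2_hnorm_nonneg = function_inner_space.hnorm_nonneg[OF L2]
lemmas L2_hnorm_triangle = function_inner_space.hnorm_triangle[OF L2]
lemmas L2_ip_add_left = function_inner_space.ip_add_left[OF L2]
lemmas L2_ip_scale_left = function_inner_space.ip_scale_left[OF L2]
lemmas L2_Pythagoras_orthonormal = function_inner_space.Pythagoras_orthonormal[OF L2]
lemmas L2_scale_mem = function_inner_space.scale_mem[OF L2]
lemmas L2_sum_mem = function_inner_space.sum_mem[OF L2]

lemma L2_norm_sq: "f \<in> periodic_continuous \<Longrightarrow> (L2_norm f)\<^sup>2 = integral {0..1} (\<lambda>x. (cmod (f x))\<^sup>2)"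
  by (simp add: L2_Re_ip_self L2_ip_self)

lemma L2_norm_mult_le:
  assumes f: "f \<in> periodic_continuous" and g: "g \<in> periodic_continuous" and B: "\<And>x. cmod (g x) \<le> B"
  shows "L2_norm (\<lambda>x. g x * f x) \<le> B * L2_norm f"
proof (rule power2_le_imp_le)
  have B0: "0 \<le> B" using B[of 0] norm_ge_zero order_trans by blast
  note gf = periodic_continuous_mult[OF g f]
  have "(L2_norm (\<lambda>x. g x * f x))\<^sup>2 \<le> integral {0..1} (\<lambda>x. B\<^sup>2 * (cmod (f x))\<^sup>2)"
    unfolding L2_norm_sq[OF gf]
  proof (rule integral_le)
    show "(cmod (g x * f x))\<^sup>2 \<le> B\<^sup>2 * (cmod (f x))\<^sup>2" for x
      unfolding norm_mult power_mult_distrib by (intro mult_right_mono power_mono B) auto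
  qed (intro integrable_continuous_interval continuous_intros periodic_continuousD f g)+
  also have "\<dots> = (B * L2_norm f)\<^sup>2"
    by (simp add: L2_norm_sq f power_mult_distrib)
  finally show "(L2_norm (\<lambda>x. g x * f x))\<^sup>2 \<le> (B * L2_norm f)\<^sup>2" .
  show "0 \<le> B * L2_norm f" using B0 L2_hnorm_nonneg[OF f] by simp
qed

lemma L2_norm_le_bound:
  assumes f: "f \<in> periodic_continuous" and B: "\<And>x. cmod (f x) \<le> B"
  shows "L2_norm f \<le> B"
proof -
  have one: "(\<lambda>x. 1) \<in> periodic_continuous"
    by (simp add: periodic_continuous_def periodic_def)
  then have "L2_norm (\<lambda>x. 1) = 1"
    using L2_norm_sq[OF one] L2_hnorm_nonneg[OF one] by (simp add: power2_eq_1_iff)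
  then show ?thesis using L2_norm_mult_le[OF one f B] by simp
qed

definition freq :: "int \<Rightarrow> complex" where
  "freq n = 2 * \<i> * of_real pi * of_int n"

definition character :: "int \<Rightarrow> real \<Rightarrow> complex" where
  "character n x = exp (freq n * of_real x)"

lemma freq_add: "freq (m + n) = freq m + freq n"
  by (simp add: freq_def algebra_simps)

lemma norm_freq: "cmod (freq n) = 2 * pi * \<bar>of_int n\<bar>"
  by (simp add: freq_def norm_mult)

lemma freq_eq_0_iff [simp]: "freq n = 0 \<longleftrightarrow> n = 0"
  by (simp add: freq_def)

lemma character_add: "character (m + n) x = character m x * character n x"
  by (simp add: character_def freq_add distrib_right exp_add)

lemma character_0 [simp]: "character 0 x = 1"
  by (simp add: character_def freq_def)

lemma character_at_0 [simp]: "character n 0 = 1"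
  by (simp add: character_def)

lemma cnj_character: "cnj (character n x) = character (- n) x"
  by (simp add: character_def freq_def exp_cnj)

lemma norm_character [simp]: "cmod (character n x) = 1"
  by (simp add: character_def freq_def)

lemma character_has_vector_derivative:
  "(character n has_vector_derivative freq n * character n x) (at x)"
proof -
  have "((\<lambda>z. exp (freq n * z)) has_field_derivative freq n * character n x) (at (of_real x))"
    unfolding character_def by (auto intro!: derivative_eq_intros)
  from field_vector_diff_chain_at[OF has_vector_derivative_of_real[OF DERIV_ident] this]
  show ?thesis unfolding character_def[abs_def] o_def by simp
qed

lemma character_shift: "character n (x + y) = character n x * character n y"
  by (simp add: character_def distrib_left exp_add)

lemma character_of_int [simp]: "character n (of_int m) = 1"
proof -
  have eq: "freq n * of_real (of_int m) = 2 * of_int (n * m) * of_real pi * \<i>"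
    by (simp add: freq_def)
  show ?thesis
    unfolding character_def eq using exp_integer_2pi[of "of_int (n * m)"] by simp
qed

lemma character_eq_1_iff: "character 1 x = 1 \<longleftrightarrow> x \<in> \<int>"
proof
  assume "character 1 x = 1"
  then obtain n :: int where "Im (freq 1 * of_real x) = of_int (2 * n) * pi"
    unfolding character_def exp_eq_1 by auto
  then have "x = of_int n" by (simp add: freq_def)
  then show "x \<in> \<int>" by simp
qed (auto elim!: Ints_cases)

lemma periodic_character: "periodic (character n)"
  using character_of_int[of n 1] by (simp add: periodic_def character_shift)

lemma smooth_character: "smooth (character n)"
proof -
  have "((\<lambda>x. freq n ^ k * character n x) has_vector_derivative freq n ^ Suc k * character n x) (at x)" for k x
    using has_vector_derivative_mult_right[OF character_has_vector_derivative[of n x], of "freq n ^ k"]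
    by (simp add: mult_ac)
  from smooth_jet[of "\<lambda>k x. freq n ^ k * character n x", OF this] show ?thesis by simp
qed

lemma character_periodic_continuous: "character n \<in> periodic_continuous"
  by (intro smooth_periodic_continuous smooth_character periodic_character)

lemma integral_character: "integral {0..1} (character n) = (if n = 0 then 1 else 0)"
proof (cases "n = 0")
  case False
  have "((\<lambda>x. character n x / freq n) has_vector_derivative character n x) (at x)" for x
    using has_vector_derivative_mult_right[OF character_has_vector_derivative[of n x], of "1 / freq n"] False
    by simp
  then have "(character n has_integral character n 1 / freq n - character n 0 / freq n) {0..1}"
    by (intro fundamental_theorem_of_calculus) (auto intro: has_vector_derivative_at_within)
  then show ?thesis
    using False character_of_int[of n 1] by (simp add: integral_unique)
qed (simp add: character_def[abs_def] freq_def)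

lemma character_orthonormal: "L2_ip (character m) (character n) = (if m = n then 1 else 0)"
proof -
  have "L2_ip (character m) (character n) = integral {0..1} (character (m - n))"
    by (simp add: L2_ip_def cnj_character character_add[symmetric])
  then show ?thesis by (simp add: integral_character)
qed

definition fourier :: "(real \<Rightarrow> complex) \<Rightarrow> int \<Rightarrow> complex" where
  "fourier f n = L2_ip f (character n)"

lemma fourier_add:
  "\<lbrakk>f \<in> periodic_continuous; g \<in> periodic_continuous\<rbrakk> \<Longrightarrow>
    fourier (\<lambda>x. f x + g x) n = fourier f n + fourier g n"
  using L2_ip_add_left[of f g "character n"] character_periodic_continuous
  by (simp add: fourier_def plus_fun_def)

lemma fourier_cmult: "f \<in> periodic_continuous \<Longrightarrow> fourier (\<lambda>x. c * f x) n = c * fourier f n"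
  using L2_ip_scale_left[of f "character n"] character_periodic_continuous by (simp add: fourier_def)

lemma fourier_Bessel:
  "\<lbrakk>f \<in> periodic_continuous; finite F\<rbrakk> \<Longrightarrow> (\<Sum>n\<in>F. (cmod (fourier f n))\<^sup>2) \<le> (L2_norm f)\<^sup>2"
  unfolding fourier_def
  by (intro L2_Bessel_inequality character_periodic_continuous character_orthonormal) auto

lemma fourier_le_hnorm: "f \<in> periodic_continuous \<Longrightarrow> cmod (fourier f n) \<le> L2_norm f"
  using fourier_Bessel[of f "{n}"] L2_hnorm_nonneg[of f] power2_le_imp_le by auto

lemma fourier_character_mult:
  "fourier (\<lambda>x. character m x * f x) n = fourier f (n - m)"
  unfolding fourier_def L2_ip_def cnj_character
proof (rule arg_cong[where f = "integral _"], rule ext)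
  fix x
  show "character m x * f x * character (- n) x = f x * character (- (n - m)) x"
    using character_add[of m "- n" x] by (simp add: mult_ac)
qed

text \<open>Integration by parts; the boundary terms cancel by periodicity.\<close>

lemma fourier_iter_deriv:
  assumes f: "smooth f" "periodic f"
  shows "fourier (iter_deriv k f) n = freq n ^ k * fourier f n"
proof (induction k)
  case (Suc k)
  let ?g = "iter_deriv k f" and ?g' = "iter_deriv (Suc k) f"
  have pc: "iter_deriv j f \<in> periodic_continuous" for j
    by (intro smooth_periodic_continuous smooth_iter_deriv periodic_iter_deriv f)
  have "((\<lambda>x. ?g x * character (- n) x) has_vector_derivative
      ?g x * (freq (- n) * character (- n) x) + ?g' x * character (- n) x) (at x)" for x
    by (intro has_vector_derivative_mult smooth_has_vector_derivative f character_has_vector_derivative)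
  then have "((\<lambda>x. ?g x * (freq (- n) * character (- n) x) + ?g' x * character (- n) x) has_integral
      ?g 1 * character (- n) 1 - ?g 0 * character (- n) 0) {0..1}"
    by (intro fundamental_theorem_of_calculus) (auto intro: has_vector_derivative_at_within)
  moreover have "?g 1 * character (- n) 1 = ?g 0 * character (- n) 0"
    using periodic_iter_deriv[OF f, of k] character_of_int[of "- n" 1] unfolding periodic_def
    by (metis add_0 character_at_0 of_int_1)
  ultimately have "((\<lambda>x. - freq n * (?g x * cnj (character n x)) + ?g' x * cnj (character n x)) has_integral 0) {0..1}"
    by (simp add: cnj_character freq_def mult_ac)
  moreover have "((\<lambda>x. - freq n * (?g x * cnj (character n x)) + ?g' x * cnj (character n x)) has_integral
      - freq n * fourier ?g n + fourier ?g' n) {0..1}"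
    unfolding fourier_def L2_ip_def
    by (intro has_integral_add has_integral_mult_right integrable_integral L2_integrable pc
        character_periodic_continuous)
  ultimately have "- freq n * fourier ?g n + fourier ?g' n = 0"
    using has_integral_unique by blast
  then show ?case using Suc by (simp add: algebra_simps)
qed simp

definition rapidly_decreasing :: "(int \<Rightarrow> complex) \<Rightarrow> bool" where
  "rapidly_decreasing a \<longleftrightarrow> (\<forall>k. \<exists>C. \<forall>n. cmod (freq n) ^ k * cmod (a n) \<le> C)"

lemma rapidly_decreasing_fourier:
  assumes f: "smooth f" "periodic f"
  shows "rapidly_decreasing (fourier f)"
  unfolding rapidly_decreasing_def
proof (intro allI)
  fix k
  have "iter_deriv k f \<in> periodic_continuous"
    by (intro smooth_periodic_continuous smooth_iter_deriv periodic_iter_deriv f)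
  from fourier_le_hnorm[OF this]
  show "\<exists>C. \<forall>n. cmod (freq n) ^ k * cmod (fourier f n) \<le> C"
    by (auto simp: fourier_iter_deriv[OF f] norm_mult norm_power)
qed

lemma summable_inverse_one_plus_freq_sq: "(\<lambda>n. 1 / (1 + (cmod (freq n))\<^sup>2)) summable_on UNIV"
proof -
  define u where "u n = 1 / (1 + (cmod (freq n))\<^sup>2)" for n
  have u_nat: "(\<lambda>n. u (int n)) summable_on UNIV"
  proof (rule summable_nonneg_imp_summable_on)
    show "summable (\<lambda>n. u (int n))"
    proof (rule summable_comparison_test')
      show "summable (\<lambda>n. inverse (real n ^ 2))" by (rule inverse_power_summable) simp
      fix n :: nat assume n: "1 \<le> n"
      have "1 * (real n)\<^sup>2 \<le> (2 * pi)\<^sup>2 * (real n)\<^sup>2"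
        using pi_ge_two by (intro mult_right_mono one_le_power) auto
      then have "(real n)\<^sup>2 \<le> 1 + (2 * pi * real n)\<^sup>2" by (simp add: power_mult_distrib)
      then have "1 / (1 + (2 * pi * real n)\<^sup>2) \<le> 1 / (real n)\<^sup>2"
        using n by (intro divide_left_mono) (auto simp: add_pos_nonneg)
      then show "norm (u (int n)) \<le> inverse (real n ^ 2)"
        by (simp add: u_def norm_freq inverse_eq_divide)
    qed
  qed (simp add: u_def add_nonneg_nonneg)
  have u_neg: "u (- n) = u n" for n by (simp add: u_def norm_freq)
  have 1: "u summable_on range int"
    using u_nat by (subst summable_on_reindex) (auto simp: o_def)
  have "(\<lambda>n. u (int n)) summable_on {1..}"
    by (rule summable_on_subset_banach[OF u_nat]) simp
  then have 2: "u summable_on (\<lambda>n. - int n) ` {1..}"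
    by (subst summable_on_reindex) (auto simp: o_def u_neg inj_on_def)
  have "range int \<inter> (\<lambda>n. - int n) ` {1..} = {}" by auto
  from summable_on_Un_disjoint[OF 1 2 this]
  have "u summable_on range int \<union> (\<lambda>n. - int n) ` {1..}" .
  moreover have "range int \<union> (\<lambda>n. - int n) ` {1..} = UNIV"
  proof -
    have "n \<in> range int \<union> (\<lambda>n. - int n) ` {1..}" for n :: int
      by (cases n rule: int_cases4) auto
    then show ?thesis by blast
  qed
  ultimately show ?thesis unfolding u_def by simp
qed

text \<open>Two more powers of the frequency give a summable majorant.\<close>

lemma rapidly_decreasing_summable:
  assumes "rapidly_decreasing a"
  shows "(\<lambda>n. cmod (freq n) ^ k * cmod (a n)) summable_on UNIV"
proof -
  obtain C1 C2 where C1: "\<And>n. cmod (freq n) ^ k * cmod (a n) \<le> C1"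
    and C2: "\<And>n. cmod (freq n) ^ (k + 2) * cmod (a n) \<le> C2"
    using assms unfolding rapidly_decreasing_def by meson
  show ?thesis
  proof (rule summable_on_comparison_test)
    show "(\<lambda>n. (C1 + C2) * (1 / (1 + (cmod (freq n))\<^sup>2))) summable_on UNIV"
      by (intro summable_on_cmult_right summable_inverse_one_plus_freq_sq)
    fix n
    have "(cmod (freq n) ^ k * cmod (a n)) * (1 + (cmod (freq n))\<^sup>2) \<le> C1 + C2"
      using C1[of n] C2[of n] by (simp add: algebra_simps power_add power2_eq_square)
    moreover have "0 < 1 + (cmod (freq n))\<^sup>2" by (simp add: add_pos_nonneg)
    ultimately show "cmod (freq n) ^ k * cmod (a n) \<le> (C1 + C2) * (1 / (1 + (cmod (freq n))\<^sup>2))"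
      by (simp add: pos_le_divide_eq)
  qed simp
qed

lemma rapidly_decreasing_freq_power:
  assumes "rapidly_decreasing a"
  shows "rapidly_decreasing (\<lambda>n. freq n ^ j * a n)"
  unfolding rapidly_decreasing_def
proof (intro allI)
  fix k
  obtain C where "\<And>n. cmod (freq n) ^ (k + j) * cmod (a n) \<le> C"
    using assms unfolding rapidly_decreasing_def by meson
  then show "\<exists>C. \<forall>n. cmod (freq n) ^ k * cmod (freq n ^ j * a n) \<le> C"
    by (auto simp: norm_mult norm_power power_add mult.assoc)
qed

definition trig_series :: "(int \<Rightarrow> complex) \<Rightarrow> real \<Rightarrow> complex" where
  "trig_series a x = (\<Sum>\<^sub>\<infinity>n. a n * character n x)"

context
  fixes a :: "int \<Rightarrow> complex"
  assumes a: "rapidly_decreasing a"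
begin

lemma trig_series_summable: "(\<lambda>n. a n * character n x) summable_on UNIV"
  by (rule Infinite_Sum.abs_summable_summable)
    (use rapidly_decreasing_summable[OF a, of 0] in \<open>simp add: norm_mult\<close>)

lemma trig_series_has_vector_derivative:
  "(trig_series a has_vector_derivative trig_series (\<lambda>n. freq n * a n) x) (at x)"
proof -
  have "((\<lambda>x. \<Sum>\<^sub>\<infinity>n. a n * character n x) has_vector_derivative
      (\<Sum>\<^sub>\<infinity>n. a n * (freq n * character n x))) (at x)"
  proof (rule has_vector_derivative_infsum)
    show "((\<lambda>x. a n * character n x) has_vector_derivative a n * (freq n * character n x)) (at x)" for n x
      by (intro has_vector_derivative_mult_right character_has_vector_derivative)
    show "continuous_on UNIV (\<lambda>x. a n * (freq n * character n x))" for n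
      by (intro continuous_intros smooth_continuous smooth_character)
    show "(\<lambda>n. cmod (freq n) ^ 1 * cmod (a n)) summable_on UNIV"
      by (rule rapidly_decreasing_summable[OF a])
  qed (auto simp: norm_mult intro: trig_series_summable)
  then show ?thesis by (simp add: trig_series_def[abs_def] mult_ac)
qed

end

lemma
  assumes a: "rapidly_decreasing a"
  shows smooth_trig_series: "smooth (trig_series a)"
    and iter_deriv_trig_series: "iter_deriv k (trig_series a) = trig_series (\<lambda>n. freq n ^ k * a n)"
proof -
  have jet: "(trig_series (\<lambda>n. freq n ^ k * a n) has_vector_derivative trig_series (\<lambda>n. freq n ^ Suc k * a n) x) (at x)" for k x
    using trig_series_has_vector_derivative[OF rapidly_decreasing_freq_power[OF a]] by (simp add: mult.assoc)
  show "smooth (trig_series a)" "iter_deriv k (trig_series a) = trig_series (\<lambda>n. freq n ^ k * a n)"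
    using smooth_jet[of "\<lambda>k. trig_series (\<lambda>n. freq n ^ k * a n)", OF jet]
      iter_deriv_eq_jet[of "\<lambda>k. trig_series (\<lambda>n. freq n ^ k * a n)", OF jet] by simp_all
qed

lemma periodic_trig_series: "periodic (trig_series a)"
  using periodic_character by (simp add: trig_series_def periodic_def)

lemma trig_series_periodic_continuous: "rapidly_decreasing a \<Longrightarrow> trig_series a \<in> periodic_continuous"
  by (intro smooth_periodic_continuous smooth_trig_series periodic_trig_series)

lemma norm_trig_series_le:
  assumes "rapidly_decreasing a"
  shows "cmod (trig_series a x) \<le> (\<Sum>\<^sub>\<infinity>n. cmod (a n))"
  unfolding trig_series_def
  using norm_infsum_bound[of "\<lambda>n. a n * character n x" UNIV] rapidly_decreasing_summable[OF assms, of 0]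
  by (simp add: norm_mult)

text \<open>The series converges uniformly and may be integrated against a character term by term.\<close>

lemma fourier_trig_series:
  assumes a: "rapidly_decreasing a"
  shows "fourier (trig_series a) m = a m"
proof -
  have unif: "uniform_limit {0..1} (\<lambda>F x. \<Sum>n\<in>F. a n * character n x * cnj (character m x))
      (\<lambda>x. \<Sum>\<^sub>\<infinity>n. a n * character n x * cnj (character m x)) (finite_subsets_at_top UNIV)"
    by (rule Weierstrass_m_test_general[where M = "\<lambda>n. cmod (a n)"])
      (use rapidly_decreasing_summable[OF a, of 0] in \<open>auto simp: norm_mult\<close>)
  have cont: "continuous_on {0..1} (\<lambda>x. \<Sum>n\<in>F. a n * character n x * cnj (character m x))" for F
    by (intro continuous_intros smooth_continuous smooth_character)
  obtain I J where I: "\<And>F. ((\<lambda>x. \<Sum>n\<in>F. a n * character n x * cnj (character m x)) has_integral I F) {0..1}"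
    and J: "((\<lambda>x. \<Sum>\<^sub>\<infinity>n. a n * character n x * cnj (character m x)) has_integral J) {0..1}"
    and lim: "(I \<longlongrightarrow> J) (finite_subsets_at_top UNIV)"
    by (rule uniform_limit_integral[OF unif cont]) auto
  have "J = fourier (trig_series a) m"
    using integral_unique[OF J] by (simp add: fourier_def L2_ip_def trig_series_def infsum_cmult_left')
  have "I F = (\<Sum>n\<in>F. if n = m then a m else 0)" if "finite F" for F
  proof -
    have "((\<lambda>x. \<Sum>n\<in>F. a n * (character n x * cnj (character m x))) has_integral
        (\<Sum>n\<in>F. a n * L2_ip (character n) (character m))) {0..1}"
      unfolding L2_ip_def
      by (intro has_integral_sum has_integral_mult_right integrable_integral L2_integrable
          character_periodic_continuous that)
    then have "I F = (\<Sum>n\<in>F. a n * L2_ip (character n) (character m))"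
      using has_integral_unique[OF I] by (simp add: mult.assoc)
    then show ?thesis by (simp add: character_orthonormal if_distrib[of "\<lambda>x. _ * x"] cong: if_cong)
  qed
  then have ev: "\<forall>\<^sub>F F in finite_subsets_at_top UNIV. I F = (\<Sum>n\<in>F. if n = m then a m else 0)"
    by (intro eventually_finite_subsets_at_top_weakI)
  have "((\<lambda>n. if n = m then a m else 0) has_sum J) UNIV"
    unfolding has_sum_def using lim ev by (rule Lim_transform_eventually)
  moreover have "((\<lambda>n. if n = m then a m else 0) has_sum a m) UNIV"
    by (rule has_sum_finite_neutralI[of "{m}"]) auto
  ultimately have "J = a m" using infsumI by metis
  then show ?thesis using \<open>J = fourier (trig_series a) m\<close> by simp
qed

text \<open>One half of the Parseval identity: it holds for finite sums by orthonormality and passes to the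
uniform limit.\<close>

lemma L2_norm_trig_series_le:
  assumes a: "rapidly_decreasing a" and K: "0 \<le> K" "\<And>F. finite F \<Longrightarrow> (\<Sum>n\<in>F. (cmod (a n))\<^sup>2) \<le> K\<^sup>2"
  shows "L2_norm (trig_series a) \<le> K"
proof (rule field_le_epsilon)
  fix e :: real assume "0 < e"
  define p where "p F = (\<Sum>n\<in>F. fscale (a n) (character n))" for F
  have p_app: "p F x = (\<Sum>n\<in>F. a n * character n x)" for F x
    unfolding p_def by (induction F rule: infinite_finite_induct) auto
  have pc: "p F \<in> periodic_continuous" for F
    unfolding p_def by (intro L2_sum_mem L2_scale_mem character_periodic_continuous)
  have unif: "uniform_limit UNIV (\<lambda>F x. \<Sum>n\<in>F. a n * character n x)
      (\<lambda>x. \<Sum>\<^sub>\<infinity>n. a n * character n x) (finite_subsets_at_top UNIV)"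
    by (rule Weierstrass_m_test_general[where M = "\<lambda>n. cmod (a n)"])
      (use rapidly_decreasing_summable[OF a, of 0] in \<open>auto simp: norm_mult\<close>)
  have fin: "\<forall>\<^sub>F F in finite_subsets_at_top (UNIV :: int set). finite F"
    by (rule eventually_finite_subsets_at_top_weakI)
  have "\<forall>\<^sub>F F in finite_subsets_at_top UNIV. finite F \<and> (\<forall>x\<in>UNIV. dist (\<Sum>n\<in>F. a n * character n x) (trig_series a x) < e)"
    unfolding trig_series_def by (rule eventually_conj[OF fin uniform_limitD[OF unif \<open>0 < e\<close>]])
  from eventually_happens'[OF finite_subsets_at_top_neq_bot this]
  obtain F where F: "finite F" "\<And>x. dist (\<Sum>n\<in>F. a n * character n x) (trig_series a x) < e"
    by auto
  have sa: "trig_series a \<in> periodic_continuous" by (rule trig_series_periodic_continuous[OF a])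
  have 1: "L2_norm (trig_series a - p F) \<le> e"
  proof (rule L2_norm_le_bound[OF L2_diff_mem[OF sa pc]])
    show "cmod ((trig_series a - p F) x) \<le> e" for x
      using F(2)[of x] by (simp add: p_app dist_norm norm_minus_commute)
  qed
  have "(L2_norm (p F))\<^sup>2 \<le> K\<^sup>2"
    unfolding p_def using L2_Pythagoras_orthonormal[of F character a] F(1) K(2)[OF F(1)]
    by (simp add: character_periodic_continuous character_orthonormal)
  then have 2: "L2_norm (p F) \<le> K" using K(1) power2_le_imp_le by blast
  have "L2_norm ((trig_series a - p F) + p F) \<le> L2_norm (trig_series a - p F) + L2_norm (p F)"
    by (intro L2_hnorm_triangle L2_diff_mem sa pc)
  then show "L2_norm (trig_series a) \<le> K + e" using 1 2 by simp
qed


lemma vector_derivative_quotient_tendsto: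
  fixes f :: "real \<Rightarrow> complex"
  assumes "(f has_vector_derivative d) (at x)"
  shows "((\<lambda>y. (f y - f x) / of_real (y - x)) \<longlongrightarrow> d) (at x)"
proof -
  have "((\<lambda>y. (1 / norm (y - x)) *\<^sub>R (f y - (f x + (y - x) *\<^sub>R d))) \<longlongrightarrow> 0) (at x)"
    using assms unfolding has_vector_derivative_def has_derivative_within by blast
  then have "((\<lambda>y. norm ((1 / norm (y - x)) *\<^sub>R (f y - (f x + (y - x) *\<^sub>R d)))) \<longlongrightarrow> 0) (at x)"
    by (rule tendsto_norm_zero)
  moreover have "\<forall>\<^sub>F y in at x. norm ((1 / norm (y - x)) *\<^sub>R (f y - (f x + (y - x) *\<^sub>R d))) =
      norm ((f y - f x) / of_real (y - x) - d)"
    unfolding eventually_at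
  proof (intro exI[of _ 1] conjI ballI impI)
    fix y assume y: "y \<noteq> x \<and> dist y x < 1"
    have "(f y - f x) / of_real (y - x) - d = (f y - (f x + (y - x) *\<^sub>R d)) / of_real (y - x)"
      using y by (simp add: field_simps scaleR_conv_of_real del: of_real_diff)
    then show "norm ((1 / norm (y - x)) *\<^sub>R (f y - (f x + (y - x) *\<^sub>R d))) =
        norm ((f y - f x) / of_real (y - x) - d)"
      by (simp add: norm_divide del: of_real_diff)
  qed simp
  ultimately have "((\<lambda>y. norm ((f y - f x) / of_real (y - x) - d)) \<longlongrightarrow> 0) (at x)"
    by (rule Lim_transform_eventually)
  then show ?thesis
    using LIM_zero_cancel tendsto_norm_zero_iff by blast
qed

text \<open>The quotient of \<open>h x - h x0\<close> by \<open>character 1 (x - x0) - 1\<close>, whose denominator has simple zeros at the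
translates of \<open>x0\<close>, extends continuously by the quotient of the derivatives.\<close>

lemma difference_quotient_factorization:
  assumes h: "smooth h" "periodic h"
  obtains k where "k \<in> periodic_continuous"
    "\<And>x. h x = h x0 + (character 1 (x - x0) - 1) * k x"
proof -
  define L where "L = iter_deriv 1 h x0 / freq 1"
  define k where "k x = (if x - x0 \<in> \<int> then L else (h x - h x0) / (character 1 (x - x0) - 1))" for x
  have h_int: "h x = h x0" "iter_deriv 1 h x = iter_deriv 1 h x0" if "x - x0 \<in> \<int>" for x
  proof -
    from that obtain m where "x = x0 + of_int m" by (metis Ints_cases add.commute diff_add_cancel)
    then show "h x = h x0" "iter_deriv 1 h x = iter_deriv 1 h x0"
      by (simp_all add: periodic_of_int h periodic_iter_deriv)
  qed
  have nz: "character 1 (x - x0) \<noteq> 1" if "x - x0 \<notin> \<int>" for x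
    using that by (simp add: character_eq_1_iff)
  have "isCont k x" for x
  proof (cases "x - x0 \<in> \<int>")
    case False
    have "closed ((\<lambda>y. x0 + y) ` \<int>)"
      by (rule closed_translation) simp
    then have "open (- ((\<lambda>y. x0 + y) ` \<int>))" by (rule open_Compl)
    moreover have "x \<in> - ((\<lambda>y. x0 + y) ` \<int>)" using False by auto
    ultimately have "\<forall>\<^sub>F y in nhds x. y \<in> - ((\<lambda>y. x0 + y) ` \<int>)" by (rule eventually_nhds_in_open)
    then have "\<forall>\<^sub>F y in nhds x. k y = (h y - h x0) / (character 1 (y - x0) - 1)"
    proof eventually_elim
      case (elim y)
      then have "y - x0 \<notin> \<int>" by (metis ComplD add.commute diff_add_cancel imageI)
      then show ?case by (simp add: k_def)
    qed
    moreover have "isCont (\<lambda>y. (h y - h x0) / (character 1 (y - x0) - 1)) x"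
    proof -
      have "isCont h x" "isCont (character 1) (x - x0)"
        using smooth_continuous[OF h(1), of UNIV] smooth_continuous[OF smooth_character[of 1], of UNIV]
        by (simp_all add: continuous_on_eq_continuous_at)
      moreover have "isCont (\<lambda>y. character 1 (y - x0)) x"
      proof (rule isCont_o2[where g = "character 1"])
        show "isCont (\<lambda>y. y - x0) x" by simp
      qed (rule calculation(2))
      ultimately show ?thesis
        using nz[OF False] by (intro isCont_divide isCont_diff continuous_const) auto
    qed
    ultimately show ?thesis using isCont_cong[of k "\<lambda>y. (h y - h x0) / (character 1 (y - x0) - 1)" x] by blast
  next
    case True
    have char: "character 1 (y - x0) = character 1 (y - x)" for y
    proof -
      obtain m where "x - x0 = of_int m" using True by (auto elim: Ints_cases)
      then have "y - x0 = (y - x) + of_int m" by simp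
      then show ?thesis by (simp only: character_shift character_of_int mult_1_right)
    qed
    have 1: "((\<lambda>y. (h y - h x) / of_real (y - x)) \<longlongrightarrow> iter_deriv 1 h x0) (at x)"
      using vector_derivative_quotient_tendsto[OF smooth_has_vector_derivative_0[OF h(1), of x]]
      unfolding h_int(2)[OF True] .
    have "((\<lambda>y. character 1 (y - x)) has_vector_derivative freq 1) (at x)"
    proof -
      have "((\<lambda>y. character 1 y * character 1 (- x)) has_vector_derivative
          freq 1 * character 1 x * character 1 (- x)) (at x)"
        by (intro has_vector_derivative_mult_left character_has_vector_derivative)
      moreover have "character 1 y * character 1 (- x) = character 1 (y - x)" for y
        using character_shift[of 1 y "- x"] by simp
      ultimately show ?thesis by (simp add: mult.assoc)
    qed
    from vector_derivative_quotient_tendsto[OF this]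
    have 2: "((\<lambda>y. (character 1 (y - x) - 1) / of_real (y - x)) \<longlongrightarrow> freq 1) (at x)" by simp
    have 3: "((\<lambda>y. ((h y - h x) / of_real (y - x)) / ((character 1 (y - x) - 1) / of_real (y - x))) \<longlongrightarrow> L) (at x)"
      unfolding L_def by (intro tendsto_divide 1 2) simp
    have "\<forall>\<^sub>F y in at x. ((h y - h x) / of_real (y - x)) / ((character 1 (y - x) - 1) / of_real (y - x)) = k y"
      unfolding eventually_at
    proof (intro exI[of _ 1] conjI ballI impI)
      fix y assume y: "y \<noteq> x \<and> dist y x < 1"
      have "y - x0 \<notin> \<int>"
      proof
        assume "y - x0 \<in> \<int>"
        then have "(y - x0) - (x - x0) \<in> \<int>" using True by (rule Ints_diff)
        then have "y - x \<in> \<int>" by simp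
        then obtain m where "y - x = of_int m" by (auto elim: Ints_cases)
        moreover from this have "\<bar>real_of_int m\<bar> < 1" using y by (simp add: dist_real_def)
        then have "m = 0" by linarith
        ultimately show False using y by simp
      qed
      then show "((h y - h x) / of_real (y - x)) / ((character 1 (y - x) - 1) / of_real (y - x)) = k y"
        using y h_int(1)[OF True] by (simp add: k_def char)
    qed simp
    with 3 have "(k \<longlongrightarrow> L) (at x)" by (rule Lim_transform_eventually)
    moreover have "k x = L" using True by (simp add: k_def)
    ultimately show ?thesis by (simp add: isCont_def)
  qed
  then have "continuous_on UNIV k" by (simp add: continuous_at_imp_continuous_on)
  moreover have "periodic k"
  proof -
    have "x + 1 - x0 \<in> \<int> \<longleftrightarrow> x - x0 \<in> \<int>" for x
      using Ints_diff[of "x + 1 - x0" 1] Ints_add[of "x - x0" 1] by (auto simp: algebra_simps)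
    moreover have "character 1 (x + 1 - x0) = character 1 (x - x0)" for x
      using periodic_character[of 1] unfolding periodic_def by (metis diff_add_eq)
    ultimately show ?thesis using h(2) by (simp add: periodic_def k_def)
  qed
  moreover have "h x = h x0 + (character 1 (x - x0) - 1) * k x" for x
  proof (cases "x - x0 \<in> \<int>")
    case True
    then have "character 1 (x - x0) = 1" by (simp add: character_eq_1_iff)
    then show ?thesis using h_int(1)[OF True] by (simp only: diff_self mult_zero_left add_0_right)
  next
    case False
    then show ?thesis using nz[OF False] by (simp add: k_def)
  qed
  ultimately show ?thesis using that[of k] unfolding periodic_continuous_def by blast
qed

lemma fourier_const: "fourier (\<lambda>x. c) n = (if n = 0 then c else 0)"
proof -
  have "fourier (\<lambda>x. c * character 0 x) n = c * fourier (character 0) n"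
    by (rule fourier_cmult[OF character_periodic_continuous])
  then show ?thesis
    using character_orthonormal[of 0 n] by (auto simp: fourier_def)
qed

text \<open>If all Fourier coefficients of \<open>h\<close> vanish, the factorization of \<open>h - h x0\<close> shows that
consecutive Fourier coefficients of \<open>k\<close> have the same modulus, except for those with the indices \<open>-1\<close>
and \<open>0\<close>. By the Bessel inequality all of them are \<open>0\<close>, and the coefficient of \<open>h\<close> with index \<open>0\<close> then
reduces to \<open>h x0\<close>.\<close>

lemma fourier_unique:
  assumes h: "smooth h" "periodic h" and zero: "\<And>n. fourier h n = 0"
  shows "h x0 = 0"
proof -
  obtain k where k: "k \<in> periodic_continuous"
    and hk: "\<And>x. h x = h x0 + (character 1 (x - x0) - 1) * k x"
    using difference_quotient_factorization[OF h, of x0] by blast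
  define c where "c = character 1 (- x0)"
  have "cmod c = 1" by (simp add: c_def)
  have pc: "(\<lambda>x. c * (character 1 x * k x)) \<in> periodic_continuous" "(\<lambda>x. (-1) * k x) \<in> periodic_continuous"
    "(\<lambda>x. h x0) \<in> periodic_continuous"
    by (intro L2_scale_mem periodic_continuous_mult character_periodic_continuous k
        smooth_periodic_continuous smooth_const; simp add: periodic_def)+
  have pc2: "(\<lambda>x. c * (character 1 x * k x) + (-1) * k x) \<in> periodic_continuous"
    using L2_add_mem[OF pc(1,2)] by (simp add: plus_fun_def)
  have h_eq: "h = (\<lambda>x. h x0 + (c * (character 1 x * k x) + (-1) * k x))"
  proof
    fix x
    have "character 1 (x - x0) = c * character 1 x"
      using character_shift[of 1 x "- x0"] by (simp add: c_def)
    then show "h x = h x0 + (c * (character 1 x * k x) + (-1) * k x)"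
      using hk[of x] by (simp add: algebra_simps)
  qed
  have coeff: "(if n = 0 then h x0 else 0) + (c * fourier k (n - 1) - fourier k n) = 0" for n
  proof -
    have "0 = fourier (\<lambda>x. h x0 + (c * (character 1 x * k x) + (-1) * k x)) n"
      using zero[of n] h_eq by metis
    also have "\<dots> = (if n = 0 then h x0 else 0) + (c * fourier k (n - 1) - fourier k n)"
      using fourier_cmult[OF k, of "-1" n]
      by (subst fourier_add[OF pc(3) pc2], subst fourier_add[OF pc(1,2)])
        (simp add: fourier_const fourier_cmult periodic_continuous_mult character_periodic_continuous k fourier_character_mult)
    finally show ?thesis by simp
  qed
  have step: "cmod (fourier k n) = cmod (fourier k (n - 1))" if "n \<noteq> 0" for n
  proof -
    have "fourier k n = c * fourier k (n - 1)" using coeff[of n] that by (simp add: algebra_simps)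
    then show ?thesis using \<open>cmod c = 1\<close> by (simp add: norm_mult)
  qed
  have pos: "cmod (fourier k (int j)) = cmod (fourier k 0)" for j
  proof (induction j)
    case (Suc j)
    then show ?case using step[of "int (Suc j)"] by simp
  qed simp
  have neg: "cmod (fourier k (- int j - 1)) = cmod (fourier k (- 1))" for j
  proof (induction j)
    case (Suc j)
    then show ?case using step[of "- int j - 1"] by (simp add: algebra_simps)
  qed simp
  have vanish: "z = 0" if "inj_on f UNIV" "\<And>j. cmod (fourier k (f j)) = z" for f :: "nat \<Rightarrow> int" and z
  proof (rule ccontr)
    assume "z \<noteq> 0"
    then have "z\<^sup>2 > 0" by simp
    then obtain N where N: "(L2_norm k)\<^sup>2 < of_nat N * z\<^sup>2" using reals_Archimedean3 by blast
    have "(\<Sum>n\<in>f ` {..<N}. (cmod (fourier k n))\<^sup>2) = (\<Sum>j<N. z\<^sup>2)"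
      by (subst sum.reindex) (auto intro: inj_on_subset[OF that(1)] simp: that(2))
    then show False using fourier_Bessel[OF k, of "f ` {..<N}"] N by simp
  qed
  have "fourier k 0 = 0" using vanish[of int "cmod (fourier k 0)"] pos by simp
  moreover have "fourier k (- 1) = 0"
    using vanish[of "\<lambda>j. - int j - 1" "cmod (fourier k (- 1))"] neg by (simp add: inj_on_def)
  ultimately show ?thesis using coeff[of 0] by simp
qed

lemma fourier_inversion:
  assumes f: "smooth f" "periodic f"
  shows "trig_series (fourier f) = f"
proof
  fix x
  let ?g = "trig_series (fourier f)"
  have r: "rapidly_decreasing (fourier f)" by (rule rapidly_decreasing_fourier[OF f])
  have g: "smooth ?g" "periodic ?g" by (intro smooth_trig_series r periodic_trig_series)+
  have f': "smooth (\<lambda>x. (-1) * f x)" "periodic (\<lambda>x. (-1) * f x)"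
    using f(2) smooth_cmult[OF f(1), of "-1"] by (simp_all only: periodic_def simp_thms)
  have "fourier (\<lambda>x. ?g x + (-1) * f x) n = 0" for n
  proof -
    have "fourier (\<lambda>x. ?g x + (-1) * f x) n = fourier ?g n + fourier (\<lambda>x. (-1) * f x) n"
      by (rule fourier_add) (intro smooth_periodic_continuous g f')+
    also have "fourier (\<lambda>x. (-1) * f x) n = (-1) * fourier f n"
      by (rule fourier_cmult) (intro smooth_periodic_continuous f)
    finally show ?thesis by (simp add: fourier_trig_series[OF r])
  qed
  moreover have "smooth (\<lambda>x. ?g x + (-1) * f x)" by (intro smooth_add g f')
  moreover have "periodic (\<lambda>x. ?g x + (-1) * f x)" using f g by (simp add: periodic_def)
  ultimately have "?g x + (-1) * f x = 0" using fourier_unique by blast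
  then show "?g x = f x" by simp
qed


section \<open>Denjoy--Carleman estimates\<close>

lemma L2_norm_sum_le:
  assumes "\<And>i. i \<in> I \<Longrightarrow> f i \<in> periodic_continuous"
  shows "L2_norm (\<lambda>x. \<Sum>i\<in>I. f i x) \<le> (\<Sum>i\<in>I. L2_norm (f i))"
proof -
  have "(\<lambda>x. \<Sum>i\<in>I. f i x) = sum f I"
    by (induction I rule: infinite_finite_induct) (auto simp: fun_eq_iff)
  then show ?thesis
    using function_inner_space.hnorm_sum_le[OF L2, of I f] assms by simp
qed

lemma geometric_tail_le:
  fixes q :: real
  assumes "0 \<le> q" "q < 1"
  shows "(\<Sum>i=1..k. q ^ i) \<le> q / (1 - q)"
proof -
  have "(\<Sum>i=1..k. q ^ i) * (1 - q) = q - q ^ Suc k"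
  proof (induction k)
    case (Suc k)
    have "(\<Sum>i=1..Suc k. q ^ i) * (1 - q) = (\<Sum>i=1..k. q ^ i) * (1 - q) + q ^ Suc k * (1 - q)"
      by (simp add: distrib_right)
    also have "\<dots> = q - q ^ Suc k + q ^ Suc k * (1 - q)" by (simp only: Suc)
    also have "\<dots> = q - q ^ Suc (Suc k)" by (simp add: algebra_simps)
    finally show ?case .
  qed simp
  also have "\<dots> \<le> q" using assms by simp
  finally show ?thesis using assms by (simp add: pos_le_divide_eq)
qed

lemma choose_fact_le: "(n choose i) * fact i * fact (n - i + m) \<le> (fact (n + m) :: nat)" if "i \<le> n"
proof -
  have "(n choose i) * fact i * fact (n - i + m) \<le> ((n + m) choose i) * fact i * fact (n - i + m)"
    by (intro mult_right_mono binomial_right_mono) auto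
  also have "\<dots> = fact (n + m)"
    using binomial_fact_lemma[of i "n + m"] that by (simp add: mult_ac)
  finally show ?thesis .
qed

text \<open>Differentiation as seen through the transfer operator, by lemma \<open>transfer_has_vector_derivative\<close>.\<close>

definition twisted_deriv :: "(real \<Rightarrow> complex) \<Rightarrow> (real \<Rightarrow> complex) \<Rightarrow> real \<Rightarrow> complex" where
  "twisted_deriv u f = iter_deriv 1 (\<lambda>x. u x * f x)"

lemma smooth_twisted_deriv: "\<lbrakk>smooth u; smooth f\<rbrakk> \<Longrightarrow> smooth (twisted_deriv u f)"
  by (simp add: twisted_deriv_def smooth_iter_deriv smooth_mult)

lemma periodic_twisted_deriv:
  "\<lbrakk>smooth u; smooth f; periodic u; periodic f\<rbrakk> \<Longrightarrow> periodic (twisted_deriv u f)"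
  by (simp add: twisted_deriv_def periodic_iter_deriv smooth_mult periodic_mult)

lemma smooth_twisted_deriv_power:
  "\<lbrakk>smooth u; smooth f\<rbrakk> \<Longrightarrow> smooth ((twisted_deriv u ^^ m) f)"
  by (induction m) (auto simp: smooth_twisted_deriv)

lemma periodic_twisted_deriv_power:
  "\<lbrakk>smooth u; smooth f; periodic u; periodic f\<rbrakk> \<Longrightarrow> periodic ((twisted_deriv u ^^ m) f)"
  by (induction m) (auto simp: periodic_twisted_deriv smooth_twisted_deriv_power)

locale weight_sequence =
  fixes M :: "nat \<Rightarrow> real"
  assumes M_pos: "\<And>k. 0 < M k" and M_mono: "mono M" and M_0: "M 0 = 1"
    and M_log_convex: "\<And>k. 1 \<le> k \<Longrightarrow> (M k)\<^sup>2 \<le> M (k - 1) * M (k + 1)"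
begin

lemma M_ge_1: "1 \<le> M k"
  using monoD[OF M_mono, of 0 k] M_0 by simp

text \<open>By log-convexity the ratios \<open>M (k + 1) / M k\<close> increase.\<close>

lemma M_mult_le: "M i * M j \<le> M (i + j)"
proof (induction i)
  case (Suc i)
  define r where "r k = M (Suc k) / M k" for k
  have r_Suc: "r k \<le> r (Suc k)" for k
    using M_log_convex[of "Suc k"] M_pos[of k] M_pos[of "Suc k"]
    by (simp add: r_def pos_divide_le_eq pos_le_divide_eq power2_eq_square mult_ac)
  have mono: "r i \<le> r (i + j)" using lift_Suc_mono_le[of r, OF r_Suc] by simp
  have r: "M (Suc k) = r k * M k" for k using M_pos[of k] by (simp add: r_def)
  have r0: "0 \<le> r k" for k using M_pos[of k] M_pos[of "Suc k"] by (simp add: r_def)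
  have "M (Suc i) * M j = r i * (M i * M j)" by (simp add: r)
  also have "\<dots> \<le> r (i + j) * M (i + j)"
    using mono Suc r0 M_pos by (intro mult_mono mult_nonneg_nonneg) (auto simp: less_imp_le)
  also have "\<dots> = M (Suc i + j)" by (simp add: r)
  finally show ?case .
qed (simp add: M_0)

text \<open>The Leibniz formula for \<open>v * inverse v = 1\<close> expresses the \<open>k\<close>-th derivative of the inverse through
the lower ones. The constant \<open>R * (1 + C / lam)\<close> is the one for which the geometric series that
arises in the induction sums up to \<open>1\<close>.\<close>

lemma inverse_derivative_bounds:
  assumes v: "smooth v" and lam: "0 < lam" "\<And>x. lam \<le> cmod (v x)"
    and C: "0 < C" "0 < R" and bound: "\<And>k x. cmod (iter_deriv k v x) \<le> C * R ^ k * fact k * M k"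
  shows "cmod (iter_deriv k (\<lambda>x. inverse (v x)) x) \<le> 1 / lam * (R * (1 + C / lam)) ^ k * fact k * M k"
proof -
  define u where "u = (\<lambda>x. inverse (v x))"
  have nz: "v x \<noteq> 0" for x using lam(2)[of x] lam(1) by auto
  have u: "smooth u" unfolding u_def using v nz by (rule smooth_inverse)
  define S where "S = R * (1 + C / lam)"
  define q where "q = R / S"
  have Clam: "0 < C / lam" using C lam by simp
  have S: "0 < S" "R < S" unfolding S_def using C Clam by (auto intro!: mult_pos_pos add_pos_pos)
  have q: "0 \<le> q" "q < 1" using S C by (auto simp: q_def)
  have q_tail: "C / lam * (q / (1 - q)) = 1"
  proof -
    have "q = 1 / (1 + C / lam)" unfolding q_def S_def using C by simp
    then show ?thesis using C lam Clam q by (simp add: field_simps)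
  qed
  show ?thesis unfolding u_def[symmetric] S_def[symmetric]
  proof (induction k rule: less_induct)
    case (less k)
    let ?t = "\<lambda>i. of_nat (k choose i) * iter_deriv i v x * iter_deriv (k - i) u x"
    have vu: "cmod (u y) \<le> 1 / lam" for y
      using lam(1) lam(2)[of y] by (simp add: u_def norm_inverse le_imp_inverse_le flip: inverse_eq_divide)
    show ?case
    proof (cases "k = 0")
      case True
      then show ?thesis using vu by (simp add: M_0)
    next
      case False
      have "iter_deriv k (\<lambda>x. v x * u x) x = (\<Sum>i\<le>k. ?t i)"
        by (simp add: Leibniz[OF v u])
      moreover have "iter_deriv k (\<lambda>x. v x * u x) x = 0"
      proof -
        have "(\<lambda>x. v x * u x) = (\<lambda>x. 1)" using nz by (simp add: u_def fun_eq_iff)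
        moreover have "iter_deriv k (\<lambda>x. 1) = (\<lambda>x. 0)"
          using iter_deriv_eq_jet[of "\<lambda>k x. if k = 0 then 1 else 0" k] False by simp
        ultimately show ?thesis by simp
      qed
      ultimately have "v x * iter_deriv k u x = - (\<Sum>i=1..k. ?t i)"
        by (simp add: atMost_atLeast0 sum.atLeast_Suc_atMost[of 0] add_eq_0_iff2)
      then have "iter_deriv k u x = u x * - (\<Sum>i=1..k. ?t i)"
        using nz[of x] by (simp add: u_def field_simps)
      then have "cmod (iter_deriv k u x) \<le> 1 / lam * cmod (\<Sum>i=1..k. ?t i)"
        using vu[of x] by (simp add: norm_mult mult_right_mono del: times_divide_eq_left)
      also have "cmod (\<Sum>i=1..k. ?t i) \<le>
          (\<Sum>i=1..k. S ^ k * fact k * M k * (C / lam * q ^ i))"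
      proof (intro sum_norm_le)
        fix i assume i: "i \<in> {1..k}"
        have "cmod (?t i) \<le>
            real (k choose i) * (C * R ^ i * fact i * M i) * (1 / lam * S ^ (k - i) * fact (k - i) * M (k - i))"
          unfolding norm_mult norm_of_nat using i C M_pos
          by (intro mult_mono bound less.IH mult_nonneg_nonneg) (auto simp: less_imp_le)
        also have "\<dots> = (real (k choose i) * fact i * fact (k - i)) * (R ^ i * S ^ (k - i)) * (M i * M (k - i)) * (C / lam)"
          by simp
        also have "real (k choose i) * fact i * fact (k - i) = fact k"
        proof -
          have "real ((k choose i) * fact i * fact (k - i)) = real (fact k)"
            using binomial_fact_lemma[of i k] i by (simp only: atLeastAtMost_iff mult_ac)
          then show ?thesis by (simp only: of_nat_mult of_nat_fact)
        qed
        also have "R ^ i * S ^ (k - i) = S ^ k * q ^ i"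
          using S i by (simp add: q_def power_divide power_diff field_simps)
        also have "fact k * (S ^ k * q ^ i) * (M i * M (k - i)) * (C / lam) \<le> fact k * (S ^ k * q ^ i) * M k * (C / lam)"
          using M_mult_le[of i "k - i"] i S q Clam by (intro mult_right_mono mult_left_mono) auto
        finally show "cmod (?t i) \<le>
            S ^ k * fact k * M k * (C / lam * q ^ i)" by (simp add: mult_ac)
      qed
      also have "(\<Sum>i=1..k. S ^ k * fact k * M k * (C / lam * q ^ i)) = S ^ k * fact k * M k * (C / lam * (\<Sum>i=1..k. q ^ i))"
        by (simp add: sum_distrib_left)
      also have "\<dots> \<le> S ^ k * fact k * M k * (C / lam * (q / (1 - q)))"
        using geometric_tail_le[OF q, of k] S C lam M_pos[of k]
        by (intro mult_left_mono) (auto simp: less_imp_le)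
      also have "\<dots> = S ^ k * fact k * M k" by (simp only: q_tail mult_1_right)
      finally show ?thesis using lam(1) by (simp add: mult_left_mono divide_right_mono)
    qed
  qed
qed

text \<open>The estimate behind the contraction. In the Leibniz formula for the derivative of order
\<open>n = j + 1\<close> of \<open>u g\<close>, the term without derivatives of \<open>u\<close> contributes the factor \<open>c\<close>. The
term with \<open>i\<close> derivatives of \<open>u\<close> contributes \<open>K (R / B)^i\<close>: log-convexity merges \<open>M i\<close> into the
remaining \<open>M\<close>, and the binomial coefficient is absorbed by the factorials.\<close>

lemma twisted_deriv_power_bound:
  assumes u: "smooth u" "periodic u" and f: "smooth f" "periodic f"
    and u0: "\<And>x. cmod (u x) \<le> c"
    and uk: "\<And>k x. cmod (iter_deriv k u x) \<le> K * R ^ k * fact k * M k"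
    and K: "0 \<le> K" "0 \<le> R" "R < B" and N: "0 \<le> N"
    and fk: "\<And>j. L2_norm (iter_deriv j f) \<le> N * B ^ j * fact j * M j"
    and p_def: "p = c + K * ((R / B) / (1 - R / B))"
  shows "L2_norm (iter_deriv j ((twisted_deriv u ^^ m) f)) \<le> N * p ^ m * B ^ (j + m) * fact (j + m) * M (j + m)"
proof (induction m arbitrary: j)
  case 0
  then show ?case using fk by simp
next
  case (Suc m)
  let ?g = "(twisted_deriv u ^^ m) f"
  let ?n = "Suc j"
  let ?t = "\<lambda>i x. of_nat (?n choose i) * iter_deriv i u x * iter_deriv (?n - i) ?g x"
  define Q where "Q = N * p ^ m * B ^ (?n + m) * fact (?n + m) * M (?n + m)"
  have c: "0 \<le> c" using u0[of 0] norm_ge_zero order_trans by blast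
  have RB: "0 \<le> R / B" "R / B < 1" using K by auto
  have p: "0 \<le> p" unfolding p_def using c K RB by simp
  have Q: "0 \<le> Q" unfolding Q_def using N p K M_pos[of "?n + m"] by simp
  have g: "smooth ?g" "periodic ?g"
    using u f by (auto intro: smooth_twisted_deriv_power periodic_twisted_deriv_power)
  have pcu: "iter_deriv i u \<in> periodic_continuous" for i
    by (intro smooth_periodic_continuous smooth_iter_deriv periodic_iter_deriv u)
  have pcg: "iter_deriv i ?g \<in> periodic_continuous" for i
    by (intro smooth_periodic_continuous smooth_iter_deriv periodic_iter_deriv g)
  have "iter_deriv j ((twisted_deriv u ^^ Suc m) f) = iter_deriv ?n (\<lambda>x. u x * ?g x)"
    by (simp add: twisted_deriv_def iter_deriv_iter_deriv)
  also have "\<dots> = (\<lambda>x. \<Sum>i\<le>?n. of_nat (?n choose i) * iter_deriv i u x * iter_deriv (?n - i) ?g x)"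
    by (rule Leibniz[OF u(1) g(1)])
  finally have "L2_norm (iter_deriv j ((twisted_deriv u ^^ Suc m) f)) \<le>
      (\<Sum>i\<le>?n. L2_norm (?t i))"
    by (simp only:) (intro L2_norm_sum_le periodic_continuous_mult L2_scale_mem pcu pcg)
  also have "\<dots> = L2_norm (?t 0) +
      (\<Sum>i=1..?n. L2_norm (?t i))"
    unfolding atMost_atLeast0 by (subst sum.atLeast_Suc_atMost) simp_all
  also have "L2_norm (?t 0) \<le> c * Q"
  proof -
    have "L2_norm (\<lambda>x. u x * iter_deriv ?n ?g x) \<le> c * L2_norm (iter_deriv ?n ?g)"
      using pcu[of 0] by (intro L2_norm_mult_le pcg u0) simp
    also have "\<dots> \<le> c * Q" unfolding Q_def by (intro mult_left_mono Suc.IH c)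
    finally show ?thesis by simp
  qed
  also have "(\<Sum>i=1..?n. L2_norm (?t i)) \<le>
      (\<Sum>i=1..?n. Q * K * (R / B) ^ i)"
  proof (rule sum_mono)
    fix i assume i: "i \<in> {1..?n}"
    have "L2_norm (?t i) \<le>
        (real (?n choose i) * (K * R ^ i * fact i * M i)) * L2_norm (iter_deriv (?n - i) ?g)"
    proof (rule L2_norm_mult_le[OF pcg])
      show "(\<lambda>x. of_nat (?n choose i) * iter_deriv i u x) \<in> periodic_continuous"
        by (intro L2_scale_mem pcu)
      show "cmod (of_nat (?n choose i) * iter_deriv i u x) \<le> real (?n choose i) * (K * R ^ i * fact i * M i)" for x
        unfolding norm_mult norm_of_nat by (intro mult_left_mono uk) simp
    qed
    also have "\<dots> \<le> (real (?n choose i) * (K * R ^ i * fact i * M i)) *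
        (N * p ^ m * B ^ (?n - i + m) * fact (?n - i + m) * M (?n - i + m))"
      using K M_pos[of i] by (intro mult_left_mono Suc.IH mult_nonneg_nonneg) (auto simp: less_imp_le)
    also have "\<dots> = (real (?n choose i) * fact i * fact (?n - i + m)) * (M i * M (?n - i + m)) *
        (N * p ^ m * K) * (R ^ i * B ^ (?n - i + m))"
      by (simp add: mult_ac)
    also have "\<dots> \<le> fact (?n + m) * M (?n + m) * (N * p ^ m * K) * (R ^ i * B ^ (?n - i + m))"
    proof (intro mult_right_mono mult_mono)
      have "real ((?n choose i) * fact i * fact (?n - i + m)) \<le> real (fact (?n + m))"
        using choose_fact_le[of i ?n m] i by (intro of_nat_mono) simp
      then show "real (?n choose i) * fact i * fact (?n - i + m) \<le> fact (?n + m)"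
        by (simp only: of_nat_mult of_nat_fact)
      show "M i * M (?n - i + m) \<le> M (?n + m)"
        using M_mult_le[of i "?n - i + m"] i by simp
    qed (use K N p M_pos in \<open>auto simp: less_imp_le\<close>)
    also have "R ^ i * B ^ (?n - i + m) = B ^ (?n + m) * (R / B) ^ i"
    proof -
      have "B ^ (?n + m) = B ^ (?n - i + m) * B ^ i" using i by (simp add: power_add[symmetric])
      then show ?thesis using K by (simp add: power_divide)
    qed
    finally show "L2_norm (?t i) \<le> Q * K * (R / B) ^ i"
      by (simp only: Q_def mult_ac)
  qed
  also have "(\<Sum>i=1..?n. Q * K * (R / B) ^ i) = Q * (K * (\<Sum>i=1..?n. (R / B) ^ i))"
    by (simp only: sum_distrib_left mult.assoc)
  also have "\<dots> \<le> Q * (K * ((R / B) / (1 - R / B)))"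
    by (intro mult_left_mono geometric_tail_le RB K Q)
  also have "c * Q + Q * (K * ((R / B) / (1 - R / B))) = p * Q"
    unfolding p_def by (simp only: distrib_left distrib_right mult.commute)
  also have "p * Q = N * p ^ Suc m * B ^ (j + Suc m) * fact (j + Suc m) * M (j + Suc m)"
    by (simp add: Q_def)
  finally show ?case by simp
qed

end


section \<open>The transfer operator on the universal cover\<close>

lemma continuous_has_antiderivative:
  fixes f :: "real \<Rightarrow> real"
  assumes "continuous_on UNIV f"
  obtains \<Phi> where "\<And>x. (\<Phi> has_real_derivative f x) (at x)"
proof -
  have int: "f integrable_on {a..b}" for a b
    using assms by (intro integrable_continuous_interval) (rule continuous_on_subset, auto)
  define \<Phi> where "\<Phi> x = integral {0..x} f - integral {x..0} f" for x
  have eq: "\<Phi> x = integral {- n..x} f - integral {- n..0} f" if "\<bar>x\<bar> \<le> n" for x n :: real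
  proof (cases "0 \<le> x")
    case True
    then have "integral {- n..0} f + integral {0..x} f = integral {- n..x} f"
      using that by (intro Henstock_Kurzweil_Integration.integral_combine int) auto
    moreover have "integral {x..0} f = 0" using True by (cases "x = 0") auto
    ultimately show ?thesis by (simp add: \<Phi>_def)
  next
    case False
    then have "integral {- n..x} f + integral {x..0} f = integral {- n..0} f"
      using that by (intro Henstock_Kurzweil_Integration.integral_combine int) auto
    then show ?thesis using False by (simp add: \<Phi>_def)
  qed
  have "(\<Phi> has_real_derivative f x) (at x)" for x
  proof -
    define n where "n = \<bar>x\<bar> + 1"
    have x: "- n < x" "x < n" by (auto simp: n_def)
    have "((\<lambda>y. integral {- n..y} f) has_real_derivative f x) (at x within {- n..n})"
      using x assms by (intro integral_has_real_derivative) (auto intro: continuous_on_subset)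
    then have "((\<lambda>y. integral {- n..y} f - integral {- n..0} f) has_real_derivative f x) (at x within {- n..n})"
      by (rule DERIV_cong[OF DERIV_diff[OF _ DERIV_const]]) simp
    then have "(\<Phi> has_real_derivative f x) (at x within {- n..n})"
      by (rule has_field_derivative_transform_within[of _ _ _ _ 1]) (use x in \<open>auto intro!: eq[symmetric]\<close>)
    then show ?thesis using at_within_Icc_at[OF x] by simp
  qed
  then show ?thesis using that by blast
qed

text \<open>Everything takes place on the real line, where \<open>T\<close> becomes a diffeomorphism \<open>F\<close> with inverse \<open>G\<close>, and
the inverse branches of \<open>T\<close> are the functions \<open>y \<mapsto> G (y + j)\<close> with \<open>0 \<le> j < degree\<close>. The map may reverse the
orientation; \<open>degree\<close> is the absolute value of the topological degree.\<close>

locale expanding_lift =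
  fixes F v :: "real \<Rightarrow> real" and lam :: real
  assumes lam: "0 < lam"
    and F_deriv: "\<And>x. (F has_real_derivative v x) (at x)"
    and v_smooth: "smooth (\<lambda>x. of_real (v x))"
    and v_periodic: "periodic v"
    and expanding: "\<And>x. lam < \<bar>v x\<bar>"
    and degree_int: "F 1 - F 0 \<in> \<int>"
begin

definition orientation :: real where "orientation = sgn (v 0)"

lemma v_nz: "v x \<noteq> 0"
  using expanding[of x] lam by auto

lemma continuous_v: "continuous_on S v"
proof -
  have "continuous_on S (\<lambda>x. Re (of_real (v x)))"
    by (intro continuous_intros smooth_continuous v_smooth)
  then show ?thesis by simp
qed

lemma orientation_cases: "orientation = 1 \<or> orientation = - 1"
  using v_nz[of 0] by (auto simp: orientation_def sgn_if)

lemma orientation_sq [simp]: "orientation * orientation = 1"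
  using orientation_cases by auto

lemma orientation_v: "orientation * v x = \<bar>v x\<bar>"
proof -
  have conn: "connected (range v)"
    by (intro connected_continuous_image continuous_v) simp
  have no_zero: "0 \<notin> range v" using v_nz by (metis imageE)
  have "0 < v x \<longleftrightarrow> 0 < v 0"
  proof (rule ccontr)
    assume "\<not> (0 < v x \<longleftrightarrow> 0 < v 0)"
    then have "v x \<le> 0 \<and> 0 \<le> v 0 \<or> v 0 \<le> 0 \<and> 0 \<le> v x" by auto
    then have "0 \<in> range v"
      using connected_contains_Icc[OF conn, of "v x" "v 0"] connected_contains_Icc[OF conn, of "v 0" "v x"]
      by (auto simp: subset_iff)
    then show False using no_zero by blast
  qed
  then show ?thesis using v_nz[of x] v_nz[of 0] by (auto simp: orientation_def sgn_if)
qed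

lemma orientation_divide_v: "orientation / v x = 1 / \<bar>v x\<bar>"
proof -
  have "orientation \<noteq> 0" using orientation_cases by auto
  from mult_divide_mult_cancel_left[OF this, of orientation "v x"]
  show ?thesis unfolding orientation_sq orientation_v by (rule sym)
qed

lemma F_growth:
  assumes "x \<le> y"
  shows "lam * (y - x) \<le> orientation * (F y - F x)"
proof -
  have "orientation * F x - lam * x \<le> orientation * F y - lam * y"
  proof (rule DERIV_nonneg_imp_nondecreasing[OF assms])
    fix z
    have "((\<lambda>z. orientation * F z - lam * z) has_real_derivative orientation * v z - lam * 1) (at z)"
      by (intro DERIV_diff DERIV_cmult F_deriv DERIV_ident)
    moreover have "0 \<le> orientation * v z - lam * 1"
      using expanding[of z] by (simp add: orientation_v)
    ultimately show "\<exists>d. ((\<lambda>z. orientation * F z - lam * z) has_real_derivative d) (at z) \<and> 0 \<le> d"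
      by blast
  qed
  then show ?thesis by (simp add: algebra_simps)
qed

lemma F_expands: "lam * \<bar>x - y\<bar> \<le> \<bar>F x - F y\<bar>"
proof (cases "x \<le> y")
  case True
  from F_growth[OF this] show ?thesis
    using True orientation_cases by (auto simp: abs_if algebra_simps)
next
  case False
  then have "y \<le> x" by simp
  from F_growth[OF this] show ?thesis
    using False orientation_cases by (auto simp: abs_if algebra_simps)
qed

lemma bij_F: "bij F"
proof (rule bijI)
  show "inj F"
  proof (rule injI)
    fix x y assume "F x = F y"
    then have "lam * \<bar>x - y\<bar> \<le> 0" using F_expands[of x y] by simp
    then show "x = y" using lam by (simp add: mult_le_0_iff)
  qed
  show "surj F"
    unfolding surj_def
  proof
    fix y
    define b where "b = \<bar>y - F 0\<bar> / lam"
    have b: "0 \<le> b" "lam * b = \<bar>y - F 0\<bar>" using lam by (auto simp: b_def)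
    have lo: "orientation * F (- b) \<le> orientation * y" and hi: "orientation * y \<le> orientation * F b"
      using F_growth[of 0 b] F_growth[of "- b" 0] b orientation_cases
      by (auto simp: algebra_simps abs_if split: if_splits)
    have "continuous_on {- b..b} (\<lambda>x. orientation * F x)"
      by (intro continuous_intros continuous_at_imp_continuous_on ballI DERIV_isCont[OF F_deriv])
    from IVT'[OF lo hi _ this] b obtain x where "orientation * F x = orientation * y" by auto
    then show "\<exists>x. y = F x" using orientation_cases by auto
  qed
qed

definition G :: "real \<Rightarrow> real" where "G = inv F"

lemma F_G [simp]: "F (G y) = y"
  unfolding G_def using bij_F by (simp add: bij_is_surj surj_f_inv_f)

lemma G_F [simp]: "G (F x) = x"
  unfolding G_def using bij_F by (simp add: bij_is_inj)

lemma G_deriv: "(G has_real_derivative 1 / v (G y)) (at y)"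
proof -
  have "continuous_on UNIV G"
  proof (rule continuous_on_iff[THEN iffD2], intro ballI allI impI)
    fix x e :: real assume "0 < e"
    have "dist (G x') (G x) < e" if "dist x' x < lam * e" for x'
    proof -
      have "lam * \<bar>G x' - G x\<bar> < lam * e"
        using F_expands[of "G x'" "G x"] that by (simp add: dist_real_def)
      then show ?thesis using lam by (simp add: dist_real_def)
    qed
    then show "\<exists>d>0. \<forall>x'\<in>UNIV. dist x' x < d \<longrightarrow> dist (G x') (G x) < e"
      using lam \<open>0 < e\<close> by (intro exI[of _ "lam * e"]) auto
  qed
  then have "isCont G y" by (simp add: continuous_on_eq_continuous_at)
  then have "(G has_real_derivative inverse (v (G y))) (at y)"
    by (intro DERIV_inverse_function[where f = F and a = "y - 1" and b = "y + 1"] F_deriv v_nz) auto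
  then show ?thesis by (simp add: inverse_eq_divide)
qed

definition degree :: nat where "degree = nat \<lfloor>orientation * (F 1 - F 0)\<rfloor>"

lemma real_degree: "real degree = orientation * (F 1 - F 0)" and degree_pos: "0 < degree"
proof -
  have pos: "lam \<le> orientation * (F 1 - F 0)" using F_growth[of 0 1] by simp
  have "orientation * (F 1 - F 0) \<in> \<int>"
    using degree_int orientation_cases Ints_minus[OF degree_int] by auto
  then obtain m :: int where m: "orientation * (F 1 - F 0) = of_int m" by (auto elim: Ints_cases)
  then show "real degree = orientation * (F 1 - F 0)"
    using pos lam by (simp add: degree_def)
  then show "0 < degree" using pos lam by (metis less_le_trans of_nat_0_less_iff)
qed

lemma F_shift: "F (x + 1) = F x + orientation * real degree"
proof -
  have "((\<lambda>x. F (x + 1) - F x) has_real_derivative v (x + 1) - v x) (at x)" for x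
    by (intro DERIV_diff F_deriv) (simp add: DERIV_shift[symmetric] F_deriv)
  then have "((\<lambda>x. F (x + 1) - F x) has_real_derivative 0) (at x)" for x
    using v_periodic by (simp add: periodic_def)
  then have "F (x + 1) - F x = F (0 + 1) - F 0" by (rule DERIV_isconst_all[rule_format])
  moreover have "orientation * real degree = F 1 - F 0"
    by (simp add: real_degree mult.assoc[symmetric])
  ultimately show ?thesis by simp
qed

lemma F_shift_int: "F (x + of_int m) = F x + of_int m * (orientation * real degree)"
proof -
  have "F (x + of_int m) - of_int m * (orientation * real degree) = F x"
  proof (induction m rule: int_induct[where k = 0])
    case (step1 i)
    then show ?case using F_shift[of "x + of_int i"] by (simp add: algebra_simps)
  next
    case (step2 i)
    then show ?case using F_shift[of "x + of_int (i - 1)"] by (simp add: algebra_simps)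
  qed simp
  then show ?thesis by simp
qed

lemma G_shift_int: "G (y + of_int m * real degree) = G y + of_int m * orientation"
proof -
  obtain e :: int where e: "orientation = of_int e"
    using orientation_cases by (metis of_int_1 of_int_minus)
  have "F (G y + of_int (m * e)) = y + of_int m * real degree"
    unfolding F_shift_int by (simp add: e[symmetric] mult.assoc)
  then have "G (y + of_int m * real degree) = G y + of_int (m * e)" by (metis G_F)
  then show ?thesis by (simp add: e)
qed

lemma periodic_G_shift:
  assumes "periodic h"
  shows "h (G (y + real degree)) = h (G y)"
proof -
  obtain e :: int where e: "orientation = of_int e"
    using orientation_cases by (metis of_int_1 of_int_minus)
  show ?thesis using G_shift_int[of y 1] periodic_of_int[OF assms, of "G y" e] e by simp
qed

definition u :: "real \<Rightarrow> complex" where "u x = inverse (of_real (v x))"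

lemma smooth_u: "smooth u"
  unfolding u_def[abs_def] by (rule smooth_inverse[OF v_smooth]) (simp add: v_nz)

lemma periodic_u: "periodic u"
  using v_periodic by (simp add: periodic_def u_def)

lemma norm_u_le: "cmod (u x) \<le> 1 / lam"
  using expanding[of x] lam by (simp add: u_def norm_inverse le_imp_inverse_le flip: inverse_eq_divide)

text \<open>The factor \<open>orientation * u x\<close> is \<open>1 / \<bar>v x\<bar>\<close>.\<close>

definition transfer :: "(real \<Rightarrow> complex) \<Rightarrow> real \<Rightarrow> complex" where
  "transfer f y = of_real orientation * (\<Sum>j<degree. u (G (y + real j)) * f (G (y + real j)))"

lemma periodic_transfer:
  assumes "periodic f"
  shows "periodic (transfer f)"
  unfolding periodic_def
proof
  fix y
  define h where "h j = u (G (y + real j)) * f (G (y + real j))" for j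
  have "periodic (\<lambda>x. u x * f x)" by (intro periodic_mult periodic_u assms)
  from periodic_G_shift[OF this] have hD: "h degree = h 0" by (simp add: h_def)
  have "transfer f (y + 1) = of_real orientation * (\<Sum>j<degree. h (Suc j))"
    by (simp add: transfer_def h_def add_ac)
  also have "(\<Sum>j<degree. h (Suc j)) = (\<Sum>j<degree. h j)"
    using sum.lessThan_Suc_shift[of h degree] hD by simp
  finally show "transfer f (y + 1) = transfer f y" by (simp add: transfer_def h_def)
qed

text \<open>The chain rule produces the derivative of \<open>y \<mapsto> G (y + j)\<close>, which is \<open>u\<close> at the point \<open>G (y + j)\<close>: the same
factor as in the definition of \<open>transfer\<close>. The derivative is therefore a transfer again.\<close>

lemma transfer_has_vector_derivative:
  assumes f: "smooth f"
  shows "(transfer f has_vector_derivative transfer (twisted_deriv u f) y) (at y)"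
proof -
  have uf: "smooth (\<lambda>x. u x * f x)" by (intro smooth_mult smooth_u f)
  have "((\<lambda>y. u (G (y + real j)) * f (G (y + real j))) has_vector_derivative
      u (G (y + real j)) * twisted_deriv u f (G (y + real j))) (at y)" for j
  proof -
    have "((\<lambda>y. G (y + real j)) has_real_derivative 1 / v (G (y + real j))) (at y)"
      using G_deriv[of "y + real j"] by (simp add: DERIV_shift)
    then have "((\<lambda>y. G (y + real j)) has_vector_derivative 1 / v (G (y + real j))) (at y)"
      by (simp add: has_real_derivative_iff_has_vector_derivative)
    from vector_diff_chain_at[OF this smooth_has_vector_derivative_0[OF uf]]
    show ?thesis
      by (simp add: o_def twisted_deriv_def u_def scaleR_conv_of_real inverse_eq_divide)
  qed
  then show ?thesis
    unfolding transfer_def[abs_def]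
    by (intro has_vector_derivative_mult_right has_vector_derivative_sum)
qed

lemma
  assumes f: "smooth f"
  shows smooth_transfer: "smooth (transfer f)"
    and iter_deriv_transfer: "iter_deriv k (transfer f) = transfer ((twisted_deriv u ^^ k) f)"
proof -
  have jet: "(transfer ((twisted_deriv u ^^ k) f) has_vector_derivative
      transfer ((twisted_deriv u ^^ Suc k) f) y) (at y)" for k y
    using transfer_has_vector_derivative[OF smooth_twisted_deriv_power[OF smooth_u f]] by simp
  show "smooth (transfer f)" "iter_deriv k (transfer f) = transfer ((twisted_deriv u ^^ k) f)"
    using smooth_jet[of "\<lambda>k. transfer ((twisted_deriv u ^^ k) f)", OF jet]
      iter_deriv_eq_jet[of "\<lambda>k. transfer ((twisted_deriv u ^^ k) f)", OF jet] by simp_all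
qed

text \<open>The Cauchy--Schwarz inequality for the sum over the branches, followed by the change of variables
\<open>x = G (y + j)\<close>. Together the branches cover one period exactly once; this appears as
a telescoping sum of values of an antiderivative \<open>\<Phi>\<close> of \<open>\<bar>f\<bar>\<^sup>2\<close>.\<close>

lemma L2_norm_transfer_le:
  assumes f: "smooth f" "periodic f"
  shows "L2_norm (transfer f) \<le> sqrt (real degree / lam) * L2_norm f"
proof -
  have fpc: "f \<in> periodic_continuous" by (intro smooth_periodic_continuous f)
  have tpc: "transfer f \<in> periodic_continuous"
    by (intro smooth_periodic_continuous smooth_transfer periodic_transfer f)
  define w where "w x = (cmod (f x))\<^sup>2" for x
  have contw: "continuous_on UNIV w"
    unfolding w_def by (intro continuous_intros smooth_continuous f)
  obtain \<Phi> where \<Phi>: "\<And>x. (\<Phi> has_real_derivative w x) (at x)"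
    using continuous_has_antiderivative[OF contw] by blast
  have period: "\<Phi> (x + 1) - \<Phi> x = \<Phi> 1 - \<Phi> 0" for x
  proof -
    have "((\<lambda>x. \<Phi> (x + 1) - \<Phi> x) has_real_derivative w (x + 1) - w x) (at x)" for x
      by (intro DERIV_diff \<Phi>) (simp add: DERIV_shift[symmetric] \<Phi>)
    then have "((\<lambda>x. \<Phi> (x + 1) - \<Phi> x) has_real_derivative 0) (at x)" for x
      using f(2) by (simp add: periodic_def w_def)
    then have "\<Phi> (x + 1) - \<Phi> x = \<Phi> (0 + 1) - \<Phi> 0" by (rule DERIV_isconst_all[rule_format])
    then show ?thesis by simp
  qed
  have int_w: "(w has_integral \<Phi> 1 - \<Phi> 0) {0..1}"
    using \<Phi> by (intro fundamental_theorem_of_calculus)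
      (auto simp: has_real_derivative_iff_has_vector_derivative[symmetric] intro: has_field_derivative_at_within)
  define W where "W y = (\<Sum>j<degree. w (G (y + real j)) / \<bar>v (G (y + real j))\<bar>)" for y
  define \<Psi> where "\<Psi> y = (\<Sum>j<degree. orientation * \<Phi> (G (y + real j)))" for y
  have \<Psi>: "(\<Psi> has_real_derivative W y) (at y)" for y
  proof -
    have "((\<lambda>y. orientation * \<Phi> (G (y + real j))) has_real_derivative
        w (G (y + real j)) / \<bar>v (G (y + real j))\<bar>) (at y)" for j
    proof -
      have "((\<lambda>y. G (y + real j)) has_real_derivative 1 / v (G (y + real j))) (at y)"
        using G_deriv[of "y + real j"] by (simp add: DERIV_shift)
      from DERIV_cmult[OF DERIV_chain2[OF \<Phi> this], of orientation]
      show ?thesis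
      proof (rule DERIV_cong)
        have "orientation * (w (G (y + real j)) * (1 / v (G (y + real j)))) =
            w (G (y + real j)) * (orientation / v (G (y + real j)))" by simp
        then show "orientation * (w (G (y + real j)) * (1 / v (G (y + real j)))) =
            w (G (y + real j)) / \<bar>v (G (y + real j))\<bar>"
          by (simp only: orientation_divide_v times_divide_eq_right mult_1_right)
      qed
    qed
    then show ?thesis unfolding \<Psi>_def W_def by (intro DERIV_sum)
  qed
  have "(W has_integral \<Psi> 1 - \<Psi> 0) {0..1}"
    using \<Psi> by (intro fundamental_theorem_of_calculus)
      (auto simp: has_real_derivative_iff_has_vector_derivative[symmetric] intro: has_field_derivative_at_within)
  moreover have "\<Psi> 1 - \<Psi> 0 = \<Phi> 1 - \<Phi> 0"
  proof -
    have "\<Psi> 1 - \<Psi> 0 = (\<Sum>j<degree. orientation * \<Phi> (G (real (Suc j))) - orientation * \<Phi> (G (real j)))"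
      unfolding \<Psi>_def sum_subtractf[symmetric] by (simp add: add_ac)
    also have "\<dots> = orientation * (\<Phi> (G (real degree)) - \<Phi> (G 0))"
      by (subst sum_lessThan_telescope) (simp add: algebra_simps)
    also have "G (real degree) = G 0 + orientation"
      using G_shift_int[of 0 1] by simp
    also have "orientation * (\<Phi> (G 0 + orientation) - \<Phi> (G 0)) = \<Phi> 1 - \<Phi> 0"
      using orientation_cases period[of "G 0"] period[of "G 0 - 1"] by auto
    finally show ?thesis .
  qed
  ultimately have int_W: "(W has_integral \<Phi> 1 - \<Phi> 0) {0..1}" by simp
  have pointwise: "(cmod (transfer f y))\<^sup>2 \<le> real degree / lam * W y" for y
  proof -
    have "(cmod (transfer f y))\<^sup>2 = (cmod (\<Sum>j<degree. u (G (y + real j)) * f (G (y + real j))))\<^sup>2"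
      using orientation_cases by (auto simp: transfer_def norm_mult)
    also have "\<dots> \<le> (\<Sum>j<degree. cmod (u (G (y + real j)) * f (G (y + real j))))\<^sup>2"
      by (intro power_mono norm_sum) simp
    also have "\<dots> \<le> real degree * (\<Sum>j<degree. (cmod (u (G (y + real j)) * f (G (y + real j))))\<^sup>2)"
      using sum_squared_le_sum_of_squares[of "\<lambda>j. cmod (u (G (y + real j)) * f (G (y + real j)))" "{..<degree}"]
      by (simp add: mult.commute)
    also have "\<dots> \<le> real degree * (\<Sum>j<degree. 1 / lam * (w (G (y + real j)) / \<bar>v (G (y + real j))\<bar>))"
    proof (intro mult_left_mono sum_mono)
      fix j
      let ?x = "G (y + real j)"
      have "(cmod (u ?x * f ?x))\<^sup>2 = cmod (u ?x) * (w ?x / \<bar>v ?x\<bar>)"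
        by (simp add: u_def w_def norm_mult norm_divide power2_eq_square inverse_eq_divide)
      also have "\<dots> \<le> 1 / lam * (w ?x / \<bar>v ?x\<bar>)"
        by (intro mult_right_mono norm_u_le) (simp add: w_def)
      finally show "(cmod (u ?x * f ?x))\<^sup>2 \<le> 1 / lam * (w ?x / \<bar>v ?x\<bar>)" .
    qed simp
    also have "\<dots> = real degree / lam * W y" by (simp add: W_def sum_distrib_left)
    finally show ?thesis .
  qed
  have "(L2_norm (transfer f))\<^sup>2 \<le> integral {0..1} (\<lambda>y. real degree / lam * W y)"
    unfolding L2_norm_sq[OF tpc]
  proof (rule integral_le)
    show "(\<lambda>y. (cmod (transfer f y))\<^sup>2) integrable_on {0..1}"
      by (intro integrable_continuous_interval continuous_intros periodic_continuousD tpc)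
    show "(\<lambda>y. real degree / lam * W y) integrable_on {0..1}"
      using int_W by (intro integrable_on_mult_right) (auto simp: integrable_on_def)
  qed (rule pointwise)
  also have "\<dots> = real degree / lam * integral {0..1} W" by simp
  also have "\<dots> = real degree / lam * (L2_norm f)\<^sup>2"
    using integral_unique[OF int_W] integral_unique[OF int_w] by (simp add: L2_norm_sq[OF fpc] w_def[abs_def])
  also have "\<dots> = (sqrt (real degree / lam) * L2_norm f)\<^sup>2"
    using lam by (simp add: power_mult_distrib)
  finally show ?thesis
    by (rule power2_le_imp_le) (use L2_hnorm_nonneg[OF fpc] lam in simp)
qed

end


section \<open>Functions on the circle\<close>

lemma abs_circle_eq_iff: "abs_circle x = abs_circle y \<longleftrightarrow> x - y \<in> \<int>"
  by (rule circle.abs_eq_iff)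

lemma abs_circle_add_int: "m \<in> \<int> \<Longrightarrow> abs_circle (x + m) = abs_circle x"
  by (simp add: abs_circle_eq_iff)

lemma abs_circle_surj: obtains x where "c = abs_circle x"
  using Quotient_abs_rep[OF Quotient_circle] by metis

lemma periodic_pullback: "periodic (f \<circ> abs_circle)"
  by (simp add: periodic_def abs_circle_add_int)

lemma pullback_inj: "f \<circ> abs_circle = g \<circ> abs_circle \<Longrightarrow> f = g"
  by (metis abs_circle_surj comp_apply ext)

lemma pullback_surj:
  assumes "periodic g"
  obtains f where "f \<circ> abs_circle = g"
proof
  show "(\<lambda>c. g (rep_circle c)) \<circ> abs_circle = g"
  proof
    fix x
    have "abs_circle (rep_circle (abs_circle x)) = abs_circle x"
      by (rule Quotient_abs_rep[OF Quotient_circle])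
    then obtain m where "rep_circle (abs_circle x) = x + of_int m"
      unfolding abs_circle_eq_iff by (metis Ints_cases add.commute diff_add_cancel)
    then show "((\<lambda>c. g (rep_circle c)) \<circ> abs_circle) x = g x"
      using periodic_of_int[OF assms] by simp
  qed
qed

lemma circle_deriv_eq: "circle_deriv f k = iter_deriv k (f \<circ> abs_circle)"
  by (simp add: circle_deriv_def iter_deriv_def)

lemma smooth_functions_iff: "f \<in> smooth_functions \<longleftrightarrow> smooth (f \<circ> abs_circle)"
  by (simp add: smooth_functions_def smooth_def circle_deriv_eq)

lemma pullback_add: "(f + g) \<circ> abs_circle = (\<lambda>x. (f \<circ> abs_circle) x + (g \<circ> abs_circle) x)"
  by (simp add: fun_eq_iff)

lemma pullback_cmult: "(\<lambda>x. c * f x) \<circ> abs_circle = (\<lambda>x. c * (f \<circ> abs_circle) x)"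
  by (simp add: fun_eq_iff)

lemma pullback_diff:
  fixes f g :: "circle \<Rightarrow> complex"
  shows "(f - g) \<circ> abs_circle = (\<lambda>x. (f \<circ> abs_circle) x + (- 1) * (g \<circ> abs_circle) x)"
  by (simp add: fun_eq_iff)

lemma smooth_functions_diff: "\<lbrakk>f \<in> smooth_functions; g \<in> smooth_functions\<rbrakk> \<Longrightarrow> f - g \<in> smooth_functions"
  unfolding smooth_functions_iff pullback_diff by (intro smooth_add smooth_cmult)

lemma circle_deriv_diff:
  "\<lbrakk>f \<in> smooth_functions; g \<in> smooth_functions\<rbrakk> \<Longrightarrow>
    circle_deriv (f - g) k x = circle_deriv f k x - circle_deriv g k x"
  unfolding smooth_functions_iff circle_deriv_eq pullback_diff
  by (subst iter_deriv_add, assumption, erule smooth_cmult, subst iter_deriv_cmult, assumption, simp)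

lemma circle_deriv_le_seminorm:
  assumes "f \<in> smooth_functions"
  shows "cmod (circle_deriv f k x) \<le> smooth_seminorm k f"
proof -
  have "smooth (f \<circ> abs_circle)" using assms by (simp add: smooth_functions_iff)
  then obtain b where "\<And>x. cmod (circle_deriv f k x) \<le> b"
    unfolding circle_deriv_eq
    using periodic_continuous_bounded[OF periodic_iter_deriv[OF _ periodic_pullback] smooth_continuous[OF smooth_iter_deriv]]
    by metis
  then show ?thesis
    unfolding smooth_seminorm_def by (intro cSUP_upper bdd_aboveI2) auto
qed

lemma smooth_seminorm_leI: "(\<And>x. cmod (circle_deriv f k x) \<le> b) \<Longrightarrow> smooth_seminorm k f \<le> b"
  unfolding smooth_seminorm_def by (intro cSUP_least) auto

lemma smooth_seminorm_triangle:
  assumes "f \<in> smooth_functions" "g \<in> smooth_functions" "h \<in> smooth_functions"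
  shows "smooth_seminorm k (f - h) \<le> smooth_seminorm k (g - h) + smooth_seminorm k (f - g)"
proof (rule smooth_seminorm_leI)
  fix x
  have "circle_deriv (f - h) k x = circle_deriv (g - h) k x + circle_deriv (f - g) k x"
    using assms by (simp add: circle_deriv_diff)
  also have "cmod \<dots> \<le> smooth_seminorm k (g - h) + smooth_seminorm k (f - g)"
    by (intro norm_triangle_mono circle_deriv_le_seminorm smooth_functions_diff assms)
  finally show "cmod (circle_deriv (f - h) k x) \<le> smooth_seminorm k (g - h) + smooth_seminorm k (f - g)" .
qed

lemma pullback_circle_character: "circle_character n \<circ> abs_circle = character n"
  by (simp add: fun_eq_iff circle_character.abs_eq character_def freq_def)

section \<open>The weight function and weighted Fourier coefficients\<close>

context weight_sequence
begin

lemma weight_le: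
  assumes "0 < x"
  shows "weight_function M x \<le> x ^ k * fact k * M k"
  unfolding weight_function_def
proof (rule cINF_lower)
  show "bdd_below (range (\<lambda>k. x ^ k * fact k * M k))"
    using assms M_pos by (intro bdd_belowI2[where m = 0]) (simp add: less_imp_le)
qed simp

text \<open>The terms tend to infinity, so only finitely many are below the term with index \<open>0\<close>.\<close>

lemma weight_attained:
  assumes x: "0 < x"
  obtains k where "weight_function M x = x ^ k * fact k * M k"
proof -
  define t where "t k = x ^ k * fact k * M k" for k
  have "(\<lambda>k. (1 / x) ^ k / fact k) \<longlonglongrightarrow> 0"
    using summable_exp[of "1 / x"] by (intro summable_LIMSEQ_zero) (simp add: divide_inverse mult.commute)
  then have "\<forall>\<^sub>F k in sequentially. (1 / x) ^ k / fact k < 1" by (rule order_tendstoD) simp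
  then obtain N where N: "\<And>k. N \<le> k \<Longrightarrow> (1 / x) ^ k / fact k < 1"
    by (auto simp: eventually_sequentially)
  have big: "t 0 \<le> t k" if "N \<le> k" for k
  proof -
    have "1 \<le> x ^ k * fact k" using N[OF that] x by (simp add: power_divide field_simps)
    then have "1 * 1 \<le> (x ^ k * fact k) * M k" using M_ge_1[of k] by (intro mult_mono) auto
    then show ?thesis by (simp add: t_def M_0)
  qed
  obtain k where k: "k \<le> N" "\<And>j. j \<le> N \<Longrightarrow> t k \<le> t j"
    using ex_is_arg_min_if_finite[of "{..N}" t] by (auto simp: is_arg_min_linorder)
  have "t k \<le> t j" for j
    using k(2)[of j] k(2)[of 0] big[of j] by (cases "j \<le> N") auto
  then have "t k \<le> weight_function M x"
    unfolding weight_function_def t_def by (intro cINF_greatest) auto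
  then have "weight_function M x = t k" using weight_le[OF x, of k] by (simp add: t_def)
  then show ?thesis using that by (simp add: t_def)
qed

lemma weight_pos: "0 < x \<Longrightarrow> 0 < weight_function M x"
  by (rule weight_attained[of x]) (use M_pos in auto)

lemma weight_mono: "\<lbrakk>0 < x; x \<le> y\<rbrakk> \<Longrightarrow> weight_function M x \<le> weight_function M y"
proof -
  assume xy: "0 < x" "x \<le> y"
  then obtain k where k: "weight_function M y = y ^ k * fact k * M k"
    using weight_attained[of y] by auto
  have "x ^ k * fact k * M k \<le> y ^ k * fact k * M k"
    using xy M_pos[of k] by (intro mult_right_mono power_mono) (auto simp: less_imp_le)
  with weight_le[OF xy(1), of k] show ?thesis unfolding k by (rule order_trans)
qed

text \<open>The supremum over \<open>k\<close> of \<open>(cmod (freq n) / B) ^ k / (fact k * M k)\<close>. For \<open>n = 0\<close> only the term with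
\<open>k = 0\<close> is nonzero, which explains the value \<open>1\<close>.\<close>

definition fourier_weight :: "real \<Rightarrow> int \<Rightarrow> real" where
  "fourier_weight B n = (if n = 0 then 1 else 1 / weight_function M (B / cmod (freq n)))"

lemma fourier_weight_pos: "0 < B \<Longrightarrow> 0 < fourier_weight B n"
  by (simp add: fourier_weight_def weight_pos)

lemma freq_power_le:
  assumes B: "0 < B"
  shows "cmod (freq n) ^ k \<le> B ^ k * fact k * M k * fourier_weight B n"
proof (cases "n = 0")
  case True
  then show ?thesis
    using B M_pos[of k] by (cases k) (auto simp: fourier_weight_def freq_def M_0 less_imp_le)
next
  case False
  then have f: "0 < cmod (freq n)" by simp
  let ?w = "weight_function M (B / cmod (freq n))"
  have w: "0 < ?w" using f B by (intro weight_pos) simp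
  have "?w \<le> (B / cmod (freq n)) ^ k * fact k * M k"
    using f B by (intro weight_le) simp
  then have "cmod (freq n) ^ k * ?w \<le> B ^ k * fact k * M k"
    using f by (simp add: power_divide field_simps)
  then show ?thesis using False w by (simp add: fourier_weight_def pos_le_divide_eq)
qed

lemma fourier_weight_attained:
  assumes B: "0 < B"
  obtains k where "cmod (freq n) ^ k = B ^ k * fact k * M k * fourier_weight B n"
proof (cases "n = 0")
  case True
  then show ?thesis using that[of 0] by (simp add: fourier_weight_def M_0)
next
  case False
  then have f: "0 < cmod (freq n)" by simp
  let ?w = "weight_function M (B / cmod (freq n))"
  obtain k where k: "?w = (B / cmod (freq n)) ^ k * fact k * M k"
    using weight_attained[of "B / cmod (freq n)"] f B by auto
  have w: "0 < ?w" using f B by (intro weight_pos) simp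
  have "cmod (freq n) ^ k * ?w = B ^ k * fact k * M k"
    unfolding k using f by (simp add: power_divide)
  then have "cmod (freq n) ^ k = B ^ k * fact k * M k * fourier_weight B n"
    using False w by (simp add: fourier_weight_def eq_divide_eq)
  then show ?thesis by (rule that)
qed

text \<open>Enlarging the frequency scale by \<open>\<theta>\<close> multiplies the term with index \<open>k\<close> by \<open>\<theta>^k\<close>.\<close>

lemma fourier_weight_scale_le:
  assumes B: "0 < B" and \<theta>: "0 < \<theta>"
    and k: "cmod (freq n) ^ k = B ^ k * fact k * M k * fourier_weight B n"
  shows "\<theta> ^ k * fourier_weight B n \<le> fourier_weight (B / \<theta>) n"
proof -
  have pos: "0 < (B / \<theta>) ^ k * fact k * M k" using B \<theta> M_pos[of k] by simp
  have "(B / \<theta>) ^ k * fact k * M k * (\<theta> ^ k * fourier_weight B n) = cmod (freq n) ^ k"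
    unfolding k using \<theta> by (simp add: power_divide)
  also have "\<dots> \<le> (B / \<theta>) ^ k * fact k * M k * fourier_weight (B / \<theta>) n"
    using B \<theta> by (intro freq_power_le) simp
  finally show ?thesis using pos by (simp only: mult_le_cancel_left_pos)
qed

lemma fourier_weight_le_scale:
  assumes B: "0 < B" and \<theta>: "1 \<le> \<theta>"
  shows "fourier_weight B n \<le> fourier_weight (B / \<theta>) n"
proof -
  obtain k where k: "cmod (freq n) ^ k = B ^ k * fact k * M k * fourier_weight B n"
    by (rule fourier_weight_attained[OF B])
  have "1 * fourier_weight B n \<le> \<theta> ^ k * fourier_weight B n"
    using \<theta> fourier_weight_pos[OF B, of n] by (intro mult_right_mono one_le_power) auto
  also have "\<dots> \<le> fourier_weight (B / \<theta>) n"
    using \<theta> by (intro fourier_weight_scale_le[OF B _ k]) simp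
  finally show ?thesis by simp
qed

lemma finite_freq_bounded: "finite {n. cmod (freq n) \<le> c}"
proof (rule finite_subset)
  show "{n. cmod (freq n) \<le> c} \<subseteq> {- \<lceil>c\<rceil>..\<lceil>c\<rceil>}"
  proof
    fix n assume "n \<in> {n. cmod (freq n) \<le> c}"
    then have "2 * pi * \<bar>real_of_int n\<bar> \<le> c" by (simp add: norm_freq)
    moreover have "1 * \<bar>real_of_int n\<bar> \<le> 2 * pi * \<bar>real_of_int n\<bar>"
      using pi_ge_two by (intro mult_right_mono) auto
    ultimately have "\<bar>real_of_int n\<bar> \<le> c" by simp
    then show "n \<in> {- \<lceil>c\<rceil>..\<lceil>c\<rceil>}" by (simp, linarith)
  qed
qed simp

text \<open>Where the ratio of the weights exceeds \<open>\<delta>\<close>, the supremum defining the weight is attained at an index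
\<open>k\<close> with \<open>\<theta>^k < 1 / \<delta>\<close>. For large frequencies this is impossible, because the term with a fixed larger
index \<open>K\<close> dominates.\<close>

lemma finite_weight_ratio_large:
  assumes B: "0 < B" and \<theta>: "1 < \<theta>" and \<delta>: "0 < \<delta>"
  shows "finite {n. \<delta> * fourier_weight (B / \<theta>) n < fourier_weight B n}"
proof -
  obtain K where K: "1 / \<delta> < \<theta> ^ K" using real_arch_pow[OF \<theta>] by blast
  have "cmod (freq n) \<le> B * max 1 (fact K * M K)"
    if n: "\<delta> * fourier_weight (B / \<theta>) n < fourier_weight B n" for n
  proof -
    obtain k where k: "cmod (freq n) ^ k = B ^ k * fact k * M k * fourier_weight B n"
      by (rule fourier_weight_attained[OF B])
    note W = fourier_weight_pos[OF B, of n]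
    have "\<delta> * (\<theta> ^ k * fourier_weight B n) < fourier_weight B n"
      using fourier_weight_scale_le[OF B _ k, of \<theta>] \<theta> \<delta> n
      by (meson le_less_trans less_trans mult_left_mono less_imp_le zero_less_one)
    then have "\<theta> ^ k < 1 / \<delta>" using W \<delta> by (simp add: field_simps)
    then have "k < K" using K \<theta> by (meson less_trans power_less_imp_less_exp)
    define y where "y = cmod (freq n) / B"
    have "y ^ k * 1 \<ge> fourier_weight B n"
    proof -
      have "1 * 1 \<le> fact k * M k" using M_ge_1[of k] by (intro mult_mono) auto
      then have "fourier_weight B n \<le> fact k * M k * fourier_weight B n" using W by simp
      also have "\<dots> = y ^ k" using k B by (simp add: y_def power_divide field_simps)
      finally show ?thesis by simp
    qed
    moreover have "y ^ K \<le> fact K * M K * fourier_weight B n"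
      using freq_power_le[OF B, of n K] B by (simp add: y_def power_divide field_simps)
    ultimately have le: "y ^ K \<le> fact K * M K * y ^ k"
      using M_pos[of K] by (smt (verit) mult_left_mono fact_gt_zero mult_pos_pos)
    have "y \<le> max 1 (fact K * M K)"
    proof (cases "1 \<le> y")
      case True
      have "y ^ Suc k \<le> y ^ K" using True \<open>k < K\<close> by (intro power_increasing) auto
      then have "y * y ^ k \<le> fact K * M K * y ^ k" using le by simp
      moreover have "0 < y ^ k" using True by simp
      ultimately have "y \<le> fact K * M K" by (simp only: mult_le_cancel_right_pos)
      then show ?thesis by simp
    qed auto
    then show ?thesis using B by (simp add: y_def field_simps)
  qed
  then show ?thesis
    by (intro finite_subset[OF _ finite_freq_bounded[of "B * max 1 (fact K * M K)"]]) auto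
qed

text \<open>Each frequency is assigned to an index \<open>\<kappa> n\<close> at which its weight is attained. The frequencies assigned
to \<open>k\<close> are controlled by the hypothesis for this \<open>k\<close>, and the resulting bounds form a
geometric series with ratio \<open>r\<^sup>2\<close>.\<close>

lemma sum_fourier_weight_le:
  assumes B: "0 < B" and r: "0 \<le> r" "r < 1" and F: "finite F"
    and bound: "\<And>k. (\<Sum>n\<in>F. (cmod (freq n) ^ k * cmod (b n))\<^sup>2) \<le> (c * (r * B) ^ k * fact k * M k)\<^sup>2"
  shows "(\<Sum>n\<in>F. (fourier_weight B n * cmod (b n))\<^sup>2) \<le> c\<^sup>2 / (1 - r\<^sup>2)"
proof -
  have "\<exists>k. cmod (freq n) ^ k = B ^ k * fact k * M k * fourier_weight B n" for n
    by (rule fourier_weight_attained[OF B, of n]) blast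
  then obtain \<kappa> where \<kappa>: "\<And>n. cmod (freq n) ^ \<kappa> n = B ^ \<kappa> n * fact (\<kappa> n) * M (\<kappa> n) * fourier_weight B n"
    by metis
  define D where "D k = B ^ k * fact k * M k" for k
  have D: "0 < D k" for k using B M_pos[of k] by (simp add: D_def)
  have "(\<Sum>n\<in>F. (fourier_weight B n * cmod (b n))\<^sup>2) =
      (\<Sum>n\<in>F. (cmod (freq n) ^ \<kappa> n * cmod (b n))\<^sup>2 / (D (\<kappa> n))\<^sup>2)"
  proof (rule sum.cong)
    fix n
    have "(cmod (freq n) ^ \<kappa> n * cmod (b n)) / D (\<kappa> n) = fourier_weight B n * cmod (b n)"
    proof -
      have "cmod (freq n) ^ \<kappa> n = D (\<kappa> n) * fourier_weight B n" unfolding \<kappa> D_def ..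
      then show ?thesis using D[of "\<kappa> n"] by simp
    qed
    then show "(fourier_weight B n * cmod (b n))\<^sup>2 = (cmod (freq n) ^ \<kappa> n * cmod (b n))\<^sup>2 / (D (\<kappa> n))\<^sup>2"
      by (metis power_divide)
  qed simp
  also have "\<dots> = (\<Sum>k\<in>\<kappa> ` F. \<Sum>n\<in>{n \<in> F. \<kappa> n = k}. (cmod (freq n) ^ \<kappa> n * cmod (b n))\<^sup>2 / (D (\<kappa> n))\<^sup>2)"
    by (rule sum.image_gen[OF F])
  also have "\<dots> \<le> (\<Sum>k\<in>\<kappa> ` F. c\<^sup>2 * (r\<^sup>2) ^ k)"
  proof (rule sum_mono)
    fix k
    have "(\<Sum>n\<in>{n \<in> F. \<kappa> n = k}. (cmod (freq n) ^ \<kappa> n * cmod (b n))\<^sup>2 / (D (\<kappa> n))\<^sup>2) =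
        (\<Sum>n\<in>{n \<in> F. \<kappa> n = k}. (cmod (freq n) ^ k * cmod (b n))\<^sup>2) / (D k)\<^sup>2"
      unfolding sum_divide_distrib by (intro sum.cong) auto
    also have "\<dots> \<le> (\<Sum>n\<in>F. (cmod (freq n) ^ k * cmod (b n))\<^sup>2) / (D k)\<^sup>2"
      using F by (intro divide_right_mono sum_mono2) auto
    also have "\<dots> \<le> (c * (r * B) ^ k * fact k * M k)\<^sup>2 / (D k)\<^sup>2"
      by (intro divide_right_mono bound) simp
    also have "(c * (r * B) ^ k * fact k * M k)\<^sup>2 / (D k)\<^sup>2 = (c * r ^ k)\<^sup>2"
    proof -
      have eq: "c * (r * B) ^ k * fact k * M k = c * r ^ k * D k" by (simp add: D_def power_mult_distrib)
      show ?thesis unfolding eq using D[of k] by (simp add: power_mult_distrib)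
    qed
    also have "\<dots> = c\<^sup>2 * (r\<^sup>2) ^ k" by (simp add: power_mult_distrib power_mult[symmetric] mult.commute)
    finally show "(\<Sum>n\<in>{n \<in> F. \<kappa> n = k}. (cmod (freq n) ^ \<kappa> n * cmod (b n))\<^sup>2 / (D (\<kappa> n))\<^sup>2) \<le> c\<^sup>2 * (r\<^sup>2) ^ k" .
  qed
  also have "\<dots> = c\<^sup>2 * (\<Sum>k\<in>\<kappa> ` F. (r\<^sup>2) ^ k)" by (simp add: sum_distrib_left)
  also have "\<dots> \<le> c\<^sup>2 * (1 / (1 - r\<^sup>2))"
  proof (rule mult_left_mono)
    have r2: "norm (r\<^sup>2) < 1" using r by (simp add: power_less_one_iff abs_square_less_1)
    have "(\<Sum>k\<in>\<kappa> ` F. (r\<^sup>2) ^ k) \<le> (\<Sum>k. (r\<^sup>2) ^ k)"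
      using F by (intro sum_le_suminf summable_geometric r2) auto
    then show "(\<Sum>k\<in>\<kappa> ` F. (r\<^sup>2) ^ k) \<le> 1 / (1 - r\<^sup>2)" using suminf_geometric[OF r2] by simp
  qed simp
  finally show ?thesis by simp
qed

end


section \<open>Hilbert spaces of ultradifferentiable functions\<close>

locale carleman_space = weight_sequence M for M +
  fixes B :: real
  assumes B_pos: "0 < B"
begin

abbreviation coeff :: "(circle \<Rightarrow> complex) \<Rightarrow> int \<Rightarrow> complex" where
  "coeff f \<equiv> fourier (f \<circ> abs_circle)"

definition carrier :: "(circle \<Rightarrow> complex) set" where
  "carrier = {f \<in> smooth_functions. (\<lambda>n. (fourier_weight B n * cmod (coeff f n))\<^sup>2) summable_on UNIV}"

lemma carrier_smooth: "f \<in> carrier \<Longrightarrow> smooth (f \<circ> abs_circle)"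
  by (simp add: carrier_def smooth_functions_iff)

lemma smooth_pullback_periodic_continuous:
  "smooth (f \<circ> abs_circle) \<Longrightarrow> f \<circ> abs_circle \<in> periodic_continuous"
  by (intro smooth_periodic_continuous periodic_pullback)

lemma coeff_add_smooth:
  "\<lbrakk>smooth (f \<circ> abs_circle); smooth (g \<circ> abs_circle)\<rbrakk> \<Longrightarrow> coeff (f + g) n = coeff f n + coeff g n"
  unfolding pullback_add by (intro fourier_add smooth_pullback_periodic_continuous)

lemma coeff_cmult_smooth: "smooth (f \<circ> abs_circle) \<Longrightarrow> coeff (fscale c f) n = c * coeff f n"
  unfolding pullback_cmult by (intro fourier_cmult smooth_pullback_periodic_continuous)

lemma trig_series_coeff: "smooth (f \<circ> abs_circle) \<Longrightarrow> trig_series (coeff f) = f \<circ> abs_circle"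
  by (intro fourier_inversion periodic_pullback)

lemma bounded_weighted_rapidly_decreasing:
  assumes "\<And>n. fourier_weight B n * cmod (a n) \<le> c"
  shows "rapidly_decreasing a"
  unfolding rapidly_decreasing_def
proof (intro allI exI)
  fix k n
  have "cmod (freq n) ^ k * cmod (a n) \<le> B ^ k * fact k * M k * fourier_weight B n * cmod (a n)"
    by (intro mult_right_mono freq_power_le B_pos) simp
  also have "\<dots> = B ^ k * fact k * M k * (fourier_weight B n * cmod (a n))" by simp
  also have "\<dots> \<le> B ^ k * fact k * M k * c"
    using B_pos M_pos[of k] by (intro mult_left_mono assms) (auto simp: less_imp_le)
  finally show "cmod (freq n) ^ k * cmod (a n) \<le> B ^ k * fact k * M k * c" .
qed

sublocale weighted_l2 carrier coeff "fourier_weight B"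
proof
  show "cfun.subspace carrier"
    unfolding cfun.subspace_def
  proof (intro conjI ballI allI)
    have "fourier (\<lambda>x. 0) n = 0" for n using fourier_const[of 0 n] by simp
    then show "0 \<in> carrier"
      unfolding carrier_def smooth_functions_iff by (simp add: smooth_const o_def)
    fix f g assume fg: "f \<in> carrier" "g \<in> carrier"
    have "(\<lambda>n. (fourier_weight B n * cmod (coeff (f + g) n))\<^sup>2) summable_on UNIV"
    proof (rule summable_on_comparison_test)
      show "(\<lambda>n. 2 * (fourier_weight B n * cmod (coeff f n))\<^sup>2 + 2 * (fourier_weight B n * cmod (coeff g n))\<^sup>2) summable_on UNIV"
        using fg by (intro summable_on_add summable_on_cmult_right) (auto simp: carrier_def)
      fix n
      have "fourier_weight B n * cmod (coeff (f + g) n) \<le>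
          fourier_weight B n * (cmod (coeff f n) + cmod (coeff g n))"
        using fg fourier_weight_pos[OF B_pos, of n]
        by (intro mult_left_mono) (auto simp: coeff_add_smooth carrier_smooth norm_triangle_ineq)
      then have "(fourier_weight B n * cmod (coeff (f + g) n))\<^sup>2 \<le>
          (fourier_weight B n * cmod (coeff f n) + fourier_weight B n * cmod (coeff g n))\<^sup>2"
        using fourier_weight_pos[OF B_pos, of n] by (intro power_mono) (auto simp: distrib_left)
      also have "\<dots> \<le> 2 * (fourier_weight B n * cmod (coeff f n))\<^sup>2 + 2 * (fourier_weight B n * cmod (coeff g n))\<^sup>2"
        using sum_squares_bound[of "fourier_weight B n * cmod (coeff f n)" "fourier_weight B n * cmod (coeff g n)"]
        unfolding power2_sum by linarith
      finally show "(fourier_weight B n * cmod (coeff (f + g) n))\<^sup>2 \<le> \<dots>" .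
    qed simp
    moreover have "smooth ((f + g) \<circ> abs_circle)"
      unfolding pullback_add by (intro smooth_add carrier_smooth fg)
    ultimately show "f + g \<in> carrier"
      unfolding carrier_def smooth_functions_iff by blast
  next
    fix c f assume f: "f \<in> carrier"
    have "(\<lambda>n. (fourier_weight B n * cmod (coeff (fscale c f) n))\<^sup>2) =
        (\<lambda>n. (cmod c)\<^sup>2 * (fourier_weight B n * cmod (coeff f n))\<^sup>2)"
      unfolding coeff_cmult_smooth[OF carrier_smooth[OF f]]
      by (simp add: norm_mult power_mult_distrib mult_ac)
    moreover have "(\<lambda>n. (cmod c)\<^sup>2 * (fourier_weight B n * cmod (coeff f n))\<^sup>2) summable_on UNIV"
      using f by (intro summable_on_cmult_right) (simp add: carrier_def)
    moreover have "smooth ((fscale c f) \<circ> abs_circle)"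
      unfolding pullback_cmult by (intro smooth_cmult carrier_smooth f)
    ultimately show "fscale c f \<in> carrier"
      unfolding carrier_def smooth_functions_iff by simp
  qed
next
  fix f assume f: "f \<in> carrier" and z: "\<And>n. coeff f n = 0"
  have "f \<circ> abs_circle = trig_series (coeff f)" using trig_series_coeff[OF carrier_smooth[OF f]] by simp
  also have "\<dots> = 0 \<circ> abs_circle" using z by (simp add: trig_series_def fun_eq_iff)
  finally show "f = 0" by (rule pullback_inj)
next
  fix a :: "int \<Rightarrow> complex" assume a: "(\<lambda>n. (fourier_weight B n * cmod (a n))\<^sup>2) summable_on UNIV"
  define c where "c = sqrt (\<Sum>\<^sub>\<infinity>n. (fourier_weight B n * cmod (a n))\<^sup>2)"
  have "fourier_weight B n * cmod (a n) \<le> c" for n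
  proof -
    have "(fourier_weight B n * cmod (a n))\<^sup>2 \<le> (\<Sum>\<^sub>\<infinity>n. (fourier_weight B n * cmod (a n))\<^sup>2)"
      using finite_sum_le_infsum[OF a, of "{n}"] by simp
    then show ?thesis unfolding c_def by (rule real_le_rsqrt)
  qed
  then have r: "rapidly_decreasing a" by (rule bounded_weighted_rapidly_decreasing)
  obtain f where f: "f \<circ> abs_circle = trig_series a" using pullback_surj[OF periodic_trig_series] by metis
  have cf: "coeff f = a" unfolding f using fourier_trig_series[OF r] by blast
  have "f \<in> carrier"
    using a cf f smooth_trig_series[OF r] by (simp add: carrier_def smooth_functions_iff)
  then show "\<exists>f\<in>carrier. coeff f = a" using cf by blast
qed (auto simp: carrier_def smooth_functions_iff coeff_add_smooth coeff_cmult_smooth fourier_weight_pos[OF B_pos])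

text \<open>Since the weight dominates \<open>cmod (freq n) ^ j / (B ^ j * fact j * M j)\<close>, the Parseval inequality turns
the norm of the space into bounds for all derivatives.\<close>

lemma derivative_L2_bound:
  assumes f: "f \<in> carrier"
  shows "L2_norm (iter_deriv j (f \<circ> abs_circle)) \<le> hnorm f * B ^ j * fact j * M j"
proof -
  define D where "D = B ^ j * fact j * M j"
  have D: "0 \<le> D" using B_pos M_pos[of j] by (simp add: D_def)
  have r: "rapidly_decreasing (coeff f)"
    by (intro rapidly_decreasing_fourier carrier_smooth f periodic_pullback)
  have "iter_deriv j (f \<circ> abs_circle) = trig_series (\<lambda>n. freq n ^ j * coeff f n)"
    using iter_deriv_trig_series[OF r, of j] trig_series_coeff[OF carrier_smooth[OF f]] by simp
  moreover have "L2_norm (trig_series (\<lambda>n. freq n ^ j * coeff f n)) \<le> D * hnorm f"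
  proof (rule L2_norm_trig_series_le[OF rapidly_decreasing_freq_power[OF r]])
    show "0 \<le> D * hnorm f" using D hnorm_nonneg[OF f] by simp
    fix F :: "int set" assume F: "finite F"
    have "(\<Sum>n\<in>F. (cmod (freq n ^ j * coeff f n))\<^sup>2) \<le> (\<Sum>n\<in>F. D\<^sup>2 * (wcoeff f n)\<^sup>2)"
    proof (rule sum_mono)
      fix n
      have "cmod (freq n ^ j * coeff f n) \<le> D * fourier_weight B n * cmod (coeff f n)"
        unfolding norm_mult norm_power D_def by (intro mult_right_mono freq_power_le B_pos) simp
      then have "(cmod (freq n ^ j * coeff f n))\<^sup>2 \<le> (D * (wcoeff f n))\<^sup>2"
        by (intro power_mono) (simp_all add: mult.assoc)
      then show "(cmod (freq n ^ j * coeff f n))\<^sup>2 \<le> D\<^sup>2 * (wcoeff f n)\<^sup>2"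
        by (simp only: power_mult_distrib)
    qed
    also have "\<dots> \<le> D\<^sup>2 * (hnorm f)\<^sup>2"
      unfolding sum_distrib_left[symmetric] by (intro mult_left_mono sum_le_hnorm_sq f F) simp
    finally show "(\<Sum>n\<in>F. (cmod (freq n ^ j * coeff f n))\<^sup>2) \<le> (D * hnorm f)\<^sup>2"
      by (simp only: power_mult_distrib)
  qed
  ultimately show ?thesis by (simp add: D_def mult_ac)
qed

text \<open>The weight dominates all powers of the frequency; the powers \<open>k\<close> and \<open>k + 2\<close> together give an
absolutely convergent series for the \<open>k\<close>-th derivative.\<close>

lemma seminorm_bound:
  obtains K where "0 \<le> K" "\<And>f. f \<in> carrier \<Longrightarrow> smooth_seminorm k f \<le> K * hnorm f"
proof -
  define D where "D j = B ^ j * fact j * M j" for j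
  have D: "0 \<le> D j" for j using B_pos M_pos[of j] by (simp add: D_def)
  define S where "S = (\<Sum>\<^sub>\<infinity>n. 1 / (1 + (cmod (freq n))\<^sup>2))"
  have S: "0 \<le> S" unfolding S_def by (intro infsum_nonneg) (simp add: add_nonneg_nonneg)
  have "smooth_seminorm k f \<le> (D k + D (k + 2)) * S * hnorm f" if f: "f \<in> carrier" for f
  proof (rule smooth_seminorm_leI)
    fix x
    have r: "rapidly_decreasing (coeff f)"
      by (intro rapidly_decreasing_fourier carrier_smooth f periodic_pullback)
    have "circle_deriv f k = trig_series (\<lambda>n. freq n ^ k * coeff f n)"
      using iter_deriv_trig_series[OF r, of k] trig_series_coeff[OF carrier_smooth[OF f]] by (simp add: circle_deriv_eq)
    then have "cmod (circle_deriv f k x) \<le> (\<Sum>\<^sub>\<infinity>n. cmod (freq n) ^ k * cmod (coeff f n))"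
      using norm_trig_series_le[OF rapidly_decreasing_freq_power[OF r, of k], of x] by (simp add: norm_mult norm_power)
    also have "\<dots> \<le> (\<Sum>\<^sub>\<infinity>n. (D k + D (k + 2)) * hnorm f * (1 / (1 + (cmod (freq n))\<^sup>2)))"
    proof (rule infsum_mono)
      show "(\<lambda>n. cmod (freq n) ^ k * cmod (coeff f n)) summable_on UNIV"
        by (rule rapidly_decreasing_summable[OF r])
      show "(\<lambda>n. (D k + D (k + 2)) * hnorm f * (1 / (1 + (cmod (freq n))\<^sup>2))) summable_on UNIV"
        by (intro summable_on_cmult_right summable_inverse_one_plus_freq_sq)
      fix n
      have j: "cmod (freq n) ^ j * cmod (coeff f n) \<le> D j * hnorm f" for j
      proof -
        have "cmod (freq n) ^ j * cmod (coeff f n) \<le> D j * fourier_weight B n * cmod (coeff f n)"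
          unfolding D_def by (intro mult_right_mono freq_power_le B_pos) simp
        also have "\<dots> \<le> D j * hnorm f"
          using coeff_le_hnorm[OF f, of n] D[of j] by (simp add: mult.assoc mult_left_mono)
        finally show ?thesis .
      qed
      have "(cmod (freq n) ^ k * cmod (coeff f n)) * (1 + (cmod (freq n))\<^sup>2) =
          cmod (freq n) ^ k * cmod (coeff f n) + cmod (freq n) ^ (k + 2) * cmod (coeff f n)"
        by (simp add: power_add algebra_simps power2_eq_square)
      also have "\<dots> \<le> (D k + D (k + 2)) * hnorm f"
        using j[of k] j[of "k + 2"] by (simp only: distrib_right)
      finally show "cmod (freq n) ^ k * cmod (coeff f n) \<le> (D k + D (k + 2)) * hnorm f * (1 / (1 + (cmod (freq n))\<^sup>2))"
        by (simp add: pos_le_divide_eq add_pos_nonneg)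
    qed
    also have "\<dots> = (D k + D (k + 2)) * S * hnorm f"
      unfolding S_def by (simp only: infsum_cmult_right' mult_ac)
    finally show "cmod (circle_deriv f k x) \<le> (D k + D (k + 2)) * S * hnorm f" .
  qed
  then show ?thesis using that[of "(D k + D (k + 2)) * S"] D S by simp
qed

lemma continuous_inclusion: "continuous_map mtopology smooth_topology (\<lambda>f. f)"
  unfolding smooth_topology_def
proof (rule continuous_on_generated_topo)
  have sm: "f \<in> smooth_functions" if "f \<in> carrier" for f using that by (simp add: carrier_def)
  let ?S = "{{g \<in> smooth_functions. smooth_seminorm k (g - f) < e} | f k e. f \<in> smooth_functions \<and> 0 < e}"
  show "(\<lambda>f. f) ` topspace mtopology \<subseteq> \<Union> ?S"
  proof clarsimp
    fix f assume f: "f \<in> carrier"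
    have "smooth_seminorm 0 (f - f) \<le> 0"
      by (rule smooth_seminorm_leI) (subst circle_deriv_diff[OF sm[OF f] sm[OF f]], simp)
    then show "\<exists>U. (\<exists>fa k e. U = {g \<in> smooth_functions. smooth_seminorm k (g - fa) < e} \<and>
        fa \<in> smooth_functions \<and> 0 < e) \<and> f \<in> U"
      using sm[OF f] by (intro exI[of _ "{g \<in> smooth_functions. smooth_seminorm 0 (g - f) < 1}"] conjI exI[of _ f] exI[of _ "0::nat"] exI[of _ "1::real"]) auto
  qed
  fix U assume "U \<in> ?S"
  then obtain f k e where U: "U = {g \<in> smooth_functions. smooth_seminorm k (g - f) < e}"
    and f: "f \<in> smooth_functions" by blast
  obtain K where K: "0 \<le> K" "\<And>f. f \<in> carrier \<Longrightarrow> smooth_seminorm k f \<le> K * hnorm f"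
    using seminorm_bound[of k] by blast
  show "openin mtopology ((\<lambda>f. f) -` U \<inter> topspace mtopology)"
    unfolding openin_mtopology
  proof (intro conjI allI impI)
    fix g assume "g \<in> (\<lambda>f. f) -` U \<inter> topspace mtopology"
    then have g: "g \<in> carrier" "smooth_seminorm k (g - f) < e" by (auto simp: U)
    define r where "r = (e - smooth_seminorm k (g - f)) / (K + 1)"
    have r: "0 < r" "K * r < e - smooth_seminorm k (g - f)"
      using g(2) K(1) by (auto simp: r_def field_simps)
    have "h \<in> (\<lambda>f. f) -` U \<inter> topspace mtopology" if "h \<in> mball g r" for h
    proof -
      have h: "h \<in> carrier" "hnorm (h - g) < r"
        using that g(1) hnorm_diff_commute[of g h] by (auto simp: hdist_def)
      have "smooth_seminorm k (h - f) \<le> smooth_seminorm k (g - f) + smooth_seminorm k (h - g)"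
        by (intro smooth_seminorm_triangle sm h g f)
      also have "smooth_seminorm k (h - g) \<le> K * hnorm (h - g)"
        by (intro K diff_mem h g)
      also have "K * hnorm (h - g) \<le> K * r" using h K by (intro mult_left_mono) auto
      finally have "smooth_seminorm k (h - f) < e" using r by linarith
      then show ?thesis using h(1) sm[OF h(1)] unfolding U topspace_mtopology by blast
    qed
    then show "\<exists>r>0. mball g r \<subseteq> (\<lambda>f. f) -` U \<inter> topspace mtopology" using r(1) by blast
  qed simp
qed

lemma unit_vector_eq_character: "unit_vector n = circle_character n"
proof -
  have c: "coeff (circle_character n) m = (if m = n then 1 else 0)" for m
    unfolding pullback_circle_character fourier_def by (simp add: character_orthonormal)
  have "(\<lambda>m. (fourier_weight B m * cmod (coeff (circle_character n) m))\<^sup>2) summable_on UNIV"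
    using coeff_summable[OF unit_vector(1)[of n]] by (simp add: c unit_vector(2))
  then have mem: "circle_character n \<in> carrier"
    by (simp add: carrier_def smooth_functions_iff pullback_circle_character smooth_character)
  have "unit_vector n - circle_character n = 0"
    by (rule coeff_inj) (simp_all add: diff_mem unit_vector mem coeff_diff c)
  then show ?thesis by simp
qed

lemma trigonometric_polynomials_subset: "trigonometric_polynomials \<subseteq> carrier"
  unfolding trigonometric_polynomials_def
  by (intro cfun.span_minimal carrier_subspace)
    (auto simp: unit_vector_eq_character[symmetric] unit_vector)

lemma trigonometric_polynomials_dense: "mtopology closure_of trigonometric_polynomials = carrier"
  using closure_of_span_unit_vectors
  unfolding trigonometric_polynomials_def by (simp add: unit_vector_eq_character[abs_def])

end


section \<open>The transfer operator of a circle map\<close>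

context expanding_lift
begin

lemma orientation_int: obtains e :: int where "orientation = of_int e" "e = 1 \<or> e = - 1"
  using orientation_cases that[of 1] that[of "- 1"] by auto

text \<open>The points \<open>G (y + j)\<close> with an arbitrary integer \<open>j\<close> are all the lifts of the preimages, and two of them
represent the same point of the circle iff the indices are congruent modulo the degree.\<close>

lemma fiber_bij_betw:
  assumes T: "\<And>x. T (abs_circle x) = abs_circle (F x)"
  shows "bij_betw (\<lambda>j. abs_circle (G (y + real j))) {..<degree} {c. T c = abs_circle y}"
  unfolding bij_betw_def
proof
  obtain e where e: "orientation = of_int e" "e = 1 \<or> e = - 1" by (rule orientation_int)
  show "inj_on (\<lambda>j. abs_circle (G (y + real j))) {..<degree}"
  proof (rule inj_onI)
    fix i j assume ij: "i \<in> {..<degree}" "j \<in> {..<degree}"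
      and "abs_circle (G (y + real i)) = abs_circle (G (y + real j))"
    then obtain m where m: "G (y + real i) = G (y + real j) + of_int m"
      unfolding abs_circle_eq_iff by (metis Ints_cases add.commute diff_add_cancel)
    have "y + real i = F (G (y + real j) + of_int m)" using m by (metis F_G)
    then have "real i = real j + of_int m * (orientation * real degree)"
      unfolding F_shift_int by simp
    then have "of_int (int i) = (of_int (int j + m * e * int degree) :: real)"
      by (simp add: e(1))
    then have "int i = int j + m * e * int degree" by (simp only: of_int_eq_iff)
    then have "int i mod int degree = int j mod int degree" by simp
    then show "i = j" using ij by simp
  qed
  show "(\<lambda>j. abs_circle (G (y + real j))) ` {..<degree} = {c. T c = abs_circle y}"
  proof (intro equalityI subsetI)
    fix c assume "c \<in> {c. T c = abs_circle y}"
    moreover obtain t where t: "c = abs_circle t" by (rule abs_circle_surj)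
    ultimately have "F t - y \<in> \<int>" by (simp add: T abs_circle_eq_iff)
    then obtain i where i: "F t = y + of_int i" by (metis Ints_cases add.commute diff_add_cancel)
    define j where "j = nat (i mod int degree)"
    define m where "m = i div int degree"
    have D: "0 < int degree" using degree_pos by simp
    have j: "j < degree" "int j = i mod int degree"
      using D by (auto simp: j_def nat_less_iff)
    have "i = m * int degree + int j" unfolding m_def j(2) by simp
    then have "of_int i = of_int m * real degree + real j" by (simp del: of_int_mult add: of_int_mult[symmetric]) simp
    then have "G (F t) = G (y + real j + of_int m * real degree)" unfolding i by (simp add: add_ac)
    then have "t = G (y + real j) + of_int m * of_int e" by (simp add: G_shift_int e(1))
    then have "abs_circle t = abs_circle (G (y + real j))" by (simp add: abs_circle_eq_iff)
    then show "c \<in> (\<lambda>j. abs_circle (G (y + real j))) ` {..<degree}" using t j(1) by blast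
  qed (auto simp: T abs_circle_add_int)
qed

lemma transfer_operator_pullback:
  assumes T: "\<And>x. T (abs_circle x) = abs_circle (F x)" and T': "\<And>x. T' (abs_circle x) = v x"
  shows "transfer_operator T T' \<phi> \<circ> abs_circle = transfer (\<phi> \<circ> abs_circle)"
proof
  fix y
  have "(transfer_operator T T' \<phi> \<circ> abs_circle) y =
      (\<Sum>j<degree. of_real (1 / \<bar>T' (abs_circle (G (y + real j)))\<bar>) * \<phi> (abs_circle (G (y + real j))))"
    unfolding transfer_operator_def o_def
    by (rule sum.reindex_bij_betw[symmetric]) (rule fiber_bij_betw[OF T])
  also have "\<dots> = (\<Sum>j<degree. of_real orientation * (u (G (y + real j)) * (\<phi> \<circ> abs_circle) (G (y + real j))))"
    unfolding T' orientation_divide_v[symmetric] u_def by (simp add: divide_inverse mult.assoc)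
  also have "\<dots> = transfer (\<phi> \<circ> abs_circle) y"
    by (simp only: transfer_def sum_distrib_left)
  finally show "(transfer_operator T T' \<phi> \<circ> abs_circle) y = transfer (\<phi> \<circ> abs_circle) y" .
qed

end

lemma transfer_operator_add: "transfer_operator T T' (f + g) = transfer_operator T T' f + transfer_operator T T' g"
  by (simp add: transfer_operator_def fun_eq_iff sum.distrib distrib_left)

lemma transfer_operator_scale: "transfer_operator T T' (fscale c f) = fscale c (transfer_operator T T' f)"
  by (simp add: transfer_operator_def fun_eq_iff sum_distrib_left mult_ac)

theorem theorem5:
  fixes M :: "nat \<Rightarrow> real" and T :: "circle \<Rightarrow> circle" and T' :: "circle \<Rightarrow> real"
    and lam \<theta> :: real
  assumes "\<And>k. 0 < M k" and "mono M" and "M 0 = 1"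
    and "\<And>k. 1 \<le> k \<Longrightarrow> (M k)\<^sup>2 \<le> M (k - 1) * M (k + 1)"
    and "1 < lam"
    and "circle_map_has_derivative T T'"
    and "\<And>x. lam < \<bar>T' x\<bar>"
    and "(\<lambda>x. complex_of_real (T' x)) \<in> denjoy_carleman M"
    and "1 < \<theta>" and "\<theta> < lam"
  shows "\<exists>C A H ip. 0 < C \<and> 0 < A \<and>
    function_hilbert_space H ip \<and>
    continuous_map (Metric_space.mtopology H (function_inner_space.hdist H ip))
      smooth_topology (\<lambda>f. f) \<and>
    trigonometric_polynomials \<subseteq> H \<and>
    Metric_space.mtopology H (function_inner_space.hdist H ip)
      closure_of trigonometric_polynomials = H \<and>
    function_inner_space.compact_operator H ip (transfer_operator T T') \<and>
    (\<forall>k\<ge>1. function_inner_space.singular_value H ip (transfer_operator T T') k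
      \<le> C * (SUP x\<in>{0<..1 / real k}.
          weight_function M (A * x) / weight_function M (\<theta> * A * x)))"
proof -
  interpret weight_sequence M by (unfold_locales) (use assms(1-4) in auto)
  define v where "v x = T' (abs_circle x)" for x
  obtain F where TF: "\<And>x. T (abs_circle x) = abs_circle (F x)"
    and F: "\<And>x. (F has_real_derivative v x) (at x)"
    using assms(6) unfolding circle_map_has_derivative_def v_def by blast
  have pull: "(\<lambda>x. complex_of_real (T' x)) \<circ> abs_circle = (\<lambda>x. of_real (v x))"
    by (simp add: fun_eq_iff v_def)
  have v_smooth: "smooth (\<lambda>x. of_real (v x))"
    using assms(8) by (simp add: denjoy_carleman_def smooth_functions_iff pull)
  from assms(8) have "\<exists>C>0. \<exists>R>0. \<forall>k x. cmod (iter_deriv k (\<lambda>x. of_real (v x)) x) \<le> C * R ^ k * fact k * M k"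
    by (simp add: denjoy_carleman_def circle_deriv_eq pull)
  then obtain C0 R where C0: "0 < C0" "0 < R"
    and v_bound: "\<And>k x. cmod (iter_deriv k (\<lambda>x. of_real (v x)) x) \<le> C0 * R ^ k * fact k * M k"
    by metis
  have "abs_circle (F 1) = abs_circle (F 0)"
    using abs_circle_add_int[of 1 0] by (simp add: TF[symmetric])
  then interpret expanding_lift F v lam
    using assms(5,7) F v_smooth
    by unfold_locales (auto simp: v_def periodic_def abs_circle_add_int abs_circle_eq_iff)
  define S where "S = R * (1 + C0 / lam)"
  have S: "0 < S" unfolding S_def using C0 assms(5) by (intro mult_pos_pos add_pos_pos) auto
  have u_bound: "cmod (iter_deriv k u x) \<le> 1 / lam * S ^ k * fact k * M k" for k x
    unfolding u_def[abs_def] S_def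
    using expanding by (intro inverse_derivative_bounds[OF v_smooth _ _ C0 v_bound]) (use assms(5) in \<open>auto intro: less_imp_le\<close>)
  \<comment> \<open>\<open>e\<close> is chosen such that \<open>(1 + e) * \<theta>\<close> is the mean of \<open>\<theta>\<close> and \<open>lam\<close>, and \<open>B\<close> such that the
    contraction factor \<open>p\<close> becomes \<open>(1 + e) / lam\<close>\<close>
  define e where "e = (lam - \<theta>) / (2 * \<theta>)"
  have e: "0 < e" using assms(9,10) by (simp add: e_def)
  define B where "B = S * (1 + e) / e"
  have SB: "S / B = e / (1 + e)" using S e by (simp add: B_def)
  have B: "0 < B" unfolding B_def using S e by (intro divide_pos_pos mult_pos_pos) auto
  have "S < B"
  proof -
    have "S / B < 1" unfolding SB using e by simp
    then show ?thesis using B by (simp add: divide_less_eq)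
  qed
  have ratio: "(S / B) / (1 - S / B) = e" unfolding SB using e by (simp add: field_simps)
  define p where "p = 1 / lam + 1 / lam * ((S / B) / (1 - S / B))"
  have p: "p = (1 + e) / lam" unfolding p_def ratio by (simp add: add_divide_distrib)
  define r where "r = p * \<theta>"
  have r: "0 \<le> r" "r < 1"
  proof -
    have "(1 + e) * \<theta> < lam" using assms(9,10) by (simp add: e_def field_simps)
    then show "r < 1" using assms(5) by (simp add: r_def p divide_less_eq)
    show "0 \<le> r" using assms(5,9) e by (simp add: r_def p)
  qed
  interpret carleman_space M B by unfold_locales (rule B)
  define L where "L = transfer_operator T T'"
  have pull_L: "L f \<circ> abs_circle = transfer (f \<circ> abs_circle)" for f
    unfolding L_def by (rule transfer_operator_pullback) (auto simp: TF v_def)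
  \<comment> \<open>the weights of the smaller space that contains the range of \<open>L\<close>\<close>
  define V where "V = fourier_weight (B / \<theta>)"
  have B': "0 < B / \<theta>" using B assms(9) by simp
  define K where "K = sqrt ((real degree / lam) / (1 - r\<^sup>2))"
  have r2: "0 < 1 - r\<^sup>2" using r by (simp add: abs_square_less_1)
  have K: "0 < K" unfolding K_def using r2 degree_pos assms(5) by simp
  have gain: "(\<Sum>n\<in>J. (V n * cmod (coeff (L f) n))\<^sup>2) \<le> (K * hnorm f)\<^sup>2"
    if f: "f \<in> carrier" and J: "finite J" for f J
  proof -
    let ?f = "f \<circ> abs_circle"
    have sf: "smooth ?f" "periodic ?f" by (intro carrier_smooth f periodic_pullback)+
    define c where "c = sqrt (real degree / lam) * hnorm f"
    have "(\<Sum>n\<in>J. (cmod (freq n) ^ k * cmod (coeff (L f) n))\<^sup>2) \<le> (c * (r * (B / \<theta>)) ^ k * fact k * M k)\<^sup>2" for k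
    proof -
      have st: "smooth (transfer ?f)" "periodic (transfer ?f)"
        by (intro smooth_transfer periodic_transfer sf)+
      have pc: "iter_deriv k (transfer ?f) \<in> periodic_continuous"
        by (intro smooth_periodic_continuous smooth_iter_deriv periodic_iter_deriv st)
      have "(\<Sum>n\<in>J. (cmod (freq n) ^ k * cmod (coeff (L f) n))\<^sup>2) =
          (\<Sum>n\<in>J. (cmod (fourier (iter_deriv k (transfer ?f)) n))\<^sup>2)"
        by (simp add: pull_L fourier_iter_deriv[OF st] norm_mult norm_power)
      also have "\<dots> \<le> (L2_norm (iter_deriv k (transfer ?f)))\<^sup>2"
        by (rule fourier_Bessel[OF pc J])
      also have "\<dots> \<le> (c * (r * (B / \<theta>)) ^ k * fact k * M k)\<^sup>2"
      proof (rule power_mono)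
        have "L2_norm (iter_deriv k (transfer ?f)) \<le>
            sqrt (real degree / lam) * L2_norm ((twisted_deriv u ^^ k) ?f)"
          unfolding iter_deriv_transfer[OF sf(1)]
          by (intro L2_norm_transfer_le smooth_twisted_deriv_power periodic_twisted_deriv_power smooth_u periodic_u sf)
        also have "L2_norm ((twisted_deriv u ^^ k) ?f) \<le> hnorm f * p ^ k * B ^ k * fact k * M k"
          using twisted_deriv_power_bound[OF smooth_u periodic_u sf norm_u_le u_bound _ _ \<open>S < B\<close>
              hnorm_nonneg[OF f] derivative_L2_bound[OF f] p_def, of 0 k] S assms(5) by simp
        finally have "L2_norm (iter_deriv k (transfer ?f)) \<le>
            sqrt (real degree / lam) * (hnorm f * p ^ k * B ^ k * fact k * M k)"
          using assms(5) by (simp add: mult_left_mono)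
        also have "r * (B / \<theta>) = p * B" using assms(9) by (simp add: r_def)
        then have "sqrt (real degree / lam) * (hnorm f * p ^ k * B ^ k * fact k * M k) =
            c * (r * (B / \<theta>)) ^ k * fact k * M k"
          by (simp add: c_def power_mult_distrib mult_ac)
        finally show "L2_norm (iter_deriv k (transfer ?f)) \<le> c * (r * (B / \<theta>)) ^ k * fact k * M k" .
      qed (rule L2_hnorm_nonneg[OF pc])
      finally show ?thesis .
    qed
    then have "(\<Sum>n\<in>J. (V n * cmod (coeff (L f) n))\<^sup>2) \<le> c\<^sup>2 / (1 - r\<^sup>2)"
      unfolding V_def by (rule sum_fourier_weight_le[OF B' r J])
    also have "\<dots> = (K * hnorm f)\<^sup>2"
      using r2 assms(5) by (simp add: c_def K_def power_mult_distrib)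
    finally show ?thesis .
  qed
  have V_pos: "0 < V n" for n unfolding V_def by (rule fourier_weight_pos[OF B'])
  have WV: "fourier_weight B n \<le> V n" for n
    unfolding V_def using assms(9) by (intro fourier_weight_le_scale B) simp
  have L_mem: "L f \<in> carrier" if f: "f \<in> carrier" for f
  proof -
    have "(\<Sum>n\<in>J. (wcoeff (L f) n)\<^sup>2) \<le> (K * hnorm f)\<^sup>2" if J: "finite J" for J
    proof -
      have "(\<Sum>n\<in>J. (wcoeff (L f) n)\<^sup>2) \<le> (\<Sum>n\<in>J. (V n * cmod (coeff (L f) n))\<^sup>2)"
        using WV fourier_weight_pos[OF B]
        by (intro sum_mono power_mono mult_right_mono) (auto simp: less_imp_le)
      then show ?thesis using gain[OF f J] by linarith
    qed
    then have "(\<lambda>n. (wcoeff (L f) n)\<^sup>2) summable_on UNIV"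
      by (rule summable_if_bounded)
    moreover have "smooth (L f \<circ> abs_circle)"
      unfolding pull_L by (intro smooth_transfer carrier_smooth f)
    ultimately show ?thesis unfolding carrier_def smooth_functions_iff by simp
  qed
  have L_add: "L (f + g) = L f + L g" for f g unfolding L_def by (rule transfer_operator_add)
  have L_scale: "L (fscale c f) = fscale c (L f)" for c f unfolding L_def by (rule transfer_operator_scale)
  have large: "finite {n. \<delta> * V n < fourier_weight B n}" if "0 < \<delta>" for \<delta>
    unfolding V_def by (rule finite_weight_ratio_large[OF B assms(9) that])
  have compact: "compact_operator L"
    using K by (intro smoothing_operator_compact[where V = V and K = K] L_mem L_add L_scale V_pos gain large) simp_all
  define A where "A = B / (pi * \<theta>)"
  have A: "0 < A" unfolding A_def using B assms(9) by simp
  define q where "q x = weight_function M (A * x) / weight_function M (\<theta> * A * x)" for x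
  have q_pos: "0 < q x" if "0 < x" for x
    unfolding q_def using that A assms(9) by (intro divide_pos_pos weight_pos) auto
  have q_le_1: "q x \<le> 1" if "0 < x" for x
  proof -
    have "weight_function M (A * x) \<le> weight_function M (\<theta> * A * x)"
      using that A assms(9) by (intro weight_mono) auto
    moreover have "0 < weight_function M (\<theta> * A * x)"
      using that A assms(9) by (intro weight_pos) auto
    ultimately show ?thesis by (simp add: q_def)
  qed
  have sv: "singular_value L k \<le> K * (SUP x\<in>{0<..1 / real k}. q x)" if k: "1 \<le> k" for k
  proof -
    define s where "s = (SUP x\<in>{0<..1 / real k}. q x)"
    have q_le_s: "q x \<le> s" if "0 < x" "x \<le> 1 / real k" for x
      unfolding s_def using that q_le_1 by (intro cSUP_upper bdd_aboveI2[where M = 1]) auto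
    have "0 \<le> s" using q_le_s[of "1 / real k"] q_pos[of "1 / real k"] k by simp
    \<comment> \<open>the frequencies \<open>n\<close> with \<open>2 * \<bar>n\<bar> < k\<close>; there are at most \<open>k\<close> of them\<close>
    define m where "m = int ((k - 1) div 2)"
    define J where "J = {- m..m}"
    have "card J \<le> k" using k by (simp add: J_def m_def)
    moreover have "fourier_weight B n \<le> s * V n" if n: "n \<notin> J" for n
    proof -
      have n0: "n \<noteq> 0" using n by (auto simp: J_def m_def)
      have "k \<le> 2 * nat \<bar>n\<bar>" using n k by (auto simp: J_def m_def)
      then have kn: "real k \<le> 2 * \<bar>real_of_int n\<bar>" by linarith
      define x where "x = 1 / (2 * \<bar>real_of_int n\<bar>)"
      have x: "0 < x" "x \<le> 1 / real k"
        using n0 kn k by (auto simp: x_def intro!: divide_left_mono)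
      have 1: "A * x = B / \<theta> / cmod (freq n)" and 2: "\<theta> * A * x = B / cmod (freq n)"
        using assms(9) n0 by (auto simp: A_def x_def norm_freq field_simps)
      have w: "0 < weight_function M (A * x)" "0 < weight_function M (\<theta> * A * x)"
        using x A assms(9) by (auto intro!: weight_pos)
      have "fourier_weight B n = q x * V n"
        using n0 w unfolding q_def V_def fourier_weight_def 1[symmetric] 2[symmetric] by simp
      also have "\<dots> \<le> s * V n" using q_le_s[OF x] V_pos[of n] by (intro mult_right_mono) auto
      finally show ?thesis .
    qed
    ultimately show ?thesis
      unfolding s_def[symmetric] using K \<open>0 \<le> s\<close>
      by (intro smoothing_operator_singular_value[where V = V and K = K and F = J]
          L_mem L_add L_scale V_pos gain large) (auto simp: J_def)
  qed
  show ?thesis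
  proof (intro exI conjI)
    show "0 < K" "0 < A" by fact+
    show "function_hilbert_space carrier l2_ip" by unfold_locales
    show "continuous_map mtopology smooth_topology (\<lambda>f. f)" by (rule continuous_inclusion)
    show "trigonometric_polynomials \<subseteq> carrier" by (rule trigonometric_polynomials_subset)
    show "mtopology closure_of trigonometric_polynomials = carrier" by (rule trigonometric_polynomials_dense)
    show "compact_operator (transfer_operator T T')" using compact by (simp only: L_def)
    show "\<forall>k\<ge>1. singular_value (transfer_operator T T') k
      \<le> K * (SUP x\<in>{0<..1 / real k}. weight_function M (A * x) / weight_function M (\<theta> * A * x))"
      using sv unfolding L_def q_def by blast
  qed
qed

end
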